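(* Let $u\in\mathcal{D}'(\mathbb{R}^d)$, $\tau>0$, $\sigma>1$, and $(x_0,\xi_0)\in\mathbb{R}^d\times(\mathbb{R}^d\setminus\{0\})$. The following assertions are equivalent: (i) $(x_0,\xi_0)\notin \mathrm{WF}_{\{\tau,\sigma\}}(u)$ (resp. $(x_0,\xi_0)\notin \mathrm{WF}_{(\tau,\sigma)}(u)$). (ii) There exist a conic neighborhood $\Gamma$ of $\xi_0$ and a compact neighborhood $K$ of $x_0$ such that for every $\phi\in\mathcal{D}^K_{\{\tau,\sigma\}}$ (resp. $\phi\in\mathcal{D}^K_{(\tau,\sigma)}$) there exist $A,h>0$ (resp. for every $h>0$ there exists $A>0$) such that $$|\widehat{\phi u}(\xi)|\le A\,\frac{h^{N^{\sigma}}N^{\tau N^{\sigma}}}{|\xi|^{N}},\qquad N\in\mathbb{N},\ \xi\in\Gamma.$$ (iii) There exist a conic neighborhood $\Gamma$ of $\xi_0$ and a compact neighborhood $K$ of $x_0$ such that for every $\phi\in\mathcal{D}^{K-\{x_0\}}_{\{\tau,\sigma\}}$ (resp. $\phi\in\mathcal{D}^{K-\{x_0\}}_{(\tau,\sigma)}$) there exist $A,h>0$ (resp. for every $h>0$ there exists $A>0$) such that $$|V_\phi u(x,\xi)|\le A\,e^{-T_{\tau,\sigma,h}(|\xi|)},\qquad x\in K,\ \xi\in\Gamma,$$ where $K-\{x_0\}=\{y\in\mathbb{R}^d : y+x_0\in K\}$.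
   Context: Notation: $\mathbb{N}=\{0,1,2,\dots\}$. $M_p^{\tau,\sigma}=p^{\tau p^{\sigma}}$ for $p\ge1$ and $M_0^{\tau,\sigma}=1$ (so $N^{\tau N^\sigma}=1$ for $N=0$). Conic neighborhoods of $\xi_0$ are subsets of $\mathbb{R}^d\setminus\{0\}$. Function spaces: for $h>0$ and a regular compact set $K\subset\mathbb{R}^d$, $\mathcal{D}^K_{\tau,\sigma,h}$ is the Banach space of smooth functions $\phi$ with support contained in $K$ such that $$\sup_{\alpha\in\mathbb{N}^d}\sup_{x\in K}\frac{|\partial^\alpha\phi(x)|}{h^{|\alpha|^\sigma}M^{\tau,\sigma}_{|\alpha|}}<\infty .$$ Then $\mathcal{D}^K_{\{\tau,\sigma\}}=\bigcup_{h>0}\mathcal{D}^K_{\tau,\sigma,h}$ (Roumieu case) and $\mathcal{D}^K_{(\tau,\sigma)}=\bigcap_{h>0}\mathcal{D}^K_{\tau,\sigma,h}$ (Beurling case). Wave front set: for $u\in\mathcal{D}'(\mathbb{R}^d)$ and $(x_0,\xi_0)\in\mathbb{R}^d\times(\mathbb{R}^d\setminus\{0\})$, one has $(x_0,\xi_0)\notin\mathrm{WF}_{\{\tau,\sigma\}}(u)$ (resp. $(x_0,\xi_0)\notin\mathrm{WF}_{(\tau,\sigma)}(u)$) if and only if there exist a conic neighborhood $\Gamma$ of $\xi_0$, a compact neighborhood $K$ of $x_0$, and $\phi\in\mathcal{D}^K_{\{\tau,\sigma\}}$ (resp. $\phi\in\mathcal{D}^K_{(\tau,\sigma)}$) with $\phi=1$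 on some neighborhood of $x_0$, and there exist $A,h>0$ (resp. for every $h>0$ there exists $A>0$) such that $$|\widehat{\phi u}(\xi)|\le A\,\frac{h^{N^{\sigma}}N^{\tau N^{\sigma}}}{|\xi|^{N}},\qquad N\in\mathbb{N},\ \xi\in\Gamma.$$ Fourier transform: $\hat f(\xi)=\mathcal{F}f(\xi)=\int f(t)e^{-2\pi i t\cdot\xi}dt$, extended to compactly supported distributions. STFT: $V_\phi u(x,\xi)=\mathcal{F}(u\cdot T_x\overline{\phi})(\xi)$, where $T_x\phi(t)=\phi(t-x)$; for functions, $V_\phi u(x,\xi)=\int e^{-2\pi i t\cdot\xi}u(t)\overline{\phi(t-x)}\,dt$. Extended associated function: for $h,k>0$, $$T_{\tau,\sigma,h}(k)=\sup_{p\in\mathbb{N}}\ln_+\frac{h^{p^{\sigma}}k^{p}}{M_p^{\tau,\sigma}},\qquad \ln_+A=\max\{0,\ln A\}.$$ *)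

theory Defs
  imports "HOL-Analysis.Analysis"
begin

section \<open>Smooth functions on Euclidean space and their partial derivatives\<close>

definition partial_deriv :: "'n::finite \<Rightarrow> (real^'n \<Rightarrow> complex) \<Rightarrow> real^'n \<Rightarrow> complex" where
  "partial_deriv i f x = frechet_derivative f (at x) (axis i 1)"

primrec C_k :: "nat \<Rightarrow> (real^'n::finite \<Rightarrow> complex) \<Rightarrow> bool" where
  "C_k 0 f \<longleftrightarrow> continuous_on UNIV f"
| "C_k (Suc k) f \<longleftrightarrow> f differentiable_on UNIV \<and> (\<forall>i. C_k k (partial_deriv i f))"

definition smooth_fun :: "(real^'n::finite \<Rightarrow> complex) \<Rightarrow> bool" where
  "smooth_fun f \<longleftrightarrow> (\<forall>k. C_k k f)"

text \<open>The derivative for a multi-index \<open>\<alpha>\<close> needs an order in which the coordinates are processed;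
  one is chosen once and for all. For smooth functions the choice is irrelevant, as partial
  derivatives commute.\<close>

definition coords :: "'n::finite list" where
  "coords = (SOME is. distinct is \<and> set is = UNIV)"

definition multi_deriv :: "nat^'n::finite \<Rightarrow> (real^'n \<Rightarrow> complex) \<Rightarrow> real^'n \<Rightarrow> complex" where
  "multi_deriv \<alpha> f = foldr (\<lambda>i. partial_deriv i ^^ (\<alpha> $ i)) coords f"

definition multi_abs :: "nat^'n::finite \<Rightarrow> nat" where
  "multi_abs \<alpha> = (\<Sum>i\<in>UNIV. \<alpha> $ i)"

definition supp :: "(real^'n::finite \<Rightarrow> complex) \<Rightarrow> (real^'n) set" where
  "supp f = closure {x. f x \<noteq> 0}"

definition regular_compact :: "(real^'n::finite) set \<Rightarrow> bool" where
  "regular_compact K \<longleftrightarrow> compact K \<and> closure (interior K) = K"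

section \<open>Distributions\<close>

definition test_functions :: "(real^'n::finite) set \<Rightarrow> (real^'n \<Rightarrow> complex) set" where
  "test_functions K = {f. smooth_fun f \<and> supp f \<subseteq> K}"

text \<open>A distribution is a functional on functions, of which only the values on compactly supported
  smooth functions are meaningful. Continuity on \<open>\<D>(\<real>\<^sup>d)\<close> is stated by the usual seminorm
  estimates on each \<open>\<D>(K)\<close>; the suprema are over bounded sets.\<close>

definition distribution :: "((real^'n::finite \<Rightarrow> complex) \<Rightarrow> complex) \<Rightarrow> bool" where
  "distribution u \<longleftrightarrow>
     (\<forall>K f g. compact K \<longrightarrow> f \<in> test_functions K \<longrightarrow> g \<in> test_functions K \<longrightarrow>
        u (\<lambda>t. f t + g t) = u f + u g) \<and>
     (\<forall>K f c. compact K \<longrightarrow> f \<in> test_functions K \<longrightarrow> u (\<lambda>t. c * f t) = c * u f) \<and>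
     (\<forall>K. compact K \<longrightarrow> (\<exists>C m. \<forall>f\<in>test_functions K.
        norm (u f) \<le> C * (\<Sum>\<alpha> | multi_abs \<alpha> \<le> m. SUP x. norm (multi_deriv \<alpha> f x))))"

text \<open>For \<open>\<phi>\<close> smooth with compact support, \<open>\<phi> u\<close> is compactly supported, and \<open>mult_dist \<phi> u\<close> is
  its canonical extension to all of \<open>C\<^sup>\<infinity>(\<real>\<^sup>d)\<close>: the function \<open>\<phi> \<psi>\<close> is a test function for every smooth \<open>\<psi>\<close>.\<close>

definition mult_dist ::
  "(real^'n::finite \<Rightarrow> complex) \<Rightarrow> ((real^'n \<Rightarrow> complex) \<Rightarrow> complex) \<Rightarrow> (real^'n \<Rightarrow> complex) \<Rightarrow> complex" where
  "mult_dist \<phi> u = (\<lambda>\<psi>. u (\<lambda>t. \<phi> t * \<psi> t))"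

text \<open>The Fourier transform of a compactly supported distribution, viewed as a functional on
  \<open>C\<^sup>\<infinity>(\<real>\<^sup>d)\<close>: it is paired with the exponential \<open>t \<mapsto> exp (-2\<pi>i t\<cdot>\<xi>)\<close>.\<close>

definition fourier :: "((real^'n::finite \<Rightarrow> complex) \<Rightarrow> complex) \<Rightarrow> real^'n \<Rightarrow> complex" where
  "fourier v \<xi> = v (\<lambda>t. exp (- 2 * complex_of_real pi * \<i> * complex_of_real (t \<bullet> \<xi>)))"

definition translate :: "real^'n::finite \<Rightarrow> (real^'n \<Rightarrow> complex) \<Rightarrow> real^'n \<Rightarrow> complex" where
  "translate x f t = f (t - x)"

definition stft ::
  "(real^'n::finite \<Rightarrow> complex) \<Rightarrow> ((real^'n \<Rightarrow> complex) \<Rightarrow> complex) \<Rightarrow> real^'n \<Rightarrow> real^'n \<Rightarrow> complex" where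
  "stft \<phi> u x \<xi> = fourier (mult_dist (translate x (\<lambda>t. cnj (\<phi> t))) u) \<xi>"

section \<open>Extended Gevrey classes\<close>

text \<open>The case split is needed since \<open>0 powr a = 0\<close> for every \<open>a\<close>.\<close>

definition M_seq :: "real \<Rightarrow> real \<Rightarrow> nat \<Rightarrow> real" where
  "M_seq \<tau> \<sigma> p = (if p = 0 then 1 else real p powr (\<tau> * real p powr \<sigma>))"

definition D_h :: "real \<Rightarrow> real \<Rightarrow> real \<Rightarrow> (real^'n::finite) set \<Rightarrow> (real^'n \<Rightarrow> complex) set" where
  "D_h \<tau> \<sigma> h K = {\<phi>. smooth_fun \<phi> \<and> supp \<phi> \<subseteq> K \<and>
     bdd_above {norm (multi_deriv \<alpha> \<phi> x) /
                 (h powr (real (multi_abs \<alpha>) powr \<sigma>) * M_seq \<tau> \<sigma> (multi_abs \<alpha>)) | \<alpha> x. x \<in> K}}"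

definition D_Roumieu :: "real \<Rightarrow> real \<Rightarrow> (real^'n::finite) set \<Rightarrow> (real^'n \<Rightarrow> complex) set" where
  "D_Roumieu \<tau> \<sigma> K = (\<Union>h\<in>{0<..}. D_h \<tau> \<sigma> h K)"

definition D_Beurling :: "real \<Rightarrow> real \<Rightarrow> (real^'n::finite) set \<Rightarrow> (real^'n \<Rightarrow> complex) set" where
  "D_Beurling \<tau> \<sigma> K = (\<Inter>h\<in>{0<..}. D_h \<tau> \<sigma> h K)"

definition ln_plus :: "real \<Rightarrow> real" where
  "ln_plus a = max 0 (ln a)"

text \<open>For \<open>\<sigma> > 1\<close> and \<open>\<tau>, h, k > 0\<close> the supremum is over a bounded set.\<close>

definition assoc_fun :: "real \<Rightarrow> real \<Rightarrow> real \<Rightarrow> real \<Rightarrow> real" where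
  "assoc_fun \<tau> \<sigma> h k = (SUP p::nat. ln_plus (h powr (real p powr \<sigma>) * k ^ p / M_seq \<tau> \<sigma> p))"

section \<open>Wave front sets\<close>

text \<open>The library notion \<open>conic\<close> allows the factor \<open>0\<close>, hence does not describe cones in
  \<open>\<real>\<^sup>d - {0}\<close>.\<close>

definition conic_nhd :: "(real^'n::finite) set \<Rightarrow> real^'n \<Rightarrow> bool" where
  "conic_nhd \<Gamma> \<xi>0 \<longleftrightarrow> 0 \<notin> \<Gamma> \<and> (\<forall>\<xi>\<in>\<Gamma>. \<forall>c>0. c *\<^sub>R \<xi> \<in> \<Gamma>) \<and> \<xi>0 \<in> interior \<Gamma>"

text \<open>Regularity is included because the spaces of test functions are attached to regular compact
  sets only.\<close>

definition compact_nhd :: "(real^'n::finite) set \<Rightarrow> real^'n \<Rightarrow> bool" where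
  "compact_nhd K x0 \<longleftrightarrow> regular_compact K \<and> x0 \<in> interior K"

definition decay_Roumieu ::
  "real \<Rightarrow> real \<Rightarrow> (real^'n::finite) set \<Rightarrow> (real^'n \<Rightarrow> complex) \<Rightarrow> bool" where
  "decay_Roumieu \<tau> \<sigma> \<Gamma> F \<longleftrightarrow> (\<exists>A>0. \<exists>h>0. \<forall>N::nat. \<forall>\<xi>\<in>\<Gamma>.
     norm (F \<xi>) \<le> A * (h powr (real N powr \<sigma>) * M_seq \<tau> \<sigma> N / norm \<xi> ^ N))"

definition decay_Beurling ::
  "real \<Rightarrow> real \<Rightarrow> (real^'n::finite) set \<Rightarrow> (real^'n \<Rightarrow> complex) \<Rightarrow> bool" where
  "decay_Beurling \<tau> \<sigma> \<Gamma> F \<longleftrightarrow> (\<forall>h>0. \<exists>A>0. \<forall>N::nat. \<forall>\<xi>\<in>\<Gamma>.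
     norm (F \<xi>) \<le> A * (h powr (real N powr \<sigma>) * M_seq \<tau> \<sigma> N / norm \<xi> ^ N))"

definition WF_Roumieu ::
  "real \<Rightarrow> real \<Rightarrow> ((real^'n::finite \<Rightarrow> complex) \<Rightarrow> complex) \<Rightarrow> ((real^'n) \<times> (real^'n)) set" where
  "WF_Roumieu \<tau> \<sigma> u = {(x0, \<xi>0). \<xi>0 \<noteq> 0 \<and>
     \<not> (\<exists>\<Gamma> K. conic_nhd \<Gamma> \<xi>0 \<and> compact_nhd K x0 \<and>
         (\<exists>\<phi>\<in>D_Roumieu \<tau> \<sigma> K. (\<forall>\<^sub>F x in nhds x0. \<phi> x = 1) \<and>
            decay_Roumieu \<tau> \<sigma> \<Gamma> (fourier (mult_dist \<phi> u))))}"

definition WF_Beurling ::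
  "real \<Rightarrow> real \<Rightarrow> ((real^'n::finite \<Rightarrow> complex) \<Rightarrow> complex) \<Rightarrow> ((real^'n) \<times> (real^'n)) set" where
  "WF_Beurling \<tau> \<sigma> u = {(x0, \<xi>0). \<xi>0 \<noteq> 0 \<and>
     \<not> (\<exists>\<Gamma> K. conic_nhd \<Gamma> \<xi>0 \<and> compact_nhd K x0 \<and>
         (\<exists>\<phi>\<in>D_Beurling \<tau> \<sigma> K. (\<forall>\<^sub>F x in nhds x0. \<phi> x = 1) \<and>
            decay_Beurling \<tau> \<sigma> \<Gamma> (fourier (mult_dist \<phi> u))))}"

end

theory Submission
  imports Defs "HOL-Real_Asymp.Real_Asymp"
begin

text \<open>If \<open>\<phi> = 1\<close> near \<open>supp \<psi>\<close>, expand \<open>\<psi>\<close> into a Fourier series on a large cube,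
  \<open>\<psi> = \<Sum>\<^sub>k c\<^sub>k exp (2\<pi>i t \<cdot> \<eta>\<^sub>k)\<close> with \<open>\<eta>\<^sub>k = k / (2a)\<close>. Then the Fourier transform of
  \<open>\<psi> u = \<psi> \<phi> u\<close> at \<open>\<xi>\<close> is \<open>\<Sum>\<^sub>k c\<^sub>k F (\<xi> - \<eta>\<^sub>k)\<close>, where \<open>F\<close> is the transform of \<open>\<phi> u\<close>;
  this replaces the usual convolution integral and avoids Fourier inversion on \<open>\<real>\<^sup>d\<close>.
  For \<open>|\<eta>\<^sub>k| \<le> c |\<xi>|\<close> the point \<open>\<xi> - \<eta>\<^sub>k\<close> stays in the cone where \<open>F\<close> decays; for the other
  \<open>k\<close> the decay of \<open>c\<^sub>k\<close>, read off from the pure derivatives of \<open>\<psi>\<close>, beats the polynomial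
  growth of \<open>F\<close>. A shift of the index \<open>N\<close> and factors \<open>C\<^sup>N\<close> are absorbed by changing \<open>h\<close>, as
  \<open>\<sigma> > 1\<close>. The estimate depends on \<open>\<psi>\<close> only through the size of its derivatives, so it is
  uniform over translates, which gives the bound for the STFT. The converse directions
  test with a cutoff function of Gevrey type, which lies in every one of the classes.\<close>

section \<open>Smooth functions\<close>

text \<open>The crux is the new parameter \<open>H h\<close>. Far frequencies lose \<open>m\<close>
  powers to the growth of the transform of \<phi> u, where m is an order of u near the support of
  \<phi>, and \<open>2 * CARD('n)\<close> more powers to make the lattice sum converge. So
  derivatives of order \<open>N + q\<close> with \<open>q = m + 2 * CARD('n)\<close> have to be
  measured by the weight of index N. The quotient of the two values of \<open>M_seq\<close>,
  together with any factor C^N, is at most exp (N^\<sigma>) up to a constant, which multiplies h by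
  e; the shifted power of h itself costs nothing when h is at most 1. Hence
  \<open>H h = exp 1 * h\<close> for small h, and this lets the Beurling case reach every target
  parameter, while the Roumieu case is content with any \<open>H h\<close>. Bounds by powers of
  |\<xi>| and bounds by the associated function T are dual to each other: exp (- T) at k is the
  infimum over p of M_p / (h^(p^\<sigma>) k^p), so that each passage between them replaces h by 1 /
  h.\<close>

lemma partial_deriv_eq:
  "(f has_derivative f') (at x) \<Longrightarrow> partial_deriv i f x = f' (axis i 1)"
  by (simp add: partial_deriv_def frechet_derivative_at[symmetric])

lemma C_k_SucD: "C_k (Suc k) f \<Longrightarrow> C_k k f"
proof (induction k arbitrary: f)
  case 0
  then show ?case by (auto intro: differentiable_imp_continuous_on)
qed auto

lemma smooth_imp_differentiable: "smooth_fun f \<Longrightarrow> f differentiable at x"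
proof -
  assume "smooth_fun f"
  then have "C_k (Suc 0) f" unfolding smooth_fun_def by blast
  then show ?thesis by (simp add: differentiable_on_def)
qed

lemma smooth_partial_deriv: "smooth_fun f \<Longrightarrow> smooth_fun (partial_deriv i f)"
  unfolding smooth_fun_def by (metis C_k.simps(2))

lemma smooth_imp_continuous: "smooth_fun f \<Longrightarrow> continuous_on S f"
  unfolding smooth_fun_def by (metis C_k.simps(1) continuous_on_subset subset_UNIV)

text \<open>\<open>C_k\<close> asks only for differentiability before it passes to the partial
  derivatives, and continuity at level 0 follows from it. Typical invariants are explicit families,
  such as the multiples of one exponential.\<close>

lemma smooth_fun_coinduct:
  assumes "P f" and "\<And>g x. P g \<Longrightarrow> g differentiable at x" and "\<And>g i. P g \<Longrightarrow> P (partial_deriv i g)"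
  shows "smooth_fun f"
proof -
  have "C_k k g" if "P g" for k g
    using that
  proof (induction k arbitrary: g)
    case 0
    then show ?case
      by (auto intro!: differentiable_imp_continuous_on simp: differentiable_on_def assms)
  next
    case (Suc k)
    then show ?case by (auto simp: differentiable_on_def assms)
  qed
  then show ?thesis using assms(1) by (simp add: smooth_fun_def)
qed

section \<open>Sums and products of smooth functions\<close>

lemma partial_deriv_add:
  assumes "f differentiable at x" "g differentiable at x"
  shows "partial_deriv i (\<lambda>t. f t + g t) x = partial_deriv i f x + partial_deriv i g x"
  using partial_deriv_eq[OF has_derivative_add[OF assms[unfolded frechet_derivative_works]]]
  by (simp add: partial_deriv_def)

lemma partial_deriv_mult:
  assumes "f differentiable at x" "g differentiable at x"
  shows "partial_deriv i (\<lambda>t. f t * g t) x = partial_deriv i f x * g x + f x * partial_deriv i g x"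
  using partial_deriv_eq[OF has_derivative_mult[OF assms[unfolded frechet_derivative_works]]]
  by (simp add: partial_deriv_def)

lemma partial_deriv_const: "partial_deriv i (\<lambda>t. c) x = 0"
  by (simp add: partial_deriv_def)

lemma C_k_add: "C_k k f \<Longrightarrow> C_k k g \<Longrightarrow> C_k k (\<lambda>t. f t + g t)"
proof (induction k arbitrary: f g)
  case 0
  then show ?case by (auto intro: continuous_on_add)
next
  case (Suc k)
  then have "partial_deriv i (\<lambda>t. f t + g t) = (\<lambda>t. partial_deriv i f t + partial_deriv i g t)" for i
    by (auto simp: partial_deriv_add differentiable_on_def)
  then show ?case using Suc by auto
qed

lemma C_k_mult: "C_k k f \<Longrightarrow> C_k k g \<Longrightarrow> C_k k (\<lambda>t. f t * g t)"
proof (induction k arbitrary: f g)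
  case 0
  then show ?case by (auto intro: continuous_on_mult)
next
  case (Suc k)
  then have eq: "partial_deriv i (\<lambda>t. f t * g t) =
      (\<lambda>t. partial_deriv i f t * g t + f t * partial_deriv i g t)" for i
    by (auto simp: partial_deriv_mult differentiable_on_def)
  \<comment> \<open>The product rule leaves one factor undifferentiated; it is given at level
    \<open>Suc k\<close> and used at level \<open>k\<close>.\<close>
  have "C_k k f" "C_k k g"
    using Suc.prems by (blast intro: C_k_SucD)+
  then show ?case
    using Suc.prems unfolding C_k.simps eq by (auto intro!: C_k_add Suc.IH differentiable_on_mult)
qed

lemma smooth_add: "smooth_fun f \<Longrightarrow> smooth_fun g \<Longrightarrow> smooth_fun (\<lambda>t. f t + g t)"
  by (simp add: smooth_fun_def C_k_add)

lemma smooth_mult: "smooth_fun f \<Longrightarrow> smooth_fun g \<Longrightarrow> smooth_fun (\<lambda>t. f t * g t)"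
  by (simp add: smooth_fun_def C_k_mult)

lemma smooth_const: "smooth_fun (\<lambda>t. c)"
proof (rule smooth_fun_coinduct[where P = "\<lambda>g. \<exists>c. g = (\<lambda>t. c)"])
  show "\<exists>c. partial_deriv i g = (\<lambda>t. c)" if "\<exists>c. g = (\<lambda>t. c)" for g :: "real^'n::finite \<Rightarrow> complex" and i
  proof -
    from that obtain c where g: "g = (\<lambda>t. c)" ..
    have "partial_deriv i g = (\<lambda>t. 0)"
      unfolding g by (rule ext) (rule partial_deriv_const)
    then show ?thesis by blast
  qed
qed auto

lemma smooth_sum: "(\<And>k. k \<in> F \<Longrightarrow> smooth_fun (f k)) \<Longrightarrow> smooth_fun (\<lambda>t. \<Sum>k\<in>F. f k t)"
  by (induction F rule: infinite_finite_induct) (auto simp: smooth_const smooth_add)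

text \<open>Derivatives are indexed by lists of coordinates rather than multi-indices: one more
  derivative is one more \<open>Cons\<close>, so the rules below are list inductions, and the order
  prescribed by \<open>coords\<close> becomes one particular list.\<close>

definition pd :: "'n::finite list \<Rightarrow> (real^'n \<Rightarrow> complex) \<Rightarrow> real^'n \<Rightarrow> complex" where
  "pd is f = foldr partial_deriv is f"

lemma pd_Nil [simp]: "pd [] f = f"
  and pd_Cons [simp]: "pd (i # is) f = partial_deriv i (pd is f)"
  and pd_append: "pd (is @ js) f = pd is (pd js f)"
  by (simp_all add: pd_def)

lemma smooth_pd: "smooth_fun f \<Longrightarrow> smooth_fun (pd is f)"
  by (induction "is") (auto intro: smooth_partial_deriv)

lemma smooth_differentiable_pd: "smooth_fun f \<Longrightarrow> pd is f differentiable at x"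
  by (simp add: smooth_imp_differentiable smooth_pd)

lemma pd_add:
  "smooth_fun f \<Longrightarrow> smooth_fun g \<Longrightarrow> pd is (\<lambda>t. f t + g t) = (\<lambda>t. pd is f t + pd is g t)"
  by (induction "is") (auto simp: partial_deriv_add smooth_differentiable_pd)

lemma pd_zero: "pd is (\<lambda>t. 0) = (\<lambda>t. 0)"
  by (induction "is") (auto simp: partial_deriv_const)

lemma pd_sum:
  assumes "\<And>k. k \<in> F \<Longrightarrow> smooth_fun (f k)"
  shows "pd is (\<lambda>t. \<Sum>k\<in>F. f k t) = (\<lambda>t. \<Sum>k\<in>F. pd is (f k) t)"
  using assms
  by (induction F rule: infinite_finite_induct) (auto simp: pd_zero pd_add smooth_sum)

lemma pd_cmult: "smooth_fun f \<Longrightarrow> pd is (\<lambda>t. c * f t) = (\<lambda>t. c * pd is f t)"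
proof (induction "is")
  case (Cons i "is")
  then have *: "pd is f differentiable at x" for x by (simp add: smooth_differentiable_pd)
  show ?case
    using Cons by (auto simp: partial_deriv_mult[OF _ *] partial_deriv_const)
qed simp

text \<open>\<open>stft\<close> multiplies by the conjugate of a translated window. Its derivatives
  have the same absolute values as those of the window, only translated, so one set of bounds serves
  all positions x.\<close>

lemma pd_cnj_translate:
  fixes f :: "real^'n::finite \<Rightarrow> complex"
  assumes "smooth_fun f"
  shows "pd is (\<lambda>t. cnj (f (t - x))) = (\<lambda>t. cnj (pd is f (t - x)))"
    and "smooth_fun (\<lambda>t. cnj (f (t - x)))"
proof -
  have *: "((\<lambda>t. cnj (g (t - x))) has_derivative (\<lambda>h. cnj (frechet_derivative g (at (t - x)) h))) (at t)"
    if "smooth_fun g" for g :: "real^'n \<Rightarrow> complex" and t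
  proof -
    have "(g has_derivative frechet_derivative g (at (t - x))) (at (t - x))"
      using frechet_derivative_works smooth_imp_differentiable that by blast
    moreover have "((\<lambda>t. t - x) has_derivative (\<lambda>h. h)) (at t)"
      by (auto intro!: derivative_eq_intros)
    ultimately have "((\<lambda>t. g (t - x)) has_derivative (\<lambda>h. frechet_derivative g (at (t - x)) h)) (at t)"
      using has_derivative_compose by blast
    then show ?thesis by (rule bounded_linear.has_derivative[OF bounded_linear_cnj])
  qed
  have **: "partial_deriv i (\<lambda>t. cnj (g (t - x))) = (\<lambda>t. cnj (partial_deriv i g (t - x)))"
    if "smooth_fun g" for g :: "real^'n \<Rightarrow> complex" and i
    using partial_deriv_eq[OF *[OF that]] by (auto simp: partial_deriv_def)
  show "smooth_fun (\<lambda>t. cnj (f (t - x)))"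
  proof (rule smooth_fun_coinduct[where P = "\<lambda>h. \<exists>g. smooth_fun g \<and> h = (\<lambda>t. cnj (g (t - x)))"])
    show "\<exists>g. smooth_fun g \<and> (\<lambda>t. cnj (f (t - x))) = (\<lambda>t. cnj (g (t - x)))"
      using assms by blast
    show "h differentiable at y" if "\<exists>g. smooth_fun g \<and> h = (\<lambda>t. cnj (g (t - x)))" for h y
      using that * by (auto simp: differentiable_def)
    show "\<exists>g. smooth_fun g \<and> partial_deriv i h = (\<lambda>t. cnj (g (t - x)))"
      if "\<exists>g. smooth_fun g \<and> h = (\<lambda>t. cnj (g (t - x)))" for h i
    proof -
      from that obtain g where g: "smooth_fun g" "h = (\<lambda>t. cnj (g (t - x)))" by blast
      then show ?thesis
        by (intro exI[of _ "partial_deriv i g"]) (simp add: ** smooth_partial_deriv)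
    qed
  qed
  show "pd is (\<lambda>t. cnj (f (t - x))) = (\<lambda>t. cnj (pd is f (t - x)))"
    by (induction "is") (auto simp: ** smooth_pd assms)
qed

section \<open>The Leibniz rule over lists\<close>

primrec splits :: "'a list \<Rightarrow> ('a list \<times> 'a list) list" where
  "splits [] = [([], [])]"
| "splits (x # xs) = map (\<lambda>(a, b). (x # a, b)) (splits xs) @ map (\<lambda>(a, b). (a, x # b)) (splits xs)"

lemma length_splits: "length (splits xs) = 2 ^ length xs"
  by (induction xs) auto

lemma splits_length: "(a, b) \<in> set (splits xs) \<Longrightarrow> length a + length b = length xs"
  by (induction xs arbitrary: a b) auto

lemma smooth_sum_list:
  "(\<And>p. p \<in> set ps \<Longrightarrow> smooth_fun (f p)) \<Longrightarrow> smooth_fun (\<lambda>t. \<Sum>p\<leftarrow>ps. f p t)"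
  by (induction ps) (auto simp: smooth_const smooth_add)

lemma partial_deriv_sum_list:
  "(\<And>p. p \<in> set ps \<Longrightarrow> smooth_fun (f p)) \<Longrightarrow>
    partial_deriv i (\<lambda>t. \<Sum>p\<leftarrow>ps. f p t) = (\<lambda>t. \<Sum>p\<leftarrow>ps. partial_deriv i (f p) t)"
proof (induction ps)
  case (Cons p ps)
  then show ?case
    by (auto simp: partial_deriv_add smooth_imp_differentiable smooth_sum_list)
qed (auto simp: partial_deriv_const)

text \<open>A new derivative falls on either factor, which is the recursion of
  \<open>splits\<close>. Equal pairs are listed repeatedly, so that the \<open>2 ^ length is\<close>
  entries take the place of binomial coefficients.\<close>

lemma pd_mult:
  assumes "smooth_fun f" "smooth_fun g"
  shows "pd is (\<lambda>t. f t * g t) = (\<lambda>t. \<Sum>(a, b)\<leftarrow>splits is. pd a f t * pd b g t)"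
proof (induction "is")
  case (Cons i "is")
  have "pd (i # is) (\<lambda>t. f t * g t) = partial_deriv i (\<lambda>t. \<Sum>p\<leftarrow>splits is. (\<lambda>t. pd (fst p) f t * pd (snd p) g t) t)"
    using Cons by (simp add: case_prod_unfold)
  also have "\<dots> = (\<lambda>t. \<Sum>p\<leftarrow>splits is. partial_deriv i (\<lambda>t. pd (fst p) f t * pd (snd p) g t) t)"
    by (intro partial_deriv_sum_list smooth_mult smooth_pd assms)
  also have "\<dots> = (\<lambda>t. \<Sum>p\<leftarrow>splits is. pd (i # fst p) f t * pd (snd p) g t + pd (fst p) f t * pd (i # snd p) g t)"
    by (simp add: partial_deriv_mult smooth_differentiable_pd assms)
  finally show ?case
    by (simp add: case_prod_unfold o_def sum_list_addf)
qed simp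

lemma norm_sum_list_le:
  fixes f :: "'a \<Rightarrow> 'b::real_normed_vector"
  assumes "\<And>x. x \<in> set xs \<Longrightarrow> norm (f x) \<le> b"
  shows "norm (\<Sum>x\<leftarrow>xs. f x) \<le> real (length xs) * b"
  using assms
proof (induction xs)
  case (Cons x xs)
  then have "norm (f x) \<le> b" "norm (\<Sum>x\<leftarrow>xs. f x) \<le> real (length xs) * b" by auto
  then show ?case
    using norm_triangle_ineq[of "f x" "\<Sum>x\<leftarrow>xs. f x"] by (simp add: algebra_simps)
qed simp

lemma norm_pd_mult_le:
  assumes "smooth_fun f" "smooth_fun g"
    and "\<And>a b. length a + length b = length is \<Longrightarrow> norm (pd a f t) * norm (pd b g t) \<le> B"
  shows "norm (pd is (\<lambda>t. f t * g t) t) \<le> 2 ^ length is * B"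
proof -
  have "norm (\<Sum>(a, b)\<leftarrow>splits is. pd a f t * pd b g t) \<le> real (length (splits is)) * B"
    by (rule norm_sum_list_le) (auto simp: norm_mult intro!: assms(3) dest: splits_length)
  then show ?thesis by (simp add: pd_mult assms length_splits)
qed

section \<open>Exponentials\<close>

definition wave :: "real^'n::finite \<Rightarrow> real^'n \<Rightarrow> complex" where
  "wave \<eta> t = exp (- 2 * complex_of_real pi * \<i> * complex_of_real (t \<bullet> \<eta>))"

lemma wave_eq_cis: "wave \<eta> t = cis (- (2 * pi * (t \<bullet> \<eta>)))"
  by (simp add: wave_def cis_conv_exp mult_ac)

lemma norm_wave [simp]: "norm (wave \<eta> t) = 1"
  by (simp add: wave_eq_cis)

lemma wave_add: "wave (\<eta> + \<zeta>) t = wave \<eta> t * wave \<zeta> t"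
  by (simp add: wave_eq_cis cis_mult inner_add_right algebra_simps)

lemma wave_0 [simp]: "wave 0 t = 1"
  by (simp add: wave_eq_cis)

lemma cnj_wave: "cnj (wave \<eta> t) = wave (- \<eta>) t"
  by (simp add: wave_eq_cis cis_cnj)

lemma has_derivative_wave:
  "(wave \<eta> has_derivative (\<lambda>h. (- 2 * complex_of_real pi * \<i> * complex_of_real (h \<bullet> \<eta>)) * wave \<eta> x)) (at x)"
proof -
  have "((\<lambda>t. - 2 * complex_of_real pi * \<i> * complex_of_real (t \<bullet> \<eta>)) has_derivative
      (\<lambda>h. - 2 * complex_of_real pi * \<i> * complex_of_real (h \<bullet> \<eta>))) (at x)"
    by (intro has_derivative_mult_right has_derivative_of_real has_derivative_inner_left
        has_derivative_ident)
  from has_derivative_compose[OF this DERIV_exp[THEN has_field_derivative_imp_has_derivative]]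
  show ?thesis by (simp add: wave_def[abs_def] mult_ac)
qed

lemma partial_deriv_wave:
  "partial_deriv i (wave \<eta>) = (\<lambda>t. (- 2 * complex_of_real pi * \<i> * complex_of_real (\<eta> $ i)) * wave \<eta> t)"
  using partial_deriv_eq[OF has_derivative_wave] by (auto simp: inner_axis')

lemma smooth_wave: "smooth_fun (wave \<eta>)"
proof (rule smooth_fun_coinduct[where P = "\<lambda>g. \<exists>c. g = (\<lambda>t. c * wave \<eta> t)"])
  have d: "wave \<eta> differentiable at x" for x
    using has_derivative_wave by (auto simp: differentiable_def)
  show "\<exists>c. wave \<eta> = (\<lambda>t. c * wave \<eta> t)" by (rule exI[of _ 1]) simp
  show "g differentiable at x" if "\<exists>c. g = (\<lambda>t. c * wave \<eta> t)" for g x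
    using that d by (auto intro: derivative_intros)
  show "\<exists>c. partial_deriv i g = (\<lambda>t. c * wave \<eta> t)" if "\<exists>c. g = (\<lambda>t. c * wave \<eta> t)" for g i
  proof -
    from that obtain c where g: "g = (\<lambda>t. c * wave \<eta> t)" ..
    have "partial_deriv i g t = (c * (- 2 * complex_of_real pi * \<i> * complex_of_real (\<eta> $ i))) * wave \<eta> t" for t
      unfolding g by (subst partial_deriv_mult) (auto simp: d partial_deriv_const partial_deriv_wave)
    then show ?thesis by (intro exI ext)
  qed
qed

text \<open>The Fourier symbol of \<open>pd is\<close>. At \<open>- freq a k\<close> it is also the
  factor by which \<open>pd is\<close> acts on a Fourier coefficient.\<close>

definition wave_symbol :: "'n::finite list \<Rightarrow> real^'n \<Rightarrow> complex" where
  "wave_symbol is \<eta> = (\<Prod>j\<leftarrow>is. - 2 * complex_of_real pi * \<i> * complex_of_real (\<eta> $ j))"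

lemma pd_wave: "pd is (wave \<eta>) = (\<lambda>t. wave_symbol is \<eta> * wave \<eta> t)"
proof (induction "is")
  case (Cons i "is")
  have "partial_deriv i (\<lambda>t. wave_symbol is \<eta> * wave \<eta> t) = (\<lambda>t. wave_symbol (i # is) \<eta> * wave \<eta> t)"
    using pd_cmult[OF smooth_wave, of "[i]" "wave_symbol is \<eta>" \<eta>]
    by (simp add: partial_deriv_wave) (simp add: wave_symbol_def mult_ac)
  then show ?case using Cons by simp
qed (simp add: wave_symbol_def)

lemma norm_wave_symbol_le: "norm (wave_symbol is \<eta>) \<le> (2 * pi * norm \<eta>) ^ length is"
proof (induction "is")
  case (Cons i "is")
  have "\<bar>\<eta> $ i\<bar> \<le> norm \<eta>" by (rule component_le_norm_cart)
  with Cons have "2 * pi * \<bar>\<eta> $ i\<bar> * norm (wave_symbol is \<eta>) \<le> 2 * pi * norm \<eta> * (2 * pi * norm \<eta>) ^ length is"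
    by (intro mult_mono) auto
  then show ?case by (simp add: wave_symbol_def norm_mult)
qed (simp add: wave_symbol_def)

subsection \<open>Supports\<close>

lemma not_in_supp: "x \<notin> supp f \<Longrightarrow> f x = 0"
  using closure_subset[of "{x. f x \<noteq> 0}"] by (auto simp: supp_def)

lemma supp_subset: "closed S \<Longrightarrow> (\<And>x. x \<notin> S \<Longrightarrow> f x = 0) \<Longrightarrow> supp f \<subseteq> S"
  unfolding supp_def by (intro closure_minimal) auto

lemma partial_deriv_outside_supp: "x \<notin> supp f \<Longrightarrow> partial_deriv i f x = 0"
proof -
  assume x: "x \<notin> supp f"
  have "((\<lambda>t. 0) has_derivative (\<lambda>h. 0)) (at x)" by simp
  then have "(f has_derivative (\<lambda>h. 0)) (at x)"
    by (rule has_derivative_transform_within_open[of _ _ _ _ "- supp f"])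
      (use x not_in_supp in \<open>auto simp: supp_def\<close>)
  then show ?thesis by (rule partial_deriv_eq)
qed

lemma pd_outside_supp: "x \<notin> supp f \<Longrightarrow> pd is f x = 0"
proof (induction "is" arbitrary: x)
  case (Cons i "is")
  have "supp (pd is f) \<subseteq> supp f"
    by (intro supp_subset Cons.IH) (auto simp: supp_def)
  then show ?case using Cons.prems by (auto intro: partial_deriv_outside_supp)
qed (simp add: not_in_supp)

lemma bounded_pd:
  fixes f :: "real^'n::finite \<Rightarrow> complex"
  assumes "smooth_fun f" "supp f \<subseteq> K" "compact K"
  shows "\<exists>B\<ge>0. \<forall>is t. length is \<le> m \<longrightarrow> norm (pd is f t) \<le> B"
proof -
  have "\<exists>B\<ge>0. \<forall>t. norm (pd is f t) \<le> B" for "is" :: "'n list"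
  proof -
    have "bounded (pd is f ` K)"
      by (intro compact_imp_bounded compact_continuous_image smooth_imp_continuous smooth_pd assms)
    then obtain B where B: "\<And>t. t \<in> K \<Longrightarrow> norm (pd is f t) \<le> B" by (auto simp: bounded_iff)
    have "norm (pd is f t) \<le> max 0 B" for t
      using B[of t] pd_outside_supp[of t f "is"] assms(2) by (cases "t \<in> K") (auto simp: subset_iff le_max_iff_disj)
    then show ?thesis by (intro exI[of _ "max 0 B"]) auto
  qed
  then obtain B where B: "\<And>is. B is \<ge> 0" "\<And>is t. norm (pd is f t) \<le> B is" by metis
  let ?L = "{is :: 'n list. length is \<le> m}"
  have "finite ?L" using finite_lists_length_le[of "UNIV :: 'n set" m] by simp
  then have "B is \<le> (\<Sum>js\<in>?L. B js)" if "length is \<le> m" for "is"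
    using that B(1) by (intro member_le_sum) auto
  then show ?thesis
    using B by (intro exI[of _ "\<Sum>js\<in>?L. B js"]) (auto intro!: sum_nonneg intro: order_trans[OF B(2)])
qed

section \<open>Multi-indices as lists, and seminorm estimates\<close>

lemma coords: "distinct (coords :: 'n::finite list)" "set (coords :: 'n list) = UNIV"
proof -
  have "\<exists>is :: 'n list. distinct is \<and> set is = UNIV"
    using finite_distinct_list[of "UNIV :: 'n set"] by auto
  then have "distinct (coords :: 'n list) \<and> set (coords :: 'n list) = UNIV"
    unfolding coords_def by (rule someI_ex)
  then show "distinct (coords :: 'n list)" "set (coords :: 'n list) = UNIV" by auto
qed

lemma funpow_partial_deriv: "(partial_deriv i ^^ n) f = pd (replicate n i) f"
  by (induction n) (auto simp: pd_def)

definition expand_index :: "nat^'n::finite \<Rightarrow> 'n list" where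
  "expand_index \<alpha> = concat (map (\<lambda>i. replicate (\<alpha> $ i) i) coords)"

lemma multi_deriv_eq_pd: "multi_deriv \<alpha> f = pd (expand_index \<alpha>) f"
proof -
  have "foldr (\<lambda>i. partial_deriv i ^^ (\<alpha> $ i)) js f = pd (concat (map (\<lambda>i. replicate (\<alpha> $ i) i) js)) f" for js
    by (induction js) (auto simp: pd_append funpow_partial_deriv)
  then show ?thesis by (simp add: multi_deriv_def expand_index_def)
qed

lemma length_expand_index: "length (expand_index \<alpha>) = multi_abs \<alpha>"
proof -
  have "length (expand_index \<alpha>) = (\<Sum>i\<leftarrow>coords. \<alpha> $ i)"
    by (simp add: expand_index_def length_concat o_def)
  also have "\<dots> = multi_abs \<alpha>"
    by (simp add: multi_abs_def sum_list_distinct_conv_sum_set[OF coords(1)] coords(2))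
  finally show ?thesis .
qed

text \<open>A list that repeats a single coordinate is insensitive to the order chosen in
  \<open>coords\<close>. The decay of Fourier coefficients is read off from such pure derivatives,
  so this is the link between the classes and the estimates.\<close>

lemma pd_replicate_eq_multi_deriv:
  obtains \<alpha> where "multi_abs \<alpha> = N" "\<And>f. pd (replicate N i) f = multi_deriv \<alpha> f"
proof
  let ?\<alpha> = "\<chi> j. if j = i then N else 0"
  show "multi_abs ?\<alpha> = N" by (simp add: multi_abs_def)
  show "pd (replicate N i) f = multi_deriv ?\<alpha> f" for f
  proof -
    have "concat (map (\<lambda>j. replicate (?\<alpha> $ j) j) js) = (if i \<in> set js then replicate N i else [])"
      if "distinct js" for js
      using that by (induction js) auto
    from this[OF coords(1)] show ?thesis
      by (simp add: multi_deriv_eq_pd expand_index_def coords(2))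
  qed
qed

text \<open>The sum of suprema is replaced by one common bound \<open>b\<close> for all list
  derivatives up to order \<open>m\<close>; the number of multi-indices goes into the
  constant.\<close>

lemma distribution_bound:
  fixes u :: "(real^'n::finite \<Rightarrow> complex) \<Rightarrow> complex"
  assumes "distribution u" "compact K"
  shows "\<exists>C\<ge>0. \<exists>m. \<forall>f\<in>test_functions K. \<forall>b.
    (\<forall>is x. length is \<le> m \<longrightarrow> norm (pd is f x) \<le> b) \<longrightarrow> norm (u f) \<le> C * b"
proof -
  have "\<forall>K. compact K \<longrightarrow> (\<exists>C m. \<forall>f\<in>test_functions K.
      norm (u f) \<le> C * (\<Sum>\<alpha> | multi_abs \<alpha> \<le> m. SUP x. norm (multi_deriv \<alpha> f x)))"
    using assms(1) unfolding distribution_def by (elim conjE)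
  with assms(2) have "\<exists>C m. \<forall>f\<in>test_functions K.
      norm (u f) \<le> C * (\<Sum>\<alpha> | multi_abs \<alpha> \<le> m. SUP x. norm (multi_deriv \<alpha> f x))"
    by blast
  then obtain C m where Cm: "\<And>f. f \<in> test_functions K \<Longrightarrow>
      norm (u f) \<le> C * (\<Sum>\<alpha> | multi_abs \<alpha> \<le> m. SUP x. norm (multi_deriv \<alpha> f x))"
    by blast
  let ?S = "{\<alpha> :: nat^'n. multi_abs \<alpha> \<le> m}"
  have main: "norm (u f) \<le> \<bar>C\<bar> * real (card ?S) * b" if f: "f \<in> test_functions K"
    and b: "\<And>is x. length is \<le> m \<Longrightarrow> norm (pd is f x) \<le> b" for f b
  proof -
    have "\<bar>SUP x. norm (multi_deriv \<alpha> f x)\<bar> \<le> b" if "multi_abs \<alpha> \<le> m" for \<alpha>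
    proof -
      have le: "norm (multi_deriv \<alpha> f x) \<le> b" for x
        by (simp add: multi_deriv_eq_pd b length_expand_index that)
      then have "(SUP x. norm (multi_deriv \<alpha> f x)) \<le> b" by (intro cSUP_least) auto
      moreover have "norm (multi_deriv \<alpha> f 0) \<le> (SUP x. norm (multi_deriv \<alpha> f x))"
        using le by (intro cSUP_upper bdd_aboveI) auto
      ultimately show ?thesis
        using norm_ge_zero[of "multi_deriv \<alpha> f 0"] by linarith
    qed
    then have *: "\<bar>\<Sum>\<alpha>\<in>?S. SUP x. norm (multi_deriv \<alpha> f x)\<bar> \<le> real (card ?S) * b"
      by (intro order_trans[OF sum_abs] sum_bounded_above) auto
    \<comment> \<open>The constant in the definition of a distribution may be negative, hence the
      absolute value.\<close>
    have "norm (u f) \<le> \<bar>C * (\<Sum>\<alpha>\<in>?S. SUP x. norm (multi_deriv \<alpha> f x))\<bar>"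
      using Cm[OF f] by linarith
    also have "\<dots> \<le> \<bar>C\<bar> * (real (card ?S) * b)"
      unfolding abs_mult using * by (intro mult_left_mono) auto
    finally show ?thesis by (simp add: mult_ac)
  qed
  show ?thesis
  proof (intro exI conjI ballI allI impI)
    show "norm (u f) \<le> \<bar>C\<bar> * real (card ?S) * b"
      if "f \<in> test_functions K" and "\<forall>is x. length is \<le> m \<longrightarrow> norm (pd is f x) \<le> b" for f b
      using main[OF that(1)] that(2) by blast
  qed simp
qed

section \<open>Fourier series of compactly supported smooth functions\<close>

definition cube :: "real \<Rightarrow> (real^'n::finite) set" where
  "cube a = cbox (\<chi> i. - a) (\<chi> i. a)"

lemma mem_cube: "t \<in> cube a \<longleftrightarrow> (\<forall>i. \<bar>t $ i\<bar> \<le> a)"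
  by (simp add: cube_def mem_box_cart abs_le_iff all_conj_distrib minus_le_iff[of a] conj_commute)

lemma compact_cube: "compact (cube a)"
  by (simp add: cube_def)

lemma has_integral_cube_split:
  assumes "(f has_integral I) (cbox a b \<inter> {x. x $ i \<le> c})" "(f has_integral J) (cbox a b \<inter> {x. x $ i \<ge> c})"
  shows "(f has_integral I + J) (cbox a (b :: real^'n::finite))"
  using has_integral_split[of f I a b "axis i 1" c J] assms by (simp add: inner_axis axis_in_Basis_iff)

text \<open>Moving the cube by \<open>s\<close> in direction \<open>i\<close> removes the slab
  \<open>t $ i \<le> - a + s\<close> and adds the slab beyond the opposite face, which is the
  removed one moved by \<open>2 * a\<close>. Periodicity is therefore asked on the removed slab
  only.\<close>

lemma integral_translated_cube:
  fixes G :: "real^'n::finite \<Rightarrow> complex"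
  assumes "continuous_on UNIV G" "0 \<le> s" "s \<le> 2 * a"
    and per: "\<And>t. t \<in> cube a \<Longrightarrow> t $ i \<le> - a + s \<Longrightarrow> G (t + axis i (2 * a)) = G t"
  shows "integral (cube a) (\<lambda>t. G (t + axis i s)) = integral (cube a) G"
proof -
  have int: "(G has_integral integral (cbox l h) G) (cbox l h)" for l h
    using assms(1) by (intro integrable_integral integrable_continuous) (auto intro: continuous_on_subset)
  note split = interval_split_cart[unfolded interval_cbox_cart]
  define lo hi :: "real^'n" where "lo = (\<chi> j. - a)" and "hi = (\<chi> j. a)"
  define lo' hi' :: "real^'n" where "lo' = (\<chi> j. if j = i then - a + s else - a)"
    and "hi' = (\<chi> j. if j = i then - a + s else a)"
  have 1: "(G has_integral integral (cbox lo hi') G + integral (cbox lo' hi) G) (cbox lo hi)"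
  proof (rule has_integral_cube_split)
    have "cbox lo hi \<inter> {x. x $ i \<le> - a + s} = cbox lo hi'"
      using assms(2,3) unfolding split
      by (intro arg_cong2[of _ _ _ _ cbox]) (auto simp: vec_eq_iff lo_def hi_def hi'_def)
    then show "(G has_integral integral (cbox lo hi') G) (cbox lo hi \<inter> {x. x $ i \<le> - a + s})"
      by (simp add: int)
    have "cbox lo hi \<inter> {x. x $ i \<ge> - a + s} = cbox lo' hi"
      using assms(2,3) unfolding split
      by (intro arg_cong2[of _ _ _ _ cbox]) (auto simp: vec_eq_iff lo_def hi_def lo'_def)
    then show "(G has_integral integral (cbox lo' hi) G) (cbox lo hi \<inter> {x. x $ i \<ge> - a + s})"
      by (simp add: int)
  qed
  have 2: "(G has_integral integral (cbox lo' hi) G + integral (cbox lo hi') G) (cbox (lo + axis i s) (hi + axis i s))"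
  proof (rule has_integral_cube_split)
    have "cbox (lo + axis i s) (hi + axis i s) \<inter> {x. x $ i \<le> a} = cbox lo' hi"
      using assms(2,3) unfolding split
      by (intro arg_cong2[of _ _ _ _ cbox]) (auto simp: vec_eq_iff lo_def hi_def lo'_def axis_def)
    then show "(G has_integral integral (cbox lo' hi) G) (cbox (lo + axis i s) (hi + axis i s) \<inter> {x. x $ i \<le> a})"
      by (simp add: int)
    have eq: "cbox (lo + axis i s) (hi + axis i s) \<inter> {x. x $ i \<ge> a}
        = cbox (lo + axis i (2 * a)) (hi' + axis i (2 * a))"
      using assms(2,3) unfolding split
      by (intro arg_cong2[of _ _ _ _ cbox]) (auto simp: vec_eq_iff lo_def hi_def hi'_def axis_def)
    have "((\<lambda>x. G (x + axis i (2 * a))) has_integral integral (cbox (lo + axis i (2 * a)) (hi' + axis i (2 * a))) G)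
        (cbox lo hi')"
      using has_integral_affinity'[OF int[of "lo + axis i (2 * a)" "hi' + axis i (2 * a)"], of 1 "axis i (2 * a)"]
      by simp
    moreover have "G (x + axis i (2 * a)) = G x" if "x \<in> cbox lo hi'" for x
    proof (rule per)
      show "x \<in> cube a"
        unfolding mem_cube
      proof
        fix j show "\<bar>x $ j\<bar> \<le> a"
          using that[unfolded mem_box_cart, THEN spec, of j] assms(2,3)
          by (auto simp: lo_def hi'_def split: if_splits)
      qed
      show "x $ i \<le> - a + s"
        using that[unfolded mem_box_cart, THEN spec, of i] by (simp add: hi'_def)
    qed
    ultimately have "(G has_integral integral (cbox (lo + axis i (2 * a)) (hi' + axis i (2 * a))) G) (cbox lo hi')"
      by (rule has_integral_eq[rotated])
    then have "integral (cbox lo hi') G = integral (cbox (lo + axis i (2 * a)) (hi' + axis i (2 * a))) G"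
      by (rule integral_unique)
    then show "(G has_integral integral (cbox lo hi') G) (cbox (lo + axis i s) (hi + axis i s) \<inter> {x. x $ i \<ge> a})"
      by (simp add: int eq)
  qed
  have "((\<lambda>t. G (t + axis i s)) has_integral integral (cbox lo' hi) G + integral (cbox lo hi') G) (cbox lo hi)"
    using has_integral_affinity'[OF 2, of 1 "axis i s"] by simp
  with 1 show ?thesis
    unfolding cube_def lo_def[symmetric] hi_def[symmetric] by (simp add: integral_unique add.commute)
qed

text \<open>The integral of the shifted function is constant for shifts in
  \<open>{0..\<epsilon>}\<close>; differentiating it at 0 under the integral sign gives the integral
  of the partial derivative. Periodicity near one face covers both the exponentials and the
  functions that vanish near the two faces.\<close>

lemma integral_partial_deriv_cube:
  fixes G :: "real^'n::finite \<Rightarrow> complex"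
  assumes G: "smooth_fun G" and "0 < \<epsilon>" "\<epsilon> \<le> 2 * a"
    and per: "\<And>t. t \<in> cube a \<Longrightarrow> t $ i \<le> - a + \<epsilon> \<Longrightarrow> G (t + axis i (2 * a)) = G t"
  shows "integral (cube a) (partial_deriv i G) = 0"
proof -
  have shift: "((\<lambda>s. t + axis i s) has_derivative (\<lambda>h. axis i h)) (at s within S)" for t :: "real^'n" and s :: real and S
  proof -
    have "bounded_linear (\<lambda>h. axis i h :: real^'n)"
      by (subst linear_conv_bounded_linear[symmetric]) (auto simp: linear_iff axis_def vec_eq_iff)
    then have "((\<lambda>s. axis i s :: real^'n) has_derivative (\<lambda>h. axis i h)) (at s within S)"
      by (rule bounded_linear_imp_has_derivative)
    then show ?thesis by (auto intro!: derivative_eq_intros)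
  qed
  have "((\<lambda>s. integral (cube a) (\<lambda>t. G (t + axis i s))) has_vector_derivative
      integral (cube a) (\<lambda>t. partial_deriv i G (t + axis i 0))) (at 0 within {0..\<epsilon>})"
    unfolding cube_def
  proof (rule leibniz_rule_vector_derivative)
    fix s t assume "s \<in> {0..\<epsilon>}"
    have "(G has_derivative frechet_derivative G (at (t + axis i s))) (at (t + axis i s))"
      using G frechet_derivative_works smooth_imp_differentiable by blast
    from has_derivative_compose[OF shift this]
    have "((\<lambda>s. G (t + axis i s)) has_derivative (\<lambda>h. frechet_derivative G (at (t + axis i s)) (axis i h)))
        (at s within {0..\<epsilon>})" .
    moreover have "frechet_derivative G (at (t + axis i s)) (axis i h) = h *\<^sub>R partial_deriv i G (t + axis i s)" for h
    proof -
      have "axis i h = h *\<^sub>R (axis i 1 :: real^'n)" by (simp add: axis_def vec_eq_iff)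
      moreover have "linear (frechet_derivative G (at (t + axis i s)))"
        using G smooth_imp_differentiable by (intro linear_frechet_derivative)
      ultimately show ?thesis by (simp add: partial_deriv_def linear_scale)
    qed
    ultimately show "((\<lambda>s. G (t + axis i s)) has_vector_derivative partial_deriv i G (t + axis i s)) (at s within {0..\<epsilon>})"
      by (simp add: has_vector_derivative_def)
  next
    fix s
    have "continuous_on (cbox (\<chi> i. - a) (\<chi> i. a)) (\<lambda>t. G (t + axis i s))"
      by (rule continuous_on_compose2[OF smooth_imp_continuous[OF G, of UNIV]]) (auto intro!: continuous_intros)
    then show "(\<lambda>t. G (t + axis i s)) integrable_on cbox (\<chi> i. - a) (\<chi> i. a)"
      by (rule integrable_continuous)
  next
    have cont: "continuous_on A (\<lambda>p. snd p + axis i (fst p) :: real^'n)" for A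
    proof -
      have "continuous_on (fst ` A) (\<lambda>s. 0 + axis i s :: real^'n)"
        using shift by (intro has_derivative_continuous_on) blast
      then have "continuous_on (fst ` A) (\<lambda>s. axis i s :: real^'n)" by simp
      then have "continuous_on A (\<lambda>p. axis i (fst p) :: real^'n)"
        by (rule continuous_on_compose2) (auto intro!: continuous_intros)
      then show ?thesis by (intro continuous_intros)
    qed
    show "continuous_on ({0..\<epsilon>} \<times> cbox (\<chi> i. - a) (\<chi> i. a)) (\<lambda>(s, t). partial_deriv i G (t + axis i s))"
      unfolding case_prod_unfold
      by (rule continuous_on_compose2[OF smooth_imp_continuous[OF smooth_partial_deriv[OF G], of UNIV] cont]) auto
  qed (use assms in auto)
  then have 1: "((\<lambda>s. integral (cube a) (\<lambda>t. G (t + axis i s))) has_vector_derivative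
      integral (cube a) (partial_deriv i G)) (at 0 within {0..\<epsilon>})"
    by (simp add: axis_def zero_vec_def[symmetric])
  have 2: "integral (cube a) (\<lambda>t. G (t + axis i s)) = integral (cube a) G" if "s \<in> {0..\<epsilon>}" for s
    using that assms by (intro integral_translated_cube smooth_imp_continuous[OF G] per) auto
  have "((\<lambda>s. integral (cube a) G) has_vector_derivative
      integral (cube a) (partial_deriv i G)) (at 0 within {0..\<epsilon>})"
    by (rule has_vector_derivative_transform[OF _ _ 1]) (use 2 assms in auto)
  moreover have "((\<lambda>s. integral (cube a) G) has_vector_derivative 0) (at 0 within {0..\<epsilon>})"
    by simp
  \<comment> \<open>The derivative is one-sided, which determines it since 0 is a limit point of
    \<open>{0..\<epsilon>}\<close>.\<close>
  ultimately show ?thesis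
    using vector_derivative_unique_within[of 0 "{0..\<epsilon>}"] assms(2)
    by (metis atLeastAtMost_iff islimpt_Icc less_eq_real_def trivial_limit_within)
qed

section \<open>The dual lattice and Fourier coefficients\<close>

definition freq :: "real \<Rightarrow> ('n \<Rightarrow> int) \<Rightarrow> real^'n::finite" where
  "freq a k = (\<chi> i. real_of_int (k i) / (2 * a))"

lemma freq_nth [simp]: "freq a k $ i = real_of_int (k i) / (2 * a)"
  by (simp add: freq_def)

lemma freq_add: "freq a k + freq a l = freq a (\<lambda>i. k i + l i)"
  by (simp add: vec_eq_iff add_divide_distrib)

lemma freq_minus: "- freq a k = freq a (\<lambda>i. - k i)"
  by (simp add: vec_eq_iff)

lemma wave_freq_periodic:
  assumes "a > 0"
  shows "wave (freq a k) (t + axis i (2 * a)) = wave (freq a k) t"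
proof -
  have "(t + axis i (2 * a)) \<bullet> freq a k = t \<bullet> freq a k + of_int (k i)"
    using assms by (simp add: inner_add_left inner_axis')
  then have "wave (freq a k) (t + axis i (2 * a)) = wave (freq a k) t * cis (- (2 * pi * of_int (k i)))"
    by (simp add: wave_eq_cis cis_mult algebra_simps)
  moreover have "cis (- (2 * pi * of_int (k i))) = 1"
    using cis_multiple_2pi[of "- of_int (k i)"] by simp
  ultimately show ?thesis by simp
qed

text \<open>If \<open>k i \<noteq> 0\<close>, then \<partial>_i multiplies the exponential by a
  nonzero constant, while the integral of the derivative vanishes by periodicity.\<close>

lemma integral_wave_freq:
  fixes k :: "'n::finite \<Rightarrow> int"
  assumes a: "a > 0"
  shows "integral (cube a) (wave (freq a k)) = (if k = (\<lambda>i. 0) then (2 * a) ^ CARD('n) else 0)"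
proof (cases "k = (\<lambda>i. 0)")
  case True
  then have "freq a k = 0" by (simp add: vec_eq_iff)
  then have "integral (cube a) (wave (freq a k)) = integral (cube a) (\<lambda>t :: real^'n. 1 :: complex)"
    by (intro integral_cong) simp
  also have "\<dots> = measure lborel (cube a :: (real^'n) set)"
    by (simp add: cube_def scaleR_conv_of_real)
  also have "measure lborel (cube a :: (real^'n) set) = (2 * a) ^ CARD('n)"
    using a unfolding cube_def
    by (subst content_cbox_cart) (auto simp: interval_eq_empty_cart)
  finally show ?thesis using True by simp
next
  case False
  then obtain i where i: "k i \<noteq> 0" by auto
  let ?c = "- 2 * complex_of_real pi * \<i> * complex_of_real (freq a k $ i)"
  have "integral (cube a) (partial_deriv i (wave (freq a k))) = 0"
    by (rule integral_partial_deriv_cube[where \<epsilon> = a]) (use a in \<open>auto simp: smooth_wave wave_freq_periodic\<close>)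
  then have "?c * integral (cube a) (wave (freq a k)) = 0"
    unfolding partial_deriv_wave by simp
  then show ?thesis using i a False by simp
qed

definition fcoeff :: "real \<Rightarrow> (real^'n::finite \<Rightarrow> complex) \<Rightarrow> ('n \<Rightarrow> int) \<Rightarrow> complex" where
  "fcoeff a f k = integral (cube a) (\<lambda>t. f t * wave (freq a k) t) / (2 * a) ^ CARD('n)"

lemma continuous_wave: "continuous_on S (wave \<eta>)"
  by (simp add: smooth_imp_continuous smooth_wave)

lemma integrable_cube: "continuous_on (cube a) f \<Longrightarrow> f integrable_on cube a"
  for f :: "real^'n::finite \<Rightarrow> complex"
  by (simp add: cube_def integrable_continuous)

lemma fcoeff_partial_deriv:
  fixes f :: "real^'n::finite \<Rightarrow> complex"
  assumes f: "smooth_fun f" "supp f \<subseteq> cube r" and r: "0 < r" "r < a"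
  shows "fcoeff a (partial_deriv i f) k = 2 * pi * \<i> * (freq a k $ i) * fcoeff a f k"
proof -
  let ?G = "\<lambda>t. f t * wave (freq a k) t"
  have z: "f t = 0" if "\<bar>t $ i\<bar> > r" for t
  proof -
    have "t \<notin> cube r" using that by (auto simp: mem_cube not_le)
    then show ?thesis using f(2) not_in_supp by blast
  qed
  \<comment> \<open>With \<epsilon> half the gap between the cubes, a point with
    \<open>t $ i \<le> - a + \<epsilon>\<close> has \<open>t $ i < - r\<close>, and its translate by
    \<open>2 * a\<close> has coordinate at least \<open>a > r\<close>. Both values of
    \<open>f\<close> are therefore 0.\<close>
  have "integral (cube a) (partial_deriv i ?G) = 0"
  proof (rule integral_partial_deriv_cube[where \<epsilon> = "(a - r) / 2"])
    fix t :: "real^'n" assume t: "t \<in> cube a" "t $ i \<le> - a + (a - r) / 2"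
    have "- a \<le> t $ i" using t(1)[unfolded mem_cube, THEN spec, of i] by linarith
    then have "f t = 0" "f (t + axis i (2 * a)) = 0"
      using t(2) r by (auto intro!: z simp: abs_if field_simps)
    then show "?G (t + axis i (2 * a)) = ?G t" by simp
  qed (use r in \<open>auto intro: smooth_mult f smooth_wave simp: field_simps\<close>)
  then have *: "integral (cube a) (partial_deriv i ?G) = 0" .
  have i1: "continuous_on (cube a) (\<lambda>t. partial_deriv i f t * wave (freq a k) t)"
    and i2: "continuous_on (cube a) ?G"
    by (intro smooth_imp_continuous smooth_mult smooth_partial_deriv f smooth_wave)+
  note *
  also have "partial_deriv i ?G = (\<lambda>t. partial_deriv i f t * wave (freq a k) t
      + (- 2 * complex_of_real pi * \<i> * complex_of_real (freq a k $ i)) * ?G t)"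
    by (rule ext, subst partial_deriv_mult)
      (auto simp: smooth_imp_differentiable f smooth_wave partial_deriv_wave)
  also have "integral (cube a) \<dots> = integral (cube a) (\<lambda>t. partial_deriv i f t * wave (freq a k) t)
      + (- 2 * complex_of_real pi * \<i> * complex_of_real (freq a k $ i)) * integral (cube a) ?G"
    by (subst integral_add)
      (use i1 i2 in \<open>auto intro!: integrable_cube continuous_on_minus continuous_on_mult_left simp del: freq_nth\<close>)
  finally show ?thesis by (simp add: fcoeff_def field_simps)
qed

lemma supp_pd: "supp (pd is f) \<subseteq> supp f"
  by (intro supp_subset pd_outside_supp) (auto simp: supp_def)

lemma fcoeff_pd:
  fixes f :: "real^'n::finite \<Rightarrow> complex"
  assumes f: "smooth_fun f" "supp f \<subseteq> cube r" and r: "0 < r" "r < a"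
  shows "fcoeff a (pd is f) k = wave_symbol is (- freq a k) * fcoeff a f k"
proof (induction "is")
  case (Cons i "is")
  have "fcoeff a (pd (i # is) f) k = 2 * pi * \<i> * (freq a k $ i) * fcoeff a (pd is f) k"
    using fcoeff_partial_deriv[of "pd is f" r a i k] f r supp_pd[of "is" f] by (auto simp: smooth_pd)
  with Cons show ?case by (simp add: wave_symbol_def)
qed (simp add: wave_symbol_def)

lemma norm_fcoeff_le:
  fixes f :: "real^'n::finite \<Rightarrow> complex"
  assumes "a > 0" "continuous_on (cube a) f" "\<And>t. t \<in> cube a \<Longrightarrow> norm (f t) \<le> B" "0 \<le> B"
  shows "norm (fcoeff a f k) \<le> B"
proof -
  let ?g = "\<lambda>t. f t * wave (freq a k) t"
  have "(?g has_integral integral (cube a) ?g) (cube a)"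
    using assms(2) by (intro integrable_integral integrable_cube continuous_intros continuous_wave)
  then have "norm (integral (cube a) ?g) \<le> B * measure lborel (cube a :: (real^'n) set)"
    unfolding cube_def by (rule has_integral_bound[rotated]) (use assms(3,4) in \<open>auto simp: cube_def norm_mult\<close>)
  also have "measure lborel (cube a :: (real^'n) set) = (2 * a) ^ CARD('n)"
    using assms(1) unfolding cube_def by (subst content_cbox_cart) (auto simp: interval_eq_empty_cart)
  finally show ?thesis
    using assms(1) by (simp add: fcoeff_def norm_divide norm_power norm_mult divide_simps)
qed

subsection \<open>Completeness of the trigonometric system\<close>

text \<open>The linear span of the exponentials. Being inductive, it yields closure under products
  and conjugation, and later orthogonality, by rule induction.\<close>

inductive trig :: "real \<Rightarrow> (real^'n::finite \<Rightarrow> complex) \<Rightarrow> bool" for a where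
  trig_wave: "trig a (wave (freq a k))"
| trig_add: "trig a p \<Longrightarrow> trig a q \<Longrightarrow> trig a (\<lambda>t. p t + q t)"
| trig_cmult: "trig a p \<Longrightarrow> trig a (\<lambda>t. c * p t)"

lemma trig_const: "trig a (\<lambda>t :: real^'n::finite. c)"
proof -
  have "freq a (\<lambda>i :: 'n. 0) = 0" by (simp add: vec_eq_iff)
  then show ?thesis
    using trig_cmult[OF trig_wave[of a "\<lambda>i :: 'n. 0"], of c] by simp
qed

lemma trig_mult:
  assumes "trig a p" "trig a q"
  shows "trig a (\<lambda>t. p t * q t)"
  using assms(1)
proof induction
  case (trig_wave k)
  show ?case
    using assms(2)
  proof induction
    case (trig_wave l)
    show ?case using trig.trig_wave[of a "\<lambda>i. k i + l i"] by (simp add: freq_add[symmetric] wave_add[abs_def])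
  next
    case (trig_add p q)
    then show ?case by (simp add: distrib_left trig.trig_add)
  next
    case (trig_cmult p c)
    then show ?case using trig.trig_cmult[OF trig_cmult.IH, of c] by (simp add: mult_ac)
  qed
next
  case (trig_add p q)
  then show ?case by (simp add: distrib_right trig.trig_add)
next
  case (trig_cmult p c)
  then show ?case using trig.trig_cmult[OF trig_cmult.IH, of c] by (simp add: mult_ac)
qed

lemma trig_sum:
  "(\<And>k. k \<in> F \<Longrightarrow> trig a (p k)) \<Longrightarrow> trig a (\<lambda>t. \<Sum>k\<in>F. p k t)"
  by (induction F rule: infinite_finite_induct) (auto simp: trig_const intro: trig_add)

lemma continuous_trig: "trig a p \<Longrightarrow> continuous_on S p"
  by (induction rule: trig.induct) (auto intro: continuous_wave continuous_on_add continuous_on_mult_left)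

lemma trig_cnj: "trig a p \<Longrightarrow> trig a (\<lambda>t. cnj (p t))"
proof (induction rule: trig.induct)
  case (trig_wave k)
  show ?case by (simp add: cnj_wave freq_minus trig.trig_wave)
qed (auto intro: trig.intros)

text \<open>Wraps the cube around the torus, gluing opposite faces. The coordinates of the image are
  exponentials, so polynomials on the torus pull back to trigonometric polynomials.\<close>

definition torus_map :: "real \<Rightarrow> real^'n::finite \<Rightarrow> complex^'n" where
  "torus_map a t = (\<chi> j. cis (pi * t $ j / a))"

lemma continuous_torus_map: "continuous_on S (torus_map a)"
  unfolding torus_map_def cis_conv_exp divide_inverse by (intro continuous_intros)

text \<open>The case of a linear form carries the content: composed with the torus map, the real and
  imaginary parts of the coordinates are cosines and sines, hence combinations of two exponentials
  each. Sums and products then follow from the closure of \<open>trig\<close>.\<close>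

lemma trig_real_polynomial:
  fixes g :: "complex^'n::finite \<Rightarrow> real"
  assumes "real_polynomial_function g" and a: "a > 0"
  shows "trig a (\<lambda>t. complex_of_real (g (torus_map a t)))"
  using assms(1)
proof induction
  case (linear g)
  interpret bounded_linear g by fact
  have trig_cis: "trig a (\<lambda>t. cis (of_int s * (pi * t $ j / a)))" for s :: int and j :: 'n
  proof -
    have "t \<bullet> freq a (\<lambda>i. if i = j then - s else 0) = - of_int s * t $ j / (2 * a)" for t :: "real^'n"
    proof -
      have "t \<bullet> freq a (\<lambda>i. if i = j then - s else 0) = (\<Sum>i\<in>UNIV. if i = j then - of_int s * t $ j / (2 * a) else 0)"
        unfolding inner_vec_def by (intro sum.cong) auto
      then show ?thesis by simp
    qed
    then have "wave (freq a (\<lambda>i. if i = j then - s else 0)) t = cis (of_int s * (pi * t $ j / a))" for t :: "real^'n"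
      using a by (simp add: wave_eq_cis mult_ac)
    then have "wave (freq a (\<lambda>i. if i = j then - s else 0)) = (\<lambda>t. cis (of_int s * (pi * t $ j / a)))"
      by blast
    then show ?thesis using trig_wave[of a "\<lambda>i. if i = j then - s else 0"] by simp
  qed
  have re_im: "complex_of_real (cos x) = (1/2) * cis (of_int 1 * x) + (1/2) * cis (of_int (-1) * x)"
    "complex_of_real (sin x) = (- \<i>/2) * cis (of_int 1 * x) + (\<i>/2) * cis (of_int (-1) * x)" for x
    by (simp_all add: complex_eq_iff)
  \<comment> \<open>\<open>g\<close> is linear over the reals only, so each complex coordinate
    contributes two basis directions.\<close>
  have expand: "g z = (\<Sum>j\<in>UNIV. Re (z $ j) * g (axis j 1) + Im (z $ j) * g (axis j \<i>))" for z
  proof -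
    have "z = (\<Sum>j\<in>UNIV. Re (z $ j) *\<^sub>R axis j 1 + Im (z $ j) *\<^sub>R axis j \<i>)"
      by (simp add: vec_eq_iff axis_def complex_eq_iff if_distrib[of "\<lambda>x. _ *\<^sub>R x"]
          if_distrib[of Re] if_distrib[of Im] cong: if_cong)
    then have "g z = g (\<Sum>j\<in>UNIV. Re (z $ j) *\<^sub>R axis j 1 + Im (z $ j) *\<^sub>R axis j \<i>)" by simp
    then show ?thesis by (simp add: sum add scaleR)
  qed
  have "trig a (\<lambda>t. \<Sum>j\<in>UNIV. of_real (g (axis j 1)) * of_real (cos (pi * t $ j / a))
      + of_real (g (axis j \<i>)) * of_real (sin (pi * t $ j / a)))"
    unfolding re_im by (intro trig_sum trig_add trig_cmult trig_cis)
  then show ?case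
    by (subst expand) (simp add: torus_map_def mult_ac)
next
  case (const c)
  show ?case by (rule trig_const)
next
  case (add f g)
  then show ?case by (simp add: trig_add)
next
  case (mult f g)
  then show ?case by (simp add: trig_mult)
qed

text \<open>Equal images force each pair of coordinates to differ by a multiple of
  \<open>2 * a\<close>. In a cube of side \<open>2 * a\<close> this means equality or opposite
  faces, so a function that is 0 on the boundary factors through the torus.\<close>

lemma torus_map_eqD:
  assumes "a > 0" "s \<in> cube a" "t \<in> cube a" "torus_map a s = torus_map a t"
  shows "s = t \<or> (\<exists>j. \<bar>s $ j\<bar> = a) \<and> (\<exists>j. \<bar>t $ j\<bar> = a)"
proof -
  have "s $ j = t $ j \<or> \<bar>s $ j\<bar> = a \<and> \<bar>t $ j\<bar> = a" for j
  proof -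
    have "cis (pi * s $ j / a) = cis (pi * t $ j / a)"
      using assms(4) by (simp add: torus_map_def vec_eq_iff)
    then have "cis (pi * s $ j / a - pi * t $ j / a) = 1"
      by (simp add: cis_divide[symmetric])
    then have "cos (pi * s $ j / a - pi * t $ j / a) = 1"
      by (simp add: complex_eq_iff)
    then obtain n :: int where "pi * s $ j / a - pi * t $ j / a = of_int n * 2 * pi"
      using cos_one_2pi_int by blast
    then have "pi * (s $ j - t $ j) = pi * (of_int n * 2 * a)"
      using assms(1) by (simp add: field_simps)
    then have n: "s $ j - t $ j = of_int n * (2 * a)" by simp
    have b: "\<bar>s $ j\<bar> \<le> a" "\<bar>t $ j\<bar> \<le> a" using assms(2,3) by (auto simp: mem_cube)
    then have "\<bar>of_int n * (2 * a)\<bar> \<le> 1 * (2 * a)" using n by linarith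
    then have "\<bar>real_of_int n\<bar> \<le> 1" using assms(1) by (simp add: abs_mult)
    then have "n = 0 \<or> n = 1 \<or> n = -1" by linarith
    then show ?thesis using n b by auto
  qed
  then show ?thesis unfolding vec_eq_iff by metis
qed

text \<open>As \<open>f\<close> is 0 where faces are glued, it descends to a continuous function on
  the compact image of the cube, and the Stone-Weierstrass theorem applies to its real and imaginary
  parts.\<close>

lemma trig_approximation:
  fixes f :: "real^'n::finite \<Rightarrow> complex"
  assumes a: "a > 0" and f: "continuous_on (cube a) f"
    and boundary: "\<And>t j. t \<in> cube a \<Longrightarrow> \<bar>t $ j\<bar> = a \<Longrightarrow> f t = 0"
    and e: "e > 0"
  shows "\<exists>p. trig a p \<and> (\<forall>t\<in>cube a. norm (f t - p t) < e)"
proof -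
  let ?q = "torus_map a :: real^'n \<Rightarrow> _" and ?Q = "cube a :: (real^'n) set"
  define F where "F z = f (SOME t. t \<in> ?Q \<and> ?q t = z)" for z
  have F: "F (?q t) = f t" if "t \<in> ?Q" for t
  proof -
    define s where "s = (SOME s. s \<in> ?Q \<and> ?q s = ?q t)"
    have "s \<in> ?Q \<and> ?q s = ?q t"
      unfolding s_def by (rule someI[of _ t]) (use that in auto)
    with torus_map_eqD[OF a _ that, of s] boundary[of s] boundary[of t] that have "f s = f t"
      by auto
    then show ?thesis by (simp add: F_def s_def)
  qed
  \<comment> \<open>On a compact cube the torus map sends closed sets to closed sets, so preimages
    under \<open>F\<close> of closed sets are closed.\<close>
  have "continuous_on (?q ` ?Q) F"
    unfolding continuous_closedin_preimage_eq
  proof (intro allI impI)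
    fix C :: "complex set" assume C: "closed C"
    have "closed (?Q \<inter> f -` C)"
      using continuous_closed_preimage[OF f _ C] compact_imp_closed[OF compact_cube] by blast
    then have "compact (?Q \<inter> f -` C)"
      using compact_Int_closed[OF compact_cube] by (metis Int_left_absorb)
    then have "compact (?q ` (?Q \<inter> f -` C))"
      by (intro compact_continuous_image continuous_torus_map)
    then have "closed (?q ` (?Q \<inter> f -` C))" by (rule compact_imp_closed)
    moreover have "?q ` ?Q \<inter> F -` C = ?q ` (?Q \<inter> f -` C)" using F by auto
    ultimately show "closedin (top_of_set (?q ` ?Q)) (?q ` ?Q \<inter> F -` C)"
      by (intro closed_subset) auto
  qed
  then have "continuous_on (?q ` ?Q) (\<lambda>z. Re (F z))" "continuous_on (?q ` ?Q) (\<lambda>z. Im (F z))"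
    by (auto intro: continuous_intros)
  moreover have "compact (?q ` ?Q)"
    by (intro compact_continuous_image continuous_torus_map compact_cube)
  ultimately obtain g h where g: "real_polynomial_function g" "\<And>z. z \<in> ?q ` ?Q \<Longrightarrow> \<bar>Re (F z) - g z\<bar> < e / 2"
    and h: "real_polynomial_function h" "\<And>z. z \<in> ?q ` ?Q \<Longrightarrow> \<bar>Im (F z) - h z\<bar> < e / 2"
    using Stone_Weierstrass_real_polynomial_function[of "?q ` ?Q" _ "e / 2"] e
    by (metis half_gt_zero)
  let ?p = "\<lambda>t. complex_of_real (g (?q t)) + \<i> * complex_of_real (h (?q t))"
  have "trig a ?p"
    by (intro trig_add trig_cmult trig_real_polynomial g h a)
  moreover have "norm (f t - ?p t) < e" if "t \<in> ?Q" for t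
  proof -
    have "norm (f t - ?p t) \<le> \<bar>Re (f t - ?p t)\<bar> + \<bar>Im (f t - ?p t)\<bar>" by (rule cmod_le)
    also have "\<dots> < e"
      using g(2)[of "?q t"] h(2)[of "?q t"] that by (simp add: F)
    finally show ?thesis .
  qed
  ultimately show ?thesis by blast
qed

text \<open>Vanishing coefficients make \<open>f\<close> orthogonal to every trigonometric
  polynomial p, so the integral of |f|^2 equals that of f times the conjugate of f - p, which is
  arbitrarily small. Continuity turns the zero integral into \<open>f t = 0\<close> on the whole
  closed cube.\<close>

lemma fcoeff_unique:
  fixes f :: "real^'n::finite \<Rightarrow> complex"
  assumes a: "a > 0" and f: "continuous_on (cube a) f"
    and approx: "\<And>e. e > 0 \<Longrightarrow> \<exists>p. trig a p \<and> (\<forall>t\<in>cube a. norm (f t - p t) < e)"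
    and zero: "\<And>k. fcoeff a f k = 0" and t: "t \<in> cube a"
  shows "f t = 0"
proof -
  let ?Q = "cube a :: (real^'n) set"
  have orth: "integral ?Q (\<lambda>t. f t * p t) = 0" if "trig a p" for p
    using that
  proof induction
    case (trig_wave k)
    show ?case using zero[of k] a by (simp add: fcoeff_def)
  next
    case (trig_add p q)
    then show ?case
      by (simp add: distrib_left integral_add integrable_cube f continuous_on_mult continuous_trig)
  next
    case (trig_cmult p c)
    then show ?case
      using integral_mult_right[of ?Q c "\<lambda>t. f t * p t"] by (simp add: mult_ac)
  qed
  have "bounded (f ` ?Q)"
    by (intro compact_imp_bounded compact_continuous_image f compact_cube)
  then obtain B where B: "B > 0" "\<And>t. t \<in> ?Q \<Longrightarrow> norm (f t) \<le> B"
    by (auto simp: bounded_pos)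
  let ?g = "\<lambda>t. (norm (f t))\<^sup>2"
  have g: "?g integrable_on ?Q"
    unfolding cube_def by (intro integrable_continuous continuous_intros) (use f in \<open>simp add: cube_def\<close>)
  let ?V = "measure lborel ?Q"
  have le: "norm (integral ?Q (\<lambda>t. f t * cnj (f t))) \<le> B * e * ?V" if "e > 0" for e
  proof -
    from approx[OF that] obtain p where p: "trig a p" "\<And>t. t \<in> ?Q \<Longrightarrow> norm (f t - p t) < e" by blast
    have cont: "continuous_on ?Q (\<lambda>t. f t * cnj (p t))" "continuous_on ?Q (\<lambda>t. f t * cnj (f t))"
      "continuous_on ?Q (\<lambda>t. f t * cnj (f t - p t))"
      by (intro continuous_intros f continuous_trig[OF p(1)])+
    have "integral ?Q (\<lambda>t. f t * cnj (f t)) = integral ?Q (\<lambda>t. f t * cnj (f t - p t))"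
      using integral_diff[OF integrable_cube[OF cont(2)] integrable_cube[OF cont(1)]] orth[OF trig_cnj[OF p(1)]]
      by (simp add: algebra_simps)
    moreover have "norm (integral ?Q (\<lambda>t. f t * cnj (f t - p t))) \<le> B * e * ?V"
    proof -
      have "((\<lambda>t. f t * cnj (f t - p t)) has_integral integral ?Q (\<lambda>t. f t * cnj (f t - p t))) ?Q"
        by (intro integrable_integral integrable_cube cont)
      then show ?thesis
        unfolding cube_def
      proof (rule has_integral_bound[rotated])
        fix t :: "real^'n" assume "t \<in> cbox (\<chi> i. - a) (\<chi> i. a)"
        then have "t \<in> ?Q" by (simp add: cube_def)
        then show "norm (f t * cnj (f t - p t)) \<le> B * e"
          using B p(2) unfolding norm_mult complex_mod_cnj by (intro mult_mono) (auto intro: less_imp_le)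
      qed (use B that in auto)
    qed
    ultimately show ?thesis by simp
  qed
  have "norm (integral ?Q (\<lambda>t. f t * cnj (f t))) \<le> 0"
  proof (rule field_le_epsilon)
    fix e :: real assume "e > 0"
    have V: "?V \<ge> 0" by simp
    \<comment> \<open>The accuracy is chosen so that the bound becomes
      \<open>e * (?V / (?V + 1))\<close>; the \<open>+ 1\<close> keeps the denominator
      positive.\<close>
    have "norm (integral ?Q (\<lambda>t. f t * cnj (f t))) \<le> B * (e / (B * (?V + 1))) * ?V"
      using \<open>e > 0\<close> B V by (intro le) (auto intro!: divide_pos_pos mult_pos_pos add_nonneg_pos)
    also have "\<dots> = e * (?V / (?V + 1))" using B by simp
    also have "?V / (?V + 1) \<le> 1"
      by (rule divide_le_eq_1_pos[THEN iffD2]) (use V in linarith)+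
    then have "e * (?V / (?V + 1)) \<le> e * 1" using \<open>e > 0\<close> by (intro mult_left_mono) auto
    finally show "norm (integral ?Q (\<lambda>t. f t * cnj (f t))) \<le> 0 + e" by simp
  qed
  then have "integral ?Q (\<lambda>t. complex_of_real (?g t)) = 0"
    unfolding complex_norm_square by simp
  moreover have "integral ?Q (\<lambda>t. complex_of_real (?g t)) = of_real (integral ?Q ?g)"
    using integral_linear[OF g bounded_linear_of_real] by (simp add: o_def)
  ultimately have "integral ?Q ?g = 0" by simp
  then have "(?g has_integral 0) ?Q" using g by (metis integrable_integral)
  then have "?g t = 0"
    unfolding cube_def
  proof (rule has_integral_0_cbox_imp_0[rotated 2])
    show "box (\<chi> i. - a) (\<chi> i. a) \<noteq> ({} :: (real^'n) set)"
      using a by (simp add: interval_eq_empty_cart not_le)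
  qed (use f t in \<open>auto simp: cube_def intro: continuous_intros\<close>)
  then show ?thesis by simp
qed

subsection \<open>Decay of the coefficients and convergence\<close>

text \<open>A summable majorant on the lattice. It factorises over the coordinates, so its sum over
  a box is a product of one-dimensional sums.\<close>

definition weight :: "('n::finite \<Rightarrow> int) \<Rightarrow> real" where
  "weight k = (\<Prod>i\<in>UNIV. 1 / (1 + (real_of_int (k i))\<^sup>2))"

lemma weight_pos: "weight k > 0"
  unfolding weight_def by (intro prod_pos) (auto intro: add_pos_nonneg)

text \<open>The correction makes the induction telescope: each of the two new terms is at most
  2/((n+1)(n+2)) = 2/(n+1) - 2/(n+2). Equality at n = 0 fixes the constant 5.\<close>

lemma sum_inverse_square_le: "(\<Sum>j\<in>{-int n..int n}. 1 / (1 + (real_of_int j)\<^sup>2)) \<le> 5 - 4 / (real n + 1)"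
proof (induction n)
  case (Suc n)
  let ?f = "\<lambda>j. 1 / (1 + (real_of_int j)\<^sup>2)"
  have "{-int (Suc n)..int (Suc n)} = insert (- int n - 1) (insert (int n + 1) {-int n..int n})" by auto
  then have "(\<Sum>j\<in>{-int (Suc n)..int (Suc n)}. ?f j) = ?f (- int n - 1) + ?f (int n + 1) + (\<Sum>j\<in>{-int n..int n}. ?f j)"
    by simp
  also have "?f (- int n - 1) = ?f (int n + 1)" by (simp add: power2_eq_square algebra_simps)
  also have "?f (int n + 1) \<le> 2 / ((real n + 1) * (real n + 2))"
  proof -
    have "(real n + 1) * (real n + 2) \<le> 2 * (1 + (real_of_int (int n + 1))\<^sup>2)"
      by (simp add: power2_eq_square algebra_simps)
    then show ?thesis
      by (subst frac_le_eq) (auto simp: divide_le_0_iff add_nonneg_eq_0_iff)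
  qed
  also have "2 / ((real n + 1) * (real n + 2)) = 2 / (real n + 1) - 2 / (real n + 2)"
    by (simp add: divide_simps)
  finally show ?case using Suc by (simp add: algebra_simps)
qed simp

lemma weight_sum_bounded: "finite F \<Longrightarrow> (\<Sum>k\<in>F. weight k) \<le> 5 ^ CARD('n)"
  for F :: "('n::finite \<Rightarrow> int) set"
proof -
  assume F: "finite F"
  have "finite ((\<lambda>(k, i). \<bar>k i\<bar>) ` (F \<times> (UNIV :: 'n set)))" using F by simp
  then obtain m where m: "\<And>k i. k \<in> F \<Longrightarrow> \<bar>k i\<bar> \<le> m"
    by (force dest: bdd_above_finite simp: bdd_above_def)
  let ?I = "{- int (nat m)..int (nat m)}"
  have "F \<subseteq> PiE (UNIV :: 'n set) (\<lambda>_. ?I)"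
  proof
    fix k assume "k \<in> F"
    then have "\<bar>k i\<bar> \<le> int (nat m)" for i using m[of k i] by linarith
    then show "k \<in> PiE (UNIV :: 'n set) (\<lambda>_. ?I)" by (auto simp: abs_le_iff minus_le_iff PiE_def)
  qed
  then have "(\<Sum>k\<in>F. weight k) \<le> (\<Sum>k\<in>PiE (UNIV :: 'n set) (\<lambda>_. ?I). weight k)"
    by (intro sum_mono2) (auto intro!: finite_PiE less_imp_le[OF weight_pos])
  also have "\<dots> = (\<Prod>i\<in>(UNIV :: 'n set). \<Sum>j\<in>?I. 1 / (1 + (real_of_int j)\<^sup>2))"
    unfolding weight_def by (subst prod_sum_PiE) auto
  also have "\<dots> \<le> (\<Prod>i\<in>(UNIV :: 'n set). 5)"
  proof (intro prod_mono conjI sum_nonneg)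
    have "0 \<le> 4 / (real (nat m) + 1)" by simp
    then show "(\<Sum>j\<in>?I. 1 / (1 + (real_of_int j)\<^sup>2)) \<le> 5"
      using sum_inverse_square_le[of "nat m"] by linarith
  qed simp
  finally show ?thesis by simp
qed

lemma weight_summable: "weight summable_on UNIV"
  by (rule nonneg_bdd_above_summable_on)
    (auto intro!: less_imp_le[OF weight_pos] bdd_aboveI2 weight_sum_bounded)

text \<open>The price of summability: since |k_i| is at most 2a |\<eta>_k|, inserting a weight costs
  two powers of \<open>1 + 2 * a * norm (freq a k)\<close> per coordinate.\<close>

lemma one_le_weight:
  fixes k :: "'n::finite \<Rightarrow> int"
  assumes "a > 0"
  shows "1 \<le> weight k * (1 + 2 * a * norm (freq a k)) ^ (2 * CARD('n))"
proof -
  have "1 + (real_of_int (k i))\<^sup>2 \<le> (1 + 2 * a * norm (freq a k))\<^sup>2" for i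
  proof -
    have "\<bar>real_of_int (k i) / (2 * a)\<bar> \<le> norm (freq a k)"
      using component_le_norm_cart[of "freq a k" i] by simp
    then have "\<bar>real_of_int (k i)\<bar> \<le> 2 * a * norm (freq a k)"
      using assms by (simp add: abs_divide pos_divide_le_eq mult.commute)
    then have "\<bar>real_of_int (k i)\<bar>\<^sup>2 \<le> (2 * a * norm (freq a k))\<^sup>2" by (intro power_mono) auto
    moreover have "0 \<le> 2 * a * norm (freq a k)" using assms by simp
    ultimately show ?thesis by (simp add: power2_eq_square algebra_simps)
  qed
  then have "(\<Prod>i\<in>(UNIV :: 'n set). 1 + (real_of_int (k i))\<^sup>2) \<le> (\<Prod>i\<in>(UNIV :: 'n set). (1 + 2 * a * norm (freq a k))\<^sup>2)"
    by (intro prod_mono) auto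
  also have "\<dots> = (1 + 2 * a * norm (freq a k)) ^ (2 * CARD('n))"
    by (simp add: power_mult)
  finally have le: "(\<Prod>i\<in>(UNIV :: 'n set). 1 + (real_of_int (k i))\<^sup>2) \<le> \<dots>" .
  have "weight k * (\<Prod>i\<in>(UNIV :: 'n set). 1 + (real_of_int (k i))\<^sup>2) = 1"
    unfolding weight_def prod.distrib[symmetric]
    by (rule prod.neutral) (auto simp: add_nonneg_eq_0_iff)
  then show ?thesis
    using mult_left_mono[OF le, of "weight k"] weight_pos[of k] by simp
qed

text \<open>By comparison with the l1 norm, some coordinate of \<eta>_k carries at least the
  fraction \<open>1 / CARD('n)\<close> of its norm. Taking all N derivatives in that direction gives
  the bound; the surplus powers of 2 pi are dropped.\<close>

lemma fcoeff_decay: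
  fixes f :: "real^'n::finite \<Rightarrow> complex"
  assumes f: "smooth_fun f" "supp f \<subseteq> cube r" and r: "0 < r" "r < a"
    and D: "\<And>i t. norm (pd (replicate N i) f t) \<le> D"
  shows "norm (fcoeff a f k) * norm (freq a k) ^ N \<le> real CARD('n) ^ N * D"
proof -
  let ?d = "real CARD('n)"
  obtain i where i: "norm (freq a k) \<le> ?d * \<bar>freq a k $ i\<bar>"
  proof -
    have "\<exists>i. norm (freq a k) \<le> ?d * \<bar>freq a k $ i\<bar>"
    proof (rule ccontr)
      assume "\<not> ?thesis"
      then have "?d * \<bar>freq a k $ i\<bar> < norm (freq a k)" for i by (auto simp: not_le)
      then have "(\<Sum>i\<in>UNIV. ?d * \<bar>freq a k $ i\<bar>) < (\<Sum>i\<in>(UNIV :: 'n set). norm (freq a k))"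
        by (intro sum_strict_mono) auto
      then have "?d * (\<Sum>i\<in>UNIV. \<bar>freq a k $ i\<bar>) < ?d * norm (freq a k)"
        by (simp only: sum_distrib_left[symmetric] sum_constant)
      then show False using norm_le_l1_cart[of "freq a k"] by simp
    qed
    then show ?thesis using that by blast
  qed
  have "norm (fcoeff a (pd (replicate N i) f) k) \<le> D"
    by (rule norm_fcoeff_le)
      (use r D order_trans[OF norm_ge_zero D] in \<open>auto intro: smooth_imp_continuous smooth_pd f\<close>)
  moreover have "fcoeff a (pd (replicate N i) f) k = wave_symbol (replicate N i) (- freq a k) * fcoeff a f k"
    by (rule fcoeff_pd[OF f r])
  moreover have "norm (wave_symbol (replicate N i) (- freq a k)) = (2 * pi * \<bar>freq a k $ i\<bar>) ^ N"
    by (simp add: wave_symbol_def prod_list_replicate norm_power norm_mult norm_divide del: freq_nth) 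
  ultimately have le: "(2 * pi * \<bar>freq a k $ i\<bar>) ^ N * norm (fcoeff a f k) \<le> D"
    by (simp add: norm_mult)
  have "norm (freq a k) ^ N \<le> (?d * \<bar>freq a k $ i\<bar>) ^ N" by (intro power_mono i) simp
  also have "\<dots> \<le> ?d ^ N * (2 * pi * \<bar>freq a k $ i\<bar>) ^ N"
  proof -
    have "1 * \<bar>freq a k $ i\<bar> \<le> (2 * pi) * \<bar>freq a k $ i\<bar>"
      using pi_gt3 by (intro mult_right_mono) auto
    then have "\<bar>freq a k $ i\<bar> ^ N \<le> (2 * pi * \<bar>freq a k $ i\<bar>) ^ N" by (intro power_mono) auto
    then show ?thesis unfolding power_mult_distrib[of ?d] by (intro mult_left_mono) auto
  qed
  finally have "norm (fcoeff a f k) * norm (freq a k) ^ N \<le> norm (fcoeff a f k) * (?d ^ N * (2 * pi * \<bar>freq a k $ i\<bar>) ^ N)"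
    by (intro mult_left_mono) auto
  also have "\<dots> = ?d ^ N * ((2 * pi * \<bar>freq a k $ i\<bar>) ^ N * norm (fcoeff a f k))" by (simp only: mult_ac)
  also have "\<dots> \<le> ?d ^ N * D" by (intro mult_left_mono le) auto
  finally show ?thesis .
qed

text \<open>Up to the factor 2^q, the power (1 + bv)^q is 1 + (bv)^q, so derivatives of the two
  orders N and N + q suffice. With \<open>N = 0\<close> and \<open>q = 2 * CARD('n)\<close> this is
  the summable bound below; with the degree of polynomial growth added to q it treats the far
  frequencies.\<close>

lemma fcoeff_decay_weight:
  fixes f :: "real^'n::finite \<Rightarrow> complex"
  assumes f: "smooth_fun f" "supp f \<subseteq> cube r" and r: "0 < r" "r < a"
    and D: "\<And>i t. norm (pd (replicate N i) f t) \<le> D" "\<And>i t. norm (pd (replicate (N + q) i) f t) \<le> D'"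
    and b: "b \<ge> 0"
  shows "norm (fcoeff a f k) * norm (freq a k) ^ N * (1 + b * norm (freq a k)) ^ q
    \<le> 2 ^ q * real CARD('n) ^ (N + q) * (D + b ^ q * D')"
proof -
  let ?d = "real CARD('n)" and ?v = "norm (freq a k)" and ?c = "norm (fcoeff a f k)"
  have d: "1 \<le> ?d" by (simp add: Suc_leI)
  have D0: "0 \<le> D" using order_trans[OF norm_ge_zero D(1)] .
  have "(1 + b * ?v) ^ q \<le> 2 ^ q * (1 + (b * ?v) ^ q)"
  proof (cases "b * ?v \<le> 1")
    case True
    then have "(1 + b * ?v) ^ q \<le> 2 ^ q" using b by (intro power_mono) auto
    also have "\<dots> \<le> 2 ^ q * (1 + (b * ?v) ^ q)" using b by simp
    finally show ?thesis .
  next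
    case False
    then have "(1 + b * ?v) ^ q \<le> (2 * (b * ?v)) ^ q" using b by (intro power_mono) auto
    also have "\<dots> \<le> 2 ^ q * (1 + (b * ?v) ^ q)" by (simp add: power_mult_distrib)
    finally show ?thesis .
  qed
  then have "?c * ?v ^ N * (1 + b * ?v) ^ q \<le> ?c * ?v ^ N * (2 ^ q * (1 + (b * ?v) ^ q))"
    by (intro mult_left_mono) auto
  also have "\<dots> = 2 ^ q * (?c * ?v ^ N + b ^ q * (?c * ?v ^ (N + q)))"
    by (simp add: power_mult_distrib power_add algebra_simps)
  also have "\<dots> \<le> 2 ^ q * (?d ^ (N + q) * D + b ^ q * (?d ^ (N + q) * D'))"
  proof (intro mult_left_mono add_mono)
    have "?c * ?v ^ N \<le> ?d ^ N * D" by (rule fcoeff_decay[OF f r D(1)])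
    also have "\<dots> \<le> ?d ^ (N + q) * D"
      using d D0 by (intro mult_right_mono power_increasing) auto
    finally show "?c * ?v ^ N \<le> ?d ^ (N + q) * D" .
    show "?c * ?v ^ (N + q) \<le> ?d ^ (N + q) * D'" by (rule fcoeff_decay[OF f r D(2)])
  qed (use b in auto)
  finally show ?thesis by (simp add: algebra_simps)
qed

lemma fcoeff_le_weight:
  fixes f :: "real^'n::finite \<Rightarrow> complex"
  assumes f: "smooth_fun f" "supp f \<subseteq> cube r" and r: "0 < r" "r < a"
    and D: "\<And>t. norm (f t) \<le> D" "\<And>i t. norm (pd (replicate (2 * CARD('n)) i) f t) \<le> D'"
  shows "norm (fcoeff a f k) \<le> weight k * (2 ^ (2 * CARD('n)) * real CARD('n) ^ (2 * CARD('n)) * (D + (2 * a) ^ (2 * CARD('n)) * D'))"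
proof -
  have "norm (fcoeff a f k) * 1 \<le> norm (fcoeff a f k) * (weight k * (1 + 2 * a * norm (freq a k)) ^ (2 * CARD('n)))"
    using r by (intro mult_left_mono one_le_weight) auto
  also have "\<dots> = weight k * (norm (fcoeff a f k) * norm (freq a k) ^ 0 * (1 + 2 * a * norm (freq a k)) ^ (2 * CARD('n)))"
    by simp
  also have "\<dots> \<le> weight k * (2 ^ (2 * CARD('n)) * real CARD('n) ^ (0 + 2 * CARD('n)) * (D + (2 * a) ^ (2 * CARD('n)) * D'))"
    using r D by (intro mult_left_mono fcoeff_decay_weight[OF f] less_imp_le[OF weight_pos]) auto
  finally show ?thesis by simp
qed

text \<open>The weights majorise the series, so its partial sums converge uniformly to a continuous
  g, and orthogonality gives g the coefficients of f. What remains is f = g, by uniqueness of the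
  coefficients.\<close>

theorem fourier_series_uniform:
  fixes f :: "real^'n::finite \<Rightarrow> complex"
  assumes f: "smooth_fun f" "supp f \<subseteq> cube r" and r: "0 < r" "r < a"
  shows "uniform_limit (cube a) (\<lambda>F t. \<Sum>k\<in>F. fcoeff a f k * wave (- freq a k) t) f (finite_subsets_at_top UNIV)"
proof -
  let ?S = "\<lambda>F t. \<Sum>k\<in>F. fcoeff a f k * wave (- freq a k) t"
  let ?Q = "cube a :: (real^'n) set"
  have a: "a > 0" using r by simp
  obtain B where B: "\<And>is t. length is \<le> 2 * CARD('n) \<Longrightarrow> norm (pd is f t) \<le> B"
    using bounded_pd[OF f compact_cube, of "2 * CARD('n)"] by blast
  have B': "norm (f t) \<le> B" "norm (pd (replicate (2 * CARD('n)) i) f t) \<le> B" for t i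
    using B[of "[]" t] B[of "replicate (2 * CARD('n)) i" t] by simp_all
  define g where "g t = (\<Sum>\<^sub>\<infinity>k\<in>UNIV. fcoeff a f k * wave (- freq a k) t)" for t
  have lim: "uniform_limit ?Q ?S g (finite_subsets_at_top UNIV)"
    unfolding g_def
  proof (rule Weierstrass_m_test_general)
    show "norm (fcoeff a f k * wave (- freq a k) t) \<le> weight k * (2 ^ (2 * CARD('n)) *
        real CARD('n) ^ (2 * CARD('n)) * (B + (2 * a) ^ (2 * CARD('n)) * B))" for k t
      using fcoeff_le_weight[OF f r B'] by (simp add: norm_mult)
    show "(\<lambda>k :: 'n \<Rightarrow> int. weight k * (2 ^ (2 * CARD('n)) *
        real CARD('n) ^ (2 * CARD('n)) * (B + (2 * a) ^ (2 * CARD('n)) * B))) summable_on UNIV"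
      by (intro summable_on_cmult_left weight_summable)
  qed
  have S: "trig a (?S F)" for F
    by (intro trig_sum trig_cmult) (simp add: freq_minus trig_wave)
  have g: "continuous_on ?Q g"
    by (rule uniform_limit_theorem[OF _ lim]) (auto intro: always_eventually continuous_trig[OF S])
  have fg: "fcoeff a (\<lambda>t. f t - g t) l = 0" for l
  proof -
    let ?w = "wave (freq a l) :: real^'n \<Rightarrow> complex"
    have "uniform_limit ?Q (\<lambda>F t. ?S F t * ?w t) (\<lambda>t. g t * ?w t) (finite_subsets_at_top UNIV)"
      using lim by (auto simp: uniform_limit_iff dist_norm left_diff_distrib[symmetric] norm_mult)
    then obtain I J where I: "\<And>F. ((\<lambda>t. ?S F t * ?w t) has_integral I F) ?Q"
      and J: "((\<lambda>t. g t * ?w t) has_integral J) ?Q" and IJ: "(I \<longlongrightarrow> J) (finite_subsets_at_top UNIV)"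
      unfolding cube_def
      by (rule uniform_limit_integral_cbox) (auto intro: continuous_on_mult continuous_trig[OF S] continuous_wave)
    have IF: "I F = (if l \<in> F then fcoeff a f l * (2 * a) ^ CARD('n) else 0)" if "finite F" for F
    proof -
      have "((\<lambda>t. \<Sum>k\<in>F. fcoeff a f k * wave (freq a (\<lambda>i. l i - k i)) t) has_integral
          (\<Sum>k\<in>F. fcoeff a f k * (if (\<lambda>i. l i - k i) = (\<lambda>i. 0) then (2 * a) ^ CARD('n) else 0))) ?Q"
        by (intro has_integral_sum that has_integral_mult_right)
          (simp only: integral_wave_freq[OF a, symmetric], intro integrable_integral integrable_cube continuous_wave)
      moreover have "wave (freq a (\<lambda>i. l i - k i)) t = wave (- freq a k) t * ?w t" for k t
        using wave_add[of "- freq a k" "freq a l" t] by (simp add: freq_minus freq_add)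
      ultimately have "I F = (\<Sum>k\<in>F. fcoeff a f k * (if (\<lambda>i. l i - k i) = (\<lambda>i. 0) then (2 * a) ^ CARD('n) else 0))"
        using I[of F] by (simp add: sum_distrib_right mult.assoc has_integral_unique)
      also have "\<dots> = (\<Sum>k\<in>F. if k = l then fcoeff a f l * (2 * a) ^ CARD('n) else 0)"
      proof (intro sum.cong refl)
        fix k
        have "(\<lambda>i. l i - k i) = (\<lambda>i. 0) \<longleftrightarrow> k = l" by (auto simp: fun_eq_iff)
        then show "fcoeff a f k * (if (\<lambda>i. l i - k i) = (\<lambda>i. 0) then (2 * a) ^ CARD('n) else 0) =
            (if k = l then fcoeff a f l * (2 * a) ^ CARD('n) else 0)" by auto
      qed
      finally show ?thesis using that by simp
    qed
    have "(I \<longlongrightarrow> fcoeff a f l * (2 * a) ^ CARD('n)) (finite_subsets_at_top UNIV)"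
    proof (rule tendsto_eventually)
      show "\<forall>\<^sub>F F in finite_subsets_at_top UNIV. I F = fcoeff a f l * (2 * a) ^ CARD('n)"
        unfolding eventually_finite_subsets_at_top
        by (rule exI[of _ "{l}"]) (auto simp: IF)
    qed
    with IJ have "J = fcoeff a f l * (2 * a) ^ CARD('n)"
      by (rule tendsto_unique[rotated 1]) simp
    then have "integral ?Q (\<lambda>t. g t * ?w t) = integral ?Q (\<lambda>t. f t * ?w t)"
      using J a by (simp add: integral_unique fcoeff_def)
    moreover have "integral ?Q (\<lambda>t. (f t - g t) * ?w t) = integral ?Q (\<lambda>t. f t * ?w t) - integral ?Q (\<lambda>t. g t * ?w t)"
      unfolding left_diff_distrib
      by (intro integral_diff integrable_cube continuous_on_mult g continuous_wave smooth_imp_continuous[OF f(1)])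
    ultimately show ?thesis by (simp add: fcoeff_def)
  qed
  have "f t - g t = 0" if t: "t \<in> ?Q" for t
  proof (rule fcoeff_unique[OF a _ _ fg t])
    show "continuous_on ?Q (\<lambda>t. f t - g t)"
      by (intro continuous_on_diff smooth_imp_continuous f g)
    \<comment> \<open>\<open>f\<close> is approximated because it vanishes on the boundary of the
      larger cube, \<open>g\<close> because it is the uniform limit of partial sums; the difference
      of the two approximants serves.\<close>
    show "\<exists>p. trig a p \<and> (\<forall>t\<in>?Q. norm (f t - g t - p t) < e)" if "e > 0" for e
    proof -
      have "f t = 0" if "t \<in> ?Q" "\<bar>t $ j\<bar> = a" for t j
      proof -
        have "t \<notin> cube r" using that(2) r by (auto simp: mem_cube not_le)
        then show ?thesis using f(2) not_in_supp by blast
      qed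
      then obtain p where p: "trig a p" "\<And>t. t \<in> ?Q \<Longrightarrow> norm (f t - p t) < e / 2"
        using trig_approximation[OF a smooth_imp_continuous[OF f(1)], of "e / 2"] \<open>e > 0\<close> by auto
      have "\<forall>\<^sub>F F in finite_subsets_at_top UNIV. \<forall>t\<in>?Q. dist (?S F t) (g t) < e / 2"
        using uniform_limitD[OF lim, of "e / 2"] \<open>e > 0\<close> by simp
      then obtain F where F: "\<And>t. t \<in> ?Q \<Longrightarrow> dist (?S F t) (g t) < e / 2"
        using eventually_happens'[OF finite_subsets_at_top_neq_bot] by blast
      have "trig a (\<lambda>t. p t + (-1) * ?S F t)" by (intro trig_add trig_cmult p S)
      moreover have "norm (f t - g t - (p t + (-1) * ?S F t)) < e" if "t \<in> ?Q" for t
      proof -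
        have "norm ((f t - p t) + (?S F t - g t)) < e / 2 + e / 2"
          by (rule norm_add_less) (use p(2) F that in \<open>auto simp: dist_norm\<close>)
        then show ?thesis by (simp add: algebra_simps)
      qed
      ultimately show ?thesis by blast
    qed
  qed
  then show ?thesis
    using lim by (auto simp: uniform_limit_iff)
qed

section \<open>Localised Fourier transforms\<close>

lemma fourier_mult_dist: "fourier (mult_dist \<phi> u) \<xi> = u (\<lambda>t. \<phi> t * wave \<xi> t)"
  by (simp add: fourier_def mult_dist_def wave_def)

lemma pd_wave_bound: "norm (pd b (wave \<eta>) t) \<le> (8 * (1 + norm \<eta>)) ^ length b"
proof -
  have "norm (pd b (wave \<eta>) t) \<le> (2 * pi * norm \<eta>) ^ length b"
    using norm_wave_symbol_le by (simp add: pd_wave norm_mult)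
  also have "\<dots> \<le> (8 * (1 + norm \<eta>)) ^ length b"
    using pi_less_4 mult_right_mono[of pi 4 "norm \<eta>"] by (intro power_mono) (auto simp: algebra_simps)
  finally show ?thesis .
qed

lemma supp_mult: "supp (\<lambda>t. f t * g t) \<subseteq> supp f"
  unfolding supp_def by (intro closure_mono) auto

text \<open>On \<open>K\<close> the functional u has some finite order m. Each derivative that falls
  on the exponential costs at most the factor \<open>8 * (1 + norm \<eta>)\<close>, where 8 is a
  bound for 2 pi; the others fall on \<phi> and are bounded.\<close>

lemma fourier_localised_growth:
  fixes \<phi> :: "real^'n::finite \<Rightarrow> complex"
  assumes u: "distribution u" and \<phi>: "smooth_fun \<phi>" "supp \<phi> \<subseteq> K" "compact K"
  shows "\<exists>C\<ge>0. \<exists>m. \<forall>\<eta>. norm (u (\<lambda>t. \<phi> t * wave \<eta> t)) \<le> C * (1 + norm \<eta>) ^ m"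
proof -
  obtain C m where C: "C \<ge> 0" and Cm: "\<And>f b. f \<in> test_functions K \<Longrightarrow>
      (\<And>is x. length is \<le> m \<Longrightarrow> norm (pd is f x) \<le> b) \<Longrightarrow> norm (u f) \<le> C * b"
    using distribution_bound[OF u \<phi>(3)] by metis
  obtain B where B: "B \<ge> 0" "\<And>is t. length is \<le> m \<Longrightarrow> norm (pd is \<phi> t) \<le> B"
    using bounded_pd[OF \<phi>, of m] by blast
  have "norm (u (\<lambda>t. \<phi> t * wave \<eta> t)) \<le> C * (2 ^ m * (B * (8 * (1 + norm \<eta>)) ^ m))" for \<eta>
  proof (rule Cm)
    show "(\<lambda>t. \<phi> t * wave \<eta> t) \<in> test_functions K"
      using supp_mult[of \<phi>] \<phi>(2) by (auto simp: test_functions_def intro: smooth_mult \<phi> smooth_wave)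
    fix "is" :: "'n list" and x assume len: "length is \<le> m"
    have "norm (pd is (\<lambda>t. \<phi> t * wave \<eta> t) x) \<le> 2 ^ length is * (B * (8 * (1 + norm \<eta>)) ^ m)"
    proof (rule norm_pd_mult_le[OF \<phi>(1) smooth_wave])
      fix a b :: "'n list" assume "length a + length b = length is"
      then have ab: "length a \<le> m" "length b \<le> m" using len by auto
      have "norm (pd b (wave \<eta>) x) \<le> (8 * (1 + norm \<eta>)) ^ length b" by (rule pd_wave_bound)
      also have "\<dots> \<le> (8 * (1 + norm \<eta>)) ^ m"
        using ab(2) norm_ge_zero[of \<eta>] by (intro power_increasing) auto
      finally show "norm (pd a \<phi> x) * norm (pd b (wave \<eta>) x) \<le> B * (8 * (1 + norm \<eta>)) ^ m"
        using B ab by (intro mult_mono) auto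
    qed
    also have "\<dots> \<le> 2 ^ m * (B * (8 * (1 + norm \<eta>)) ^ m)"
      using len B(1) by (intro mult_right_mono power_increasing) auto
    finally show "norm (pd is (\<lambda>t. \<phi> t * wave \<eta> t) x) \<le> 2 ^ m * (B * (8 * (1 + norm \<eta>)) ^ m)" .
  qed
  then have "norm (u (\<lambda>t. \<phi> t * wave \<eta> t)) \<le> (C * 2 ^ m * B * 8 ^ m) * (1 + norm \<eta>) ^ m" for \<eta>
    unfolding power_mult_distrib by (simp only: mult_ac)
  moreover have "C * 2 ^ m * B * 8 ^ m \<ge> 0" using C B by simp
  ultimately show ?thesis by blast
qed

section \<open>Distributions applied to Fourier expansions\<close>

lemma distribution_add:
  "distribution u \<Longrightarrow> compact K \<Longrightarrow> f \<in> test_functions K \<Longrightarrow> g \<in> test_functions K \<Longrightarrow>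
    u (\<lambda>t. f t + g t) = u f + u g"
  and distribution_cmult:
  "distribution u \<Longrightarrow> compact K \<Longrightarrow> f \<in> test_functions K \<Longrightarrow> u (\<lambda>t. c * f t) = c * u f"
  unfolding distribution_def by (elim conjE, blast)+

lemma test_functions_sum:
  assumes "closed K" "\<And>k. k \<in> F \<Longrightarrow> f k \<in> test_functions K"
  shows "(\<lambda>t. \<Sum>k\<in>F. f k t) \<in> test_functions K"
proof -
  have "f k t = 0" if "k \<in> F" "t \<notin> K" for k t
    using that assms(2)[of k] not_in_supp by (auto simp: test_functions_def)
  then have "supp (\<lambda>t. \<Sum>k\<in>F. f k t) \<subseteq> K"
    by (intro supp_subset assms(1) sum.neutral) blast
  then show ?thesis using assms(2) by (auto simp: test_functions_def intro: smooth_sum)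
qed

lemma distribution_sum:
  assumes u: "distribution u" and K: "compact K" and F: "\<And>k. k \<in> F \<Longrightarrow> f k \<in> test_functions K"
  shows "u (\<lambda>t. \<Sum>k\<in>F. f k t) = (\<Sum>k\<in>F. u (f k))"
  using F
proof (induction F rule: infinite_finite_induct)
  case (insert k F)
  then show ?case
    using distribution_add[OF u K, of "f k" "\<lambda>t. \<Sum>k\<in>F. f k t"] test_functions_sum[OF compact_imp_closed[OF K], of F f]
    by simp
next
  have z: "u (\<lambda>t. 0) = 0"
  proof -
    have "(\<lambda>t. 0) \<in> test_functions K" by (simp add: test_functions_def smooth_const supp_def)
    from distribution_cmult[OF u K this, of 0] show ?thesis by simp
  qed
  case (infinite F)
  then show ?case by (simp add: z)
next
  have z: "u (\<lambda>t. 0) = 0"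
  proof -
    have "(\<lambda>t. 0) \<in> test_functions K" by (simp add: test_functions_def smooth_const supp_def)
    from distribution_cmult[OF u K this, of 0] show ?thesis by simp
  qed
  case empty
  then show ?case by (simp add: z)
qed

lemma cube_mono: "r \<le> a \<Longrightarrow> cube r \<subseteq> cube a"
  unfolding mem_cube subset_iff by (meson order_trans)

text \<open>The Fourier expansion of \<open>\<psi>\<close> may be applied under \<open>u\<close>, since the expansions of all
  derivatives of \<open>\<psi>\<close> converge uniformly on a neighbourhood of \<open>supp \<phi>\<close>.\<close>

lemma fourier_localised_expansion:
  fixes \<psi> :: "real^'n::finite \<Rightarrow> complex"
  assumes u: "distribution u"
    and \<phi>: "smooth_fun \<phi>" "supp \<phi> \<subseteq> cube r" and \<psi>: "smooth_fun \<psi>" "supp \<psi> \<subseteq> cube r"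
    and r: "0 < r" "r < a" and \<phi>\<psi>: "\<And>t. \<phi> t * \<psi> t = \<psi> t"
  shows "((\<lambda>F. \<Sum>k\<in>F. fcoeff a \<psi> k * u (\<lambda>t. \<phi> t * wave (\<xi> - freq a k) t))
    \<longlongrightarrow> u (\<lambda>t. \<psi> t * wave \<xi> t)) (finite_subsets_at_top UNIV)"
proof -
  let ?K = "cube r :: (real^'n) set"
  define \<theta> where "\<theta> = (\<lambda>t. \<phi> t * wave \<xi> t)"
  define e where "e k = (\<lambda>t. fcoeff a \<psi> k * wave (- freq a k) t)" for k
  define R where "R F = (\<lambda>t. \<psi> t + (-1) * (\<Sum>k\<in>F. e k t))" for F
  have \<theta>: "smooth_fun \<theta>" "supp \<theta> \<subseteq> ?K"
    using supp_mult[of \<phi> "wave \<xi>"] \<phi>(2) by (auto simp: \<theta>_def intro: smooth_mult \<phi> smooth_wave)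
  have e: "smooth_fun (e k)" for k
    unfolding e_def by (intro smooth_mult smooth_const smooth_wave)
  have R: "smooth_fun (R F)" for F
    unfolding R_def by (intro smooth_add smooth_mult smooth_const smooth_sum \<psi> e)
  have \<theta>f: "(\<lambda>t. \<theta> t * f t) \<in> test_functions ?K" if "smooth_fun f" for f
    using supp_mult[of \<theta> f] \<theta> that by (auto simp: test_functions_def intro: smooth_mult)
  have split: "u (\<lambda>t. \<psi> t * wave \<xi> t) =
      u (\<lambda>t. \<theta> t * R F t) + (\<Sum>k\<in>F. fcoeff a \<psi> k * u (\<lambda>t. \<phi> t * wave (\<xi> - freq a k) t))" for F
  proof -
    have "(\<lambda>t. \<psi> t * wave \<xi> t) = (\<lambda>t. \<theta> t * R F t + (\<Sum>k\<in>F. \<theta> t * e k t))"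
    proof
      fix t
      have "\<theta> t * R F t + (\<Sum>k\<in>F. \<theta> t * e k t) = \<theta> t * \<psi> t"
        unfolding R_def sum_distrib_left[symmetric] by (simp add: right_diff_distrib)
      also have "\<dots> = \<phi> t * \<psi> t * wave \<xi> t" by (simp only: \<theta>_def mult_ac)
      finally show "\<psi> t * wave \<xi> t = \<theta> t * R F t + (\<Sum>k\<in>F. \<theta> t * e k t)"
        by (simp only: \<phi>\<psi>)
    qed
    then have "u (\<lambda>t. \<psi> t * wave \<xi> t) = u (\<lambda>t. \<theta> t * R F t) + u (\<lambda>t. \<Sum>k\<in>F. \<theta> t * e k t)"
      using distribution_add[OF u compact_cube \<theta>f[OF R] test_functions_sum[OF compact_imp_closed[OF compact_cube] \<theta>f[OF e]]]
      by simp
    also have "u (\<lambda>t. \<Sum>k\<in>F. \<theta> t * e k t) = (\<Sum>k\<in>F. u (\<lambda>t. \<theta> t * e k t))"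
      by (rule distribution_sum[OF u compact_cube \<theta>f[OF e]])
    also have "(\<Sum>k\<in>F. u (\<lambda>t. \<theta> t * e k t)) = (\<Sum>k\<in>F. fcoeff a \<psi> k * u (\<lambda>t. \<phi> t * wave (\<xi> - freq a k) t))"
    proof (rule sum.cong[OF refl])
      fix k
      have "(\<lambda>t. \<theta> t * e k t) = (\<lambda>t. fcoeff a \<psi> k * (\<phi> t * wave (\<xi> - freq a k) t))"
        using wave_add[of \<xi> "- freq a k"] by (auto simp: \<theta>_def e_def)
      moreover have "(\<lambda>t. \<phi> t * wave (\<xi> - freq a k) t) \<in> test_functions ?K"
        using supp_mult[of \<phi>] \<phi> by (auto simp: test_functions_def intro: smooth_mult smooth_wave)
      ultimately show "u (\<lambda>t. \<theta> t * e k t) = fcoeff a \<psi> k * u (\<lambda>t. \<phi> t * wave (\<xi> - freq a k) t)"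
        by (simp add: distribution_cmult[OF u compact_cube])
    qed
    finally show ?thesis .
  qed
  \<comment> \<open>Derivatives act on the coefficients through \<open>wave_symbol\<close>, so a
    derivative of the remainder is the remainder in the Fourier series of the derivative, to which
    uniform convergence applies again.\<close>
  have pdR: "pd b (R F) t = pd b \<psi> t - (\<Sum>k\<in>F. fcoeff a (pd b \<psi>) k * wave (- freq a k) t)" for b F t
  proof -
    have "pd b (e k) t = fcoeff a (pd b \<psi>) k * wave (- freq a k) t" for k t
      unfolding e_def by (simp add: pd_cmult smooth_wave pd_wave fcoeff_pd[OF \<psi> r])
    moreover have "pd b (R F) = (\<lambda>t. pd b \<psi> t + (-1) * (\<Sum>k\<in>F. pd b (e k) t))"
      unfolding R_def
      by (subst pd_add[OF \<psi>(1) smooth_mult[OF smooth_const smooth_sum[OF e]]])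
        (simp only: pd_cmult[OF smooth_sum[OF e]] pd_sum[OF e])
    ultimately show ?thesis by simp
  qed
  obtain C m where C: "C \<ge> 0" and Cm: "\<And>f b. f \<in> test_functions ?K \<Longrightarrow>
      (\<And>is x. length is \<le> m \<Longrightarrow> norm (pd is f x) \<le> b) \<Longrightarrow> norm (u f) \<le> C * b"
    using distribution_bound[OF u compact_cube] by metis
  obtain B where B: "B \<ge> 0" "\<And>is t. length is \<le> m \<Longrightarrow> norm (pd is \<theta> t) \<le> B"
    using bounded_pd[OF \<theta> compact_cube, of m] by blast
  show ?thesis
  proof (rule tendstoI)
    fix \<epsilon> :: real assume "\<epsilon> > 0"
    \<comment> \<open>The final estimate of u on the remainder is
      \<open>C * (2 ^ m * B) * \<delta>\<close>; adding 1 in the denominator makes it strictly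
      smaller than \<epsilon>, also when the product is 0.\<close>
    define \<delta> where "\<delta> = \<epsilon> / (C * (2 ^ m * B) + 1)"
    have pos: "C * (2 ^ m * B) + 1 > 0" using C B by (intro add_nonneg_pos mult_nonneg_nonneg) auto
    then have \<delta>: "\<delta> > 0" using \<open>\<epsilon> > 0\<close> by (simp add: \<delta>_def)
    let ?L = "{b :: 'n list. length b \<le> m}"
    have "finite ?L" using finite_lists_length_le[of "UNIV :: 'n set" m] by simp
    moreover have "\<forall>\<^sub>F F in finite_subsets_at_top UNIV. \<forall>t\<in>cube a. norm (pd b (R F) t) < \<delta>" for b
    proof -
      have "supp (pd b \<psi>) \<subseteq> ?K" using supp_pd \<psi>(2) by blast
      from uniform_limitD[OF fourier_series_uniform[OF smooth_pd[OF \<psi>(1)] this r] \<delta>]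
      show ?thesis by (simp add: pdR dist_norm norm_minus_commute)
    qed
    ultimately have "\<forall>\<^sub>F F in finite_subsets_at_top UNIV. \<forall>b\<in>?L. \<forall>t\<in>cube a. norm (pd b (R F) t) < \<delta>"
      by (rule eventually_ball_finite[OF _ ballI])
    then show "\<forall>\<^sub>F F in finite_subsets_at_top UNIV.
        dist (\<Sum>k\<in>F. fcoeff a \<psi> k * u (\<lambda>t. \<phi> t * wave (\<xi> - freq a k) t)) (u (\<lambda>t. \<psi> t * wave \<xi> t)) < \<epsilon>"
    proof eventually_elim
      fix F assume F: "\<forall>b\<in>?L. \<forall>t\<in>cube a. norm (pd b (R F) t) < \<delta>"
      have "norm (u (\<lambda>t. \<theta> t * R F t)) \<le> C * (2 ^ m * (B * \<delta>))"
      proof (rule Cm[OF \<theta>f[OF R]])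
        fix "is" :: "'n list" and x assume len: "length is \<le> m"
        have "norm (pd is (\<lambda>t. \<theta> t * R F t) x) \<le> 2 ^ length is * (B * \<delta>)"
        proof (rule norm_pd_mult_le[OF \<theta>(1) R])
          fix b c :: "'n list" assume "length b + length c = length is"
          then have bc: "length b \<le> m" "length c \<le> m" using len by auto
          show "norm (pd b \<theta> x) * norm (pd c (R F) x) \<le> B * \<delta>"
          proof (cases "x \<in> cube a")
            case True
            then have "norm (pd c (R F) x) < \<delta>" using F bc by auto
            then show ?thesis using B bc \<delta> by (intro mult_mono) auto
          next
            \<comment> \<open>Outside the cube the periodic series no longer represents \<psi> and
              \<open>R F\<close> is not controlled, but there every derivative of \<theta> is
              0.\<close>
            case False
            then have "x \<notin> ?K" using r cube_mono[of r a] by auto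
            then have "pd b \<theta> x = 0" using \<theta>(2) pd_outside_supp by blast
            then show ?thesis using B \<delta> by simp
          qed
        qed
        also have "\<dots> \<le> 2 ^ m * (B * \<delta>)"
          using len B(1) \<delta> by (intro mult_right_mono power_increasing) auto
        finally show "norm (pd is (\<lambda>t. \<theta> t * R F t) x) \<le> 2 ^ m * (B * \<delta>)" .
      qed
      also have "\<dots> = (C * (2 ^ m * B)) * \<delta>" by simp
      also have "\<dots> < (C * (2 ^ m * B) + 1) * \<delta>" using \<delta> by (intro mult_strict_right_mono) auto
      also have "\<dots> = \<epsilon>" using pos by (simp add: \<delta>_def)
      finally show "dist (\<Sum>k\<in>F. fcoeff a \<psi> k * u (\<lambda>t. \<phi> t * wave (\<xi> - freq a k) t)) (u (\<lambda>t. \<psi> t * wave \<xi> t)) < \<epsilon>"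
        using split[of F] by (simp add: dist_norm norm_minus_commute)
    qed
  qed
qed

text \<open>The factor \<open>?E\<close> comes from the near frequencies, where |\<xi> - \<eta>_k|
  is at least (1 - c)|\<xi>|; \<open>?X\<close> comes from the far ones, where |\<xi>| is less than
  |\<eta>_k| / c. Each term of the series keeps a factor \<open>weight k\<close>, so summation costs
  no more than \<open>5 ^ d\<close>. The constants stay explicit because their dependence on N
  decides the new parameter later.\<close>

lemma fourier_localised_cone_estimate:
  fixes \<psi> :: "real^'n::finite \<Rightarrow> complex"
  defines "d \<equiv> CARD('n)"
  assumes u: "distribution u"
    and \<phi>: "smooth_fun \<phi>" "supp \<phi> \<subseteq> cube r" and \<psi>: "smooth_fun \<psi>" "supp \<psi> \<subseteq> cube r"
    and r: "0 < r" "r < a" and \<phi>\<psi>: "\<And>t. \<phi> t * \<psi> t = \<psi> t"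
    and growth: "C \<ge> 0" "\<And>\<eta>. norm (u (\<lambda>t. \<phi> t * wave \<eta> t)) \<le> C * (1 + norm \<eta>) ^ m"
    and c: "0 < c" "c < 1" and cone: "\<And>\<eta>. norm (\<eta> - \<xi>) \<le> c * norm \<xi> \<Longrightarrow> \<eta> \<in> \<Gamma>"
    and E: "\<And>\<eta>. \<eta> \<in> \<Gamma> \<Longrightarrow> norm (u (\<lambda>t. \<phi> t * wave \<eta> t)) * norm \<eta> ^ N \<le> E"
    and D0: "\<And>t. norm (\<psi> t) \<le> D0" "\<And>i t. norm (pd (replicate (2 * d) i) \<psi> t) \<le> D0'"
    and D: "\<And>i t. norm (pd (replicate N i) \<psi> t) \<le> D"
      "\<And>i t. norm (pd (replicate (N + (m + 2 * d)) i) \<psi> t) \<le> D'"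
  shows "norm (u (\<lambda>t. \<psi> t * wave \<xi> t)) * norm \<xi> ^ N \<le> 5 ^ d *
    (2 ^ (2 * d) * real d ^ (2 * d) * (D0 + (2 * a) ^ (2 * d) * D0') * (E * (1 / (1 - c)) ^ N)
      + C * (1 / c) ^ N * (2 ^ (m + 2 * d) * real d ^ (N + (m + 2 * d)) *
          (D + max (2 * a) (1 + 1 / c) ^ (m + 2 * d) * D')))" (is "_ \<le> 5 ^ d * (?W0 * ?E + ?X)")
proof -
  \<comment> \<open>One number for two purposes: \<open>2 * a\<close> is asked by
    \<open>one_le_weight\<close>, and \<open>1 + 1 / c\<close> bounds |\<xi> - \<eta>_k| by a
    multiple of |\<eta>_k| for far k. The powers m and 2d then combine into one.\<close>
  let ?b = "max (2 * a) (1 + 1 / c)"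
  have b: "0 \<le> ?b" using r by auto
  have a: "a > 0" using r by simp
  have "0 \<le> D0" "0 \<le> D0'" "0 \<le> D" "0 \<le> D'"
    using order_trans[OF norm_ge_zero] D0 D by blast+
  note nn = this
  have W0: "?W0 \<ge> 0" using nn a by (intro mult_nonneg_nonneg add_nonneg_nonneg) auto
  have X: "?X \<ge> 0" using nn b growth(1) c by (intro mult_nonneg_nonneg add_nonneg_nonneg) auto
  have E0: "?E \<ge> 0"
  proof -
    have "\<xi> \<in> \<Gamma>" using cone[of \<xi>] c by simp
    then have "0 \<le> E" using E[of \<xi>] by (meson norm_ge_zero order_trans zero_le_mult_iff zero_le_power)
    then show ?thesis using c by simp
  qed
  have summand: "norm (fcoeff a \<psi> k * u (\<lambda>t. \<phi> t * wave (\<xi> - freq a k) t)) * norm \<xi> ^ N \<le> weight k * (?W0 * ?E + ?X)" for k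
  proof -
    let ?v = "norm (freq a k)" and ?c = "norm (fcoeff a \<psi> k)"
    let ?G = "norm (u (\<lambda>t. \<phi> t * wave (\<xi> - freq a k) t))"
    have w: "weight k \<ge> 0" by (rule less_imp_le[OF weight_pos])
    show ?thesis
    proof (cases "?v \<le> c * norm \<xi>")
      case True
      then have \<Gamma>: "\<xi> - freq a k \<in> \<Gamma>" by (intro cone) simp
      have "(1 - c) * norm \<xi> \<le> norm (\<xi> - freq a k)"
        using True norm_triangle_ineq2[of \<xi> "freq a k"] by (simp add: algebra_simps)
      then have "((1 - c) * norm \<xi>) ^ N \<le> norm (\<xi> - freq a k) ^ N" using c by (intro power_mono) auto
      then have "?G * ((1 - c) * norm \<xi>) ^ N \<le> ?G * norm (\<xi> - freq a k) ^ N"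
        by (intro mult_left_mono) auto
      also have "\<dots> \<le> E" by (rule E[OF \<Gamma>])
      finally have "(?G * ((1 - c) * norm \<xi>) ^ N) * (1 / (1 - c)) ^ N \<le> E * (1 / (1 - c)) ^ N"
        using c by (intro mult_right_mono) auto
      moreover have "(?G * ((1 - c) * norm \<xi>) ^ N) * (1 / (1 - c)) ^ N = ?G * norm \<xi> ^ N"
        using c by (simp add: power_mult_distrib power_divide)
      ultimately have G: "?G * norm \<xi> ^ N \<le> ?E" by simp
      have cW: "?c \<le> weight k * ?W0"
        using fcoeff_le_weight[OF \<psi> r D0(1) D0(2)[unfolded d_def]] unfolding d_def .
      have "?c * (?G * norm \<xi> ^ N) \<le> (weight k * ?W0) * ?E"
        by (rule mult_mono[OF cW G mult_nonneg_nonneg[OF w W0]]) simp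
      also have "(weight k * ?W0) * ?E = weight k * (?W0 * ?E)" by (rule mult.assoc)
      also have "\<dots> \<le> weight k * (?W0 * ?E + ?X)"
        by (rule mult_left_mono[OF add_increasing2[OF X order_refl] w])
      finally show ?thesis by (simp add: norm_mult mult_ac)
    next
      case False
      then have \<xi>: "norm \<xi> \<le> ?v / c" using c by (simp add: field_simps)
      have "norm (\<xi> - freq a k) \<le> norm \<xi> + ?v" by (rule norm_triangle_ineq4)
      also have "\<dots> \<le> (1 + 1 / c) * ?v" using \<xi> by (simp add: algebra_simps)
      also have "\<dots> \<le> ?b * ?v" by (intro mult_right_mono) auto
      finally have "(1 + norm (\<xi> - freq a k)) ^ m \<le> (1 + ?b * ?v) ^ m" by (intro power_mono) auto
      then have "C * (1 + norm (\<xi> - freq a k)) ^ m \<le> C * (1 + ?b * ?v) ^ m"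
        using growth(1) by (intro mult_left_mono)
      then have G: "?G \<le> C * (1 + ?b * ?v) ^ m" using growth(2)[of "\<xi> - freq a k"] by linarith
      have \<xi>N: "norm \<xi> ^ N \<le> (1 / c) ^ N * ?v ^ N"
        using power_mono[OF \<xi>, of N] by (simp add: power_divide)
      have "1 \<le> weight k * (1 + 2 * a * ?v) ^ (2 * d)" unfolding d_def by (rule one_le_weight[OF a])
      also have "\<dots> \<le> weight k * (1 + ?b * ?v) ^ (2 * d)"
        using w a mult_right_mono[of "2 * a" ?b ?v] by (intro mult_left_mono power_mono) auto
      finally have 1: "1 \<le> weight k * (1 + ?b * ?v) ^ (2 * d)" .
      have "?c * ?G * norm \<xi> ^ N * 1 \<le> ?c * (C * (1 + ?b * ?v) ^ m) * ((1 / c) ^ N * ?v ^ N) * (weight k * (1 + ?b * ?v) ^ (2 * d))"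
        using G \<xi>N 1 growth(1) b c by (intro mult_mono mult_nonneg_nonneg) auto
      also have "\<dots> = weight k * (C * (1 / c) ^ N * (?c * ?v ^ N * (1 + ?b * ?v) ^ (m + 2 * d)))"
        by (simp add: power_add mult_ac)
      also have "\<dots> \<le> weight k * ?X"
        unfolding d_def using w growth(1) c D b
        by (intro mult_left_mono fcoeff_decay_weight[OF \<psi> r]) (auto simp: d_def)
      also have "\<dots> \<le> weight k * (?W0 * ?E + ?X)"
        by (rule mult_left_mono[OF add_increasing[OF mult_nonneg_nonneg[OF W0 E0] order_refl] w])
      finally show ?thesis by (simp add: norm_mult)
    qed
  qed
  have "norm ((\<Sum>k\<in>F. fcoeff a \<psi> k * u (\<lambda>t. \<phi> t * wave (\<xi> - freq a k) t)) * norm \<xi> ^ N) \<le> 5 ^ d * (?W0 * ?E + ?X)"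
    if "finite F" for F
  proof -
    have "norm ((\<Sum>k\<in>F. fcoeff a \<psi> k * u (\<lambda>t. \<phi> t * wave (\<xi> - freq a k) t)) * norm \<xi> ^ N)
        \<le> (\<Sum>k\<in>F. weight k * (?W0 * ?E + ?X))"
      unfolding sum_distrib_right by (rule sum_norm_le) (use summand in \<open>simp add: norm_mult norm_power\<close>)
    also have "\<dots> = (\<Sum>k\<in>F. weight k) * (?W0 * ?E + ?X)" by (simp only: sum_distrib_right)
    also have "\<dots> \<le> 5 ^ d * (?W0 * ?E + ?X)"
      by (rule mult_right_mono[OF weight_sum_bounded[OF that, folded d_def]
            add_nonneg_nonneg[OF mult_nonneg_nonneg[OF W0 E0] X]])
    finally show ?thesis .
  qed
  then have "\<forall>\<^sub>F F in finite_subsets_at_top UNIV.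
      norm ((\<Sum>k\<in>F. fcoeff a \<psi> k * u (\<lambda>t. \<phi> t * wave (\<xi> - freq a k) t)) * norm \<xi> ^ N) \<le> 5 ^ d * (?W0 * ?E + ?X)"
    by (auto simp: eventually_finite_subsets_at_top)
  moreover have "((\<lambda>F. (\<Sum>k\<in>F. fcoeff a \<psi> k * u (\<lambda>t. \<phi> t * wave (\<xi> - freq a k) t)) * norm \<xi> ^ N)
      \<longlongrightarrow> u (\<lambda>t. \<psi> t * wave \<xi> t) * norm \<xi> ^ N) (finite_subsets_at_top UNIV)"
    by (intro tendsto_intros fourier_localised_expansion[OF u \<phi> \<psi> r \<phi>\<psi>])
  ultimately have "norm (u (\<lambda>t. \<psi> t * wave \<xi> t) * norm \<xi> ^ N) \<le> 5 ^ d * (?W0 * ?E + ?X)"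
    by (intro Lim_norm_ubound[rotated]) auto
  then show ?thesis by (simp add: norm_mult norm_power)
qed

section \<open>The weight sequence\<close>

definition growth :: "real \<Rightarrow> real \<Rightarrow> real \<Rightarrow> nat \<Rightarrow> real" where
  "growth \<tau> \<sigma> h N = h powr (real N powr \<sigma>) * M_seq \<tau> \<sigma> N"

lemma M_seq_pos: "M_seq \<tau> \<sigma> N > 0"
  by (simp add: M_seq_def)

lemma growth_pos: "h > 0 \<Longrightarrow> growth \<tau> \<sigma> h N > 0"
  by (simp add: growth_def M_seq_pos)

lemma growth_0: "h > 0 \<Longrightarrow> growth \<tau> \<sigma> h 0 = 1"
  by (simp add: growth_def M_seq_def)

lemma growth_mono: "0 < h \<Longrightarrow> h \<le> h' \<Longrightarrow> growth \<tau> \<sigma> h N \<le> growth \<tau> \<sigma> h' N"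
  unfolding growth_def by (intro mult_right_mono powr_mono2 less_imp_le[OF M_seq_pos]) auto

text \<open>Reduces the inequalities on weights to asymptotic ones: the finitely many exceptional
  indices are absorbed in the constant.\<close>

lemma eventually_le_imp_le_mult:
  fixes f g :: "nat \<Rightarrow> real"
  assumes "eventually (\<lambda>N. f N \<le> g N) sequentially" "\<And>N. g N > 0"
  shows "\<exists>A>0. \<forall>N. f N \<le> A * g N"
proof -
  obtain N0 where N0: "\<And>N. N \<ge> N0 \<Longrightarrow> f N \<le> g N"
    using assms(1) by (auto simp: eventually_sequentially)
  define A where "A = 1 + (\<Sum>N<N0. \<bar>f N\<bar> / g N)"
  have nn: "0 \<le> (\<Sum>N<N0. \<bar>f N\<bar> / g N)"
    using assms(2) by (intro sum_nonneg divide_nonneg_pos) auto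
  have "f N \<le> A * g N" for N
  proof (cases "N < N0")
    case True
    have "\<bar>f N\<bar> / g N \<le> (\<Sum>N<N0. \<bar>f N\<bar> / g N)"
      using True assms(2) by (intro member_le_sum) (auto intro: divide_nonneg_pos)
    then have "\<bar>f N\<bar> / g N \<le> A" by (simp add: A_def)
    then have "\<bar>f N\<bar> \<le> A * g N" using assms(2)[of N] by (simp add: pos_divide_le_eq)
    then show ?thesis by linarith
  next
    case False
    then have "f N \<le> 1 * g N" using N0 by simp
    also have "\<dots> \<le> A * g N"
      using nn assms(2)[of N] by (intro mult_right_mono) (auto simp: A_def)
    finally show ?thesis .
  qed
  then show ?thesis using nn by (intro exI[of _ A]) (auto simp: A_def)
qed

text \<open>The logarithm of K^N M_(N+q) / M_N is of order N^(\<sigma>-1) ln N plus a linear term,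
  hence o(N^\<sigma>) because \<sigma> > 1. It is eventually at most N^\<sigma>, which accounts for
  the factor \<open>exp 1\<close> in the new parameter; the maximum accounts for the shifted
  exponent of h.\<close>

lemma growth_shift:
  fixes K h :: real
  assumes \<tau>: "\<tau> > 0" and \<sigma>: "\<sigma> > 1" and h: "h > 0"
  shows "\<exists>A>0. \<forall>N. K ^ N * growth \<tau> \<sigma> h (N + q)
    \<le> A * growth \<tau> \<sigma> (exp 1 * max h (h powr (real (q + 1) powr \<sigma>))) N"
proof (rule eventually_le_imp_le_mult)
  let ?Q = "real (q + 1) powr \<sigma>"
  let ?H = "max h (h powr ?Q)"
  define L where "L = ln (max 1 \<bar>K\<bar>)"
  have "((\<lambda>x::real. (x * L + \<tau> * ((x + real q) powr \<sigma> * ln (x + real q)) - \<tau> * (x powr \<sigma> * ln x)) / x powr \<sigma>) \<longlongrightarrow> 0) at_top"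
    using \<sigma> by real_asymp
  then have "\<forall>\<^sub>F x::real in at_top. (x * L + \<tau> * ((x + real q) powr \<sigma> * ln (x + real q)) - \<tau> * (x powr \<sigma> * ln x)) / x powr \<sigma> < 1"
    by (rule order_tendstoD) simp
  then have "\<forall>\<^sub>F N in sequentially. (real N * L + \<tau> * ((real N + real q) powr \<sigma> * ln (real N + real q)) - \<tau> * (real N powr \<sigma> * ln (real N))) / real N powr \<sigma> < 1"
    by (rule eventually_compose_filterlim) (rule filterlim_real_sequentially)
  moreover have "\<forall>\<^sub>F N in sequentially. N \<ge> (1 :: nat)" by (rule eventually_ge_at_top)
  ultimately show "\<forall>\<^sub>F N in sequentially. K ^ N * growth \<tau> \<sigma> h (N + q) \<le> growth \<tau> \<sigma> (exp 1 * ?H) N"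
  proof eventually_elim
    fix N :: nat
    assume *: "(real N * L + \<tau> * ((real N + real q) powr \<sigma> * ln (real N + real q)) - \<tau> * (real N powr \<sigma> * ln (real N))) / real N powr \<sigma> < 1"
      and N: "N \<ge> 1"
    let ?s = "real N powr \<sigma>"
    have s: "?s > 0" using N by simp
    have "K ^ N \<le> \<bar>K ^ N\<bar>" by (rule abs_ge_self)
    also have "\<dots> \<le> (max 1 \<bar>K\<bar>) ^ N" unfolding power_abs by (intro power_mono) auto
    also have "\<dots> = exp (real N * L)"
      unfolding L_def by (subst exp_of_nat_mult) (auto intro!: arg_cong[of _ _ "\<lambda>x. x ^ N"] exp_ln[symmetric])
    finally have KN: "K ^ N \<le> exp (real N * L)" .
    have M: "M_seq \<tau> \<sigma> (N + q) = exp (\<tau> * ((real N + real q) powr \<sigma> * ln (real N + real q)))"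
      "M_seq \<tau> \<sigma> N = exp (\<tau> * (?s * ln (real N)))"
      using N by (auto simp: M_seq_def powr_def)
    have "K ^ N * M_seq \<tau> \<sigma> (N + q) \<le> exp (real N * L) * exp (\<tau> * ((real N + real q) powr \<sigma> * ln (real N + real q)))"
      unfolding M by (intro mult_right_mono KN) simp
    also have "\<dots> \<le> exp (?s + \<tau> * (?s * ln (real N)))"
      using * s by (simp add: exp_add[symmetric] divide_less_eq)
    also have "\<dots> = exp 1 powr ?s * M_seq \<tau> \<sigma> N"
      unfolding M by (simp add: exp_add powr_def)
    finally have 1: "K ^ N * M_seq \<tau> \<sigma> (N + q) \<le> exp 1 powr ?s * M_seq \<tau> \<sigma> N" .
    \<comment> \<open>For \<open>h \<le> 1\<close> a larger exponent only helps. For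
      \<open>h > 1\<close> the inequality \<open>N + q \<le> (q + 1) * N\<close>, valid from N = 1
      on, moves \<open>(q + 1) powr \<sigma>\<close> into the parameter.\<close>
    have 2: "h powr (real (N + q) powr \<sigma>) \<le> ?H powr ?s"
    proof (cases "h \<le> 1")
      case True
      have "?s \<le> real (N + q) powr \<sigma>" using \<sigma> by (intro powr_mono2) auto
      then have "h powr (real (N + q) powr \<sigma>) \<le> h powr ?s" using h True by (intro powr_mono') auto
      also have "\<dots> \<le> ?H powr ?s" using h by (intro powr_mono2) auto
      finally show ?thesis .
    next
      case False
      have "q * 1 \<le> q * N" using N by (intro mult_left_mono) auto
      then have "real (N + q) \<le> real (q + 1) * real N" by (simp add: of_nat_mult[symmetric] algebra_simps del: of_nat_mult)
      then have "real (N + q) powr \<sigma> \<le> (real (q + 1) * real N) powr \<sigma>" using \<sigma> by (intro powr_mono2) auto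
      then have "real (N + q) powr \<sigma> \<le> ?Q * ?s" by (subst (asm) powr_mult) auto
      then have "h powr (real (N + q) powr \<sigma>) \<le> h powr (?Q * ?s)" using False by (intro powr_mono) auto
      also have "\<dots> = (h powr ?Q) powr ?s" by (simp add: powr_powr)
      also have "\<dots> \<le> ?H powr ?s" by (intro powr_mono2) auto
      finally show ?thesis .
    qed
    have "K ^ N * growth \<tau> \<sigma> h (N + q) = h powr (real (N + q) powr \<sigma>) * (K ^ N * M_seq \<tau> \<sigma> (N + q))"
      by (simp add: growth_def)
    also have "\<dots> \<le> h powr (real (N + q) powr \<sigma>) * (exp 1 powr ?s * M_seq \<tau> \<sigma> N)"
      by (intro mult_left_mono 1) auto
    also have "\<dots> \<le> ?H powr ?s * (exp 1 powr ?s * M_seq \<tau> \<sigma> N)"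
      using M_seq_pos[of \<tau> \<sigma> N] by (intro mult_right_mono 2) auto
    also have "\<dots> = growth \<tau> \<sigma> (exp 1 * ?H) N"
      using h by (simp add: growth_def powr_mult)
    finally show "K ^ N * growth \<tau> \<sigma> h (N + q) \<le> growth \<tau> \<sigma> (exp 1 * ?H) N" .
  qed
  show "growth \<tau> \<sigma> (exp 1 * ?H) N > 0" for N
    using h by (intro growth_pos mult_pos_pos) auto
qed

text \<open>Logarithmically, s N ln N stands against \<tau> N^\<sigma> ln N + N^\<sigma> ln h. As
  \<sigma> > 1 the first term on the right dominates, and it also outweighs a negative ln h, so the
  parameter may be as small as desired.\<close>

lemma power_tower_le_growth:
  fixes C :: real
  assumes \<tau>: "\<tau> > 0" and \<sigma>: "\<sigma> > 1" and h: "h > 0" and C: "C > 0"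
  shows "\<exists>A>0. \<forall>N. (C * real (N + 1)) ^ (s * (N + 1)) \<le> A * growth \<tau> \<sigma> h N"
proof (rule eventually_le_imp_le_mult)
  have "filterlim (\<lambda>x::real. x powr \<sigma> * ln h + \<tau> * (x powr \<sigma> * ln x) - real s * (x + 1) * (ln C + ln (x + 1))) at_top at_top"
    using \<sigma> \<tau> by real_asymp
  then have "\<forall>\<^sub>F x::real in at_top. x powr \<sigma> * ln h + \<tau> * (x powr \<sigma> * ln x) - real s * (x + 1) * (ln C + ln (x + 1)) \<ge> 0"
    unfolding filterlim_at_top by blast
  then have "\<forall>\<^sub>F N in sequentially. real N powr \<sigma> * ln h + \<tau> * (real N powr \<sigma> * ln (real N)) - real s * (real N + 1) * (ln C + ln (real N + 1)) \<ge> 0"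
    by (rule eventually_compose_filterlim) (rule filterlim_real_sequentially)
  moreover have "\<forall>\<^sub>F N in sequentially. N \<ge> (1 :: nat)" by (rule eventually_ge_at_top)
  ultimately show "\<forall>\<^sub>F N in sequentially. (C * real (N + 1)) ^ (s * (N + 1)) \<le> growth \<tau> \<sigma> h N"
  proof eventually_elim
    fix N :: nat
    assume *: "real N powr \<sigma> * ln h + \<tau> * (real N powr \<sigma> * ln (real N)) - real s * (real N + 1) * (ln C + ln (real N + 1)) \<ge> 0"
      and N: "N \<ge> 1"
    have "C * real (N + 1) > 0" using C by simp
    then have "(C * real (N + 1)) ^ (s * (N + 1)) = exp (real (s * (N + 1)) * ln (C * real (N + 1)))"
      by (metis exp_ln exp_of_nat_mult)
    also have "real (s * (N + 1)) * ln (C * real (N + 1)) = real s * (real N + 1) * (ln C + ln (real N + 1))"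
    proof -
      have "ln (C * real (N + 1)) = ln C + ln (real N + 1)" using C by (simp add: ln_mult add.commute)
      then show ?thesis by (simp only: of_nat_mult of_nat_add of_nat_1)
    qed
    also have "exp \<dots> \<le> exp (real N powr \<sigma> * ln h + \<tau> * (real N powr \<sigma> * ln (real N)))"
      using * by simp
    also have "\<dots> = growth \<tau> \<sigma> h N"
      using N h by (simp add: growth_def M_seq_def powr_def[of h] powr_def[of "real N" "\<tau> * _"] exp_add)
    finally show "(C * real (N + 1)) ^ (s * (N + 1)) \<le> growth \<tau> \<sigma> h N" .
  qed
  show "growth \<tau> \<sigma> h N > 0" for N by (rule growth_pos[OF h])
qed

subsection \<open>The associated function\<close>

text \<open>In the associated function h stands in the numerator, so the terms of the supremum are
  the logarithms of the reciprocals of \<open>growth \<tau> \<sigma> (1 / h) N / k ^ N\<close>. Each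
  of them is bounded by \<open>ln (A / F)\<close>.\<close>

lemma norm_le_exp_assoc_fun:
  assumes A: "A > 0" and h: "h > 0" and k: "k > 0" and F: "F \<ge> 0"
    and le: "\<And>N. F \<le> A * (growth \<tau> \<sigma> (1 / h) N / k ^ N)"
  shows "F \<le> A * exp (- assoc_fun \<tau> \<sigma> h k)"
proof (cases "F = 0")
  case True
  then show ?thesis using A by simp
next
  case False
  then have F: "F > 0" using F by simp
  \<comment> \<open>Index 0 accounts for the positive part in \<open>ln_plus\<close>: it makes
    \<open>ln (A / F)\<close> nonnegative.\<close>
  have "F \<le> A" using le[of 0] h by (simp add: growth_0)
  have "assoc_fun \<tau> \<sigma> h k \<le> ln (A / F)"
    unfolding assoc_fun_def
  proof (rule cSUP_least)
    fix N :: nat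
    let ?x = "h powr (real N powr \<sigma>) * k ^ N / M_seq \<tau> \<sigma> N"
    have x: "?x > 0" using h k M_seq_pos[of \<tau> \<sigma> N] by simp
    have "growth \<tau> \<sigma> (1 / h) N / k ^ N = 1 / ?x"
      using h by (simp add: growth_def powr_divide)
    then have "F \<le> A / ?x" using le[of N] by simp
    then have "F * ?x \<le> A" unfolding pos_le_divide_eq[OF x] .
    then have "?x \<le> A / F" unfolding pos_le_divide_eq[OF F] by (simp only: mult.commute)
    then have "ln ?x \<le> ln (A / F)" using x by (intro ln_mono) auto
    moreover have "0 \<le> ln (A / F)" using \<open>F \<le> A\<close> F by simp
    ultimately show "ln_plus ?x \<le> ln (A / F)" by (simp add: ln_plus_def)
  qed simp
  then have "- ln (A / F) \<le> - assoc_fun \<tau> \<sigma> h k" by simp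
  then have "exp (- ln (A / F)) \<le> exp (- assoc_fun \<tau> \<sigma> h k)" by simp
  moreover have "exp (- ln (A / F)) = F / A"
    using A F by (simp add: exp_minus)
  ultimately show ?thesis using A by (simp add: field_simps)
qed

text \<open>A term lies below the real supremum only if the set is bounded. Here
  \<open>M_seq\<close> outgrows k^p h^(p^\<sigma>), by comparison with a tower.\<close>

lemma bdd_above_assoc_fun:
  assumes \<tau>: "\<tau> > 0" and \<sigma>: "\<sigma> > 1" and h: "h > 0" and k: "k > 0"
  shows "bdd_above (range (\<lambda>p::nat. ln_plus (h powr (real p powr \<sigma>) * k ^ p / M_seq \<tau> \<sigma> p)))"
proof -
  have "\<exists>A>0. \<forall>N. (k * real (N + 1)) ^ (1 * (N + 1)) \<le> A * growth \<tau> \<sigma> (1 / h) N"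
    using assms by (intro power_tower_le_growth) auto
  then obtain A where A: "A > 0" "\<And>N. (k * real (N + 1)) ^ (N + 1) \<le> A * growth \<tau> \<sigma> (1 / h) N" by auto
  have "ln_plus (h powr (real p powr \<sigma>) * k ^ p / M_seq \<tau> \<sigma> p) \<le> max 0 (ln (A / k))" for p
  proof -
    \<comment> \<open>The tower has exponent \<open>p + 1\<close>; the surplus factor
      \<open>k\<close> turns the bound \<open>A\<close> into \<open>A / k\<close>.\<close>
    have "k * k ^ p = k ^ (p + 1) * 1" by simp
    also have "\<dots> \<le> k ^ (p + 1) * real (p + 1) ^ (p + 1)"
      using k by (intro mult_left_mono one_le_power) auto
    also have "\<dots> = (k * real (p + 1)) ^ (p + 1)" by (simp only: power_mult_distrib)
    also have "\<dots> \<le> A * growth \<tau> \<sigma> (1 / h) p" by (rule A(2))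
    also have "\<dots> = A * M_seq \<tau> \<sigma> p / h powr (real p powr \<sigma>)"
      using h by (simp add: growth_def powr_divide)
    finally have "h powr (real p powr \<sigma>) * k ^ p / M_seq \<tau> \<sigma> p \<le> A / k"
      using h k M_seq_pos[of \<tau> \<sigma> p] by (simp add: field_simps)
    moreover have "h powr (real p powr \<sigma>) * k ^ p / M_seq \<tau> \<sigma> p > 0"
      using h k M_seq_pos[of \<tau> \<sigma> p] by simp
    ultimately have "ln (h powr (real p powr \<sigma>) * k ^ p / M_seq \<tau> \<sigma> p) \<le> ln (A / k)" by (intro ln_mono) auto
    then show ?thesis by (auto simp: ln_plus_def)
  qed
  then show ?thesis by (intro bdd_aboveI2)
qed

lemma exp_assoc_fun_le:
  assumes "\<tau> > 0" "\<sigma> > 1" "h > 0" "k > 0"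
  shows "exp (- assoc_fun \<tau> \<sigma> h k) \<le> growth \<tau> \<sigma> (1 / h) N / k ^ N"
proof -
  let ?x = "h powr (real N powr \<sigma>) * k ^ N / M_seq \<tau> \<sigma> N"
  have x: "?x > 0" using assms M_seq_pos[of \<tau> \<sigma> N] by simp
  have "ln_plus ?x \<le> assoc_fun \<tau> \<sigma> h k"
    unfolding assoc_fun_def by (rule cSUP_upper[OF UNIV_I bdd_above_assoc_fun[OF assms]])
  then have "ln ?x \<le> assoc_fun \<tau> \<sigma> h k" by (simp add: ln_plus_def)
  then have "exp (- assoc_fun \<tau> \<sigma> h k) \<le> exp (- ln ?x)" by simp
  also have "\<dots> = growth \<tau> \<sigma> (1 / h) N / k ^ N"
    using x assms by (simp add: exp_minus growth_def powr_divide)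
  finally show ?thesis .
qed

section \<open>Cutoff functions\<close>

text \<open>\<open>flat n j\<close> is the \<open>n\<close>-th derivative of \<open>x \<mapsto> x\<^sup>-\<^sup>j exp (-1/x)\<close>, extended by \<open>0\<close>
  to \<open>x \<le> 0\<close>.\<close>

primrec flat :: "nat \<Rightarrow> nat \<Rightarrow> real \<Rightarrow> real" where
  "flat 0 j x = (if x > 0 then exp (- inverse x) * inverse x ^ j else 0)"
| "flat (Suc n) j x = flat n (j + 2) x - real j * flat n (j + 1) x"

lemma power_le_fact_exp: "0 \<le> y \<Longrightarrow> y ^ j \<le> fact j * exp (y :: real)"
proof -
  assume y: "0 \<le> y"
  have "(\<Sum>n\<in>{j}. y ^ n /\<^sub>R fact n) \<le> (\<Sum>n. y ^ n /\<^sub>R fact n)"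
    by (rule sum_le_suminf[OF summable_exp_generic]) (use y in auto)
  then show ?thesis by (simp add: exp_def field_simps)
qed

lemma abs_flat_0_le: "\<bar>flat 0 j x\<bar> \<le> fact j"
proof (cases "x > 0")
  case True
  then have "inverse x ^ j \<le> fact j * exp (inverse x)" by (intro power_le_fact_exp) auto
  then have "exp (- inverse x) * inverse x ^ j \<le> exp (- inverse x) * (fact j * exp (inverse x))"
    by (intro mult_left_mono) auto
  also have "\<dots> = fact j" by (simp add: exp_minus)
  finally show ?thesis using True by simp
qed simp

text \<open>One derivative raises the exponent j by at most 2 and brings down a factor j, so each of
  the two terms is covered by the next factorial. The result (2n)! at j = 0 is Gevrey growth of
  order 2.\<close>

lemma abs_flat_le: "\<bar>flat n j x\<bar> \<le> 2 ^ n * fact (j + 2 * n)"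
proof (induction n arbitrary: j)
  case 0
  show ?case using abs_flat_0_le[of j x] by simp
next
  case (Suc n)
  have "\<bar>flat (Suc n) j x\<bar> \<le> \<bar>flat n (j + 2) x\<bar> + real j * \<bar>flat n (j + 1) x\<bar>"
    by (simp add: order_trans[OF abs_triangle_ineq4] abs_mult)
  also have "\<dots> \<le> 2 ^ n * fact (j + 2 + 2 * n) + real j * (2 ^ n * fact (j + 1 + 2 * n))"
    by (intro add_mono mult_left_mono Suc.IH) auto
  also have "\<dots> = 2 ^ n * (fact (j + 2 + 2 * n) + real j * fact (j + 1 + 2 * n))"
    by (simp add: algebra_simps)
  also have "real j * fact (j + 1 + 2 * n) \<le> real (j + 2 + 2 * n) * fact (j + 1 + 2 * n)"
    by (intro mult_right_mono) auto
  also have "\<dots> = fact (j + 2 + 2 * n)" by (simp add: algebra_simps)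
  also have "2 ^ n * (fact (j + 2 + 2 * n) + fact (j + 2 + 2 * n)) = (2 ^ Suc n * fact (j + 2 * Suc n) :: real)"
  proof -
    have "2 ^ n * (z + z) = 2 ^ Suc n * z" for z :: real by simp
    moreover have "j + 2 + 2 * n = j + 2 * Suc n" by simp
    ultimately show ?thesis by metis
  qed
  finally show ?case by simp
qed

lemma flat_0_has_derivative: "(flat 0 j has_real_derivative flat (Suc 0) j x) (at x)"
proof -
  consider "x > 0" | "x < 0" | "x = 0" by linarith
  then show ?thesis
  proof cases
    case 1
    have inv: "((\<lambda>x. inverse x) has_real_derivative - (inverse x ^ 2)) (at x)"
      using DERIV_inverse[of x UNIV] 1 by (simp add: numeral_2_eq_2)
    have "((\<lambda>x. exp (- inverse x)) has_real_derivative exp (- inverse x) * - (- (inverse x ^ 2))) (at x)"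
      by (rule DERIV_chain2[OF DERIV_exp DERIV_minus[OF inv]])
    from DERIV_mult'[OF this DERIV_power[OF inv, of j]]
    have "((\<lambda>x. exp (- inverse x) * inverse x ^ j) has_real_derivative flat (Suc 0) j x) (at x)"
      by (rule DERIV_cong) (use 1 in \<open>cases j; simp add: algebra_simps power2_eq_square\<close>)
    then show ?thesis
      by (rule has_field_derivative_transform_within_open[where S = "{0<..}"]) (use 1 in auto)
  next
    case 2
    have "((\<lambda>x. 0) has_real_derivative flat (Suc 0) j x) (at x)" using 2 by simp
    then show ?thesis
      by (rule has_field_derivative_transform_within_open[where S = "{..<0}"]) (use 2 in auto)
  next
    case 3
    have "((\<lambda>h. (flat 0 j (0 + h) - flat 0 j 0) / h) \<longlongrightarrow> 0) (at 0)"
    proof (rule Lim_null_comparison)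
      \<comment> \<open>For \<open>h > 0\<close> the difference quotient equals
        \<open>h * flat 0 (j + 2) h\<close>, whose second factor is bounded; for negative h it is
        0.\<close>
      have "norm ((flat 0 j (0 + h) - flat 0 j 0) / h) \<le> \<bar>h\<bar> * fact (j + 2)" for h
      proof (cases "h > 0")
        case True
        then have "(flat 0 j (0 + h) - flat 0 j 0) / h = h * flat 0 (j + 2) h"
          by (simp add: field_simps power2_eq_square)
        then show ?thesis
          using abs_flat_0_le[of "j + 2" h] by (simp add: abs_mult mult_left_mono del: flat.simps)
      next
        case False
        then show ?thesis using mult_nonpos_nonneg[of h "fact (j + 2)"] by simp
      qed
      then show "\<forall>\<^sub>F h in at 0. norm ((flat 0 j (0 + h) - flat 0 j 0) / h) \<le> \<bar>h\<bar> * fact (j + 2)"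
        by (intro always_eventually allI)
      have "((\<lambda>h::real. \<bar>h\<bar> * fact (j + 2)) \<longlongrightarrow> \<bar>0\<bar> * fact (j + 2)) (at 0)"
        by (intro tendsto_intros)
      then show "((\<lambda>h::real. \<bar>h\<bar> * fact (j + 2)) \<longlongrightarrow> 0) (at 0)" by simp
    qed
    then show ?thesis using 3 by (simp add: DERIV_def)
  qed
qed

lemma flat_has_derivative: "(flat n j has_real_derivative flat (Suc n) j x) (at x)"
proof (induction n arbitrary: j)
  case 0
  show ?case by (rule flat_0_has_derivative)
next
  case (Suc n)
  have "((\<lambda>x. flat n (j + 2) x - real j * flat n (j + 1) x) has_real_derivative
      flat (Suc n) (j + 2) x - real j * flat (Suc n) (j + 1) x) (at x)"
    by (intro DERIV_diff DERIV_cmult Suc.IH)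
  then show ?case by (simp only: flat.simps(2)[abs_def])
qed

text \<open>The n-th derivative of the product \<open>X 0 * Y 0\<close> when \<open>X k\<close> and
  \<open>Y k\<close> are the k-th derivatives of the factors. Shifting one sequence at each step
  replaces binomial coefficients.\<close>

primrec leibniz :: "nat \<Rightarrow> (nat \<Rightarrow> real \<Rightarrow> real) \<Rightarrow> (nat \<Rightarrow> real \<Rightarrow> real) \<Rightarrow> real \<Rightarrow> real" where
  "leibniz 0 X Y x = X 0 x * Y 0 x"
| "leibniz (Suc n) X Y x = leibniz n (\<lambda>k. X (Suc k)) Y x + leibniz n X (\<lambda>k. Y (Suc k)) x"

lemma leibniz_has_derivative:
  assumes "\<And>k x. (X k has_real_derivative X (Suc k) x) (at x)"
    and "\<And>k x. (Y k has_real_derivative Y (Suc k) x) (at x)"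
  shows "(leibniz n X Y has_real_derivative leibniz (Suc n) X Y x) (at x)"
  using assms
proof (induction n arbitrary: X Y)
  case 0
  have "((\<lambda>x. X 0 x * Y 0 x) has_real_derivative X 0 x * Y (Suc 0) x + X (Suc 0) x * Y 0 x) (at x)"
    by (rule DERIV_mult'[OF 0])
  then show ?case by (simp add: leibniz.simps(1)[abs_def] add.commute)
next
  case (Suc n)
  have "((\<lambda>x. leibniz n (\<lambda>k. X (Suc k)) Y x + leibniz n X (\<lambda>k. Y (Suc k)) x) has_real_derivative
      leibniz (Suc n) (\<lambda>k. X (Suc k)) Y x + leibniz (Suc n) X (\<lambda>k. Y (Suc k)) x) (at x)"
    by (intro DERIV_add Suc.IH Suc.prems)
  then show ?case by (simp only: leibniz.simps(2)[abs_def])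
qed

text \<open>The offsets \<open>a\<close> and \<open>b\<close> carry the induction: each step shifts
  one of the sequences by 1, and monotonicity of \<open>A\<close> compares the two outcomes.\<close>

lemma abs_leibniz_le:
  fixes A :: "nat \<Rightarrow> real"
  assumes "mono A" "\<And>k. A k \<ge> 0"
    and "\<And>k. \<bar>X k x\<bar> \<le> A (k + a)" "\<And>k. \<bar>Y k x\<bar> \<le> A (k + b)"
  shows "\<bar>leibniz n X Y x\<bar> \<le> 2 ^ n * (A (n + a) * A (n + b))"
  using assms(3,4)
proof (induction n arbitrary: X Y a b)
  case 0
  have "\<bar>X 0 x\<bar> * \<bar>Y 0 x\<bar> \<le> A (0 + a) * A (0 + b)"
    by (intro mult_mono 0 assms(2)) auto
  then show ?case by (simp add: abs_mult)
next
  case (Suc n)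
  have 1: "\<bar>leibniz n (\<lambda>k. X (Suc k)) Y x\<bar> \<le> 2 ^ n * (A (n + Suc a) * A (n + b))"
  proof (rule Suc.IH)
    show "\<bar>X (Suc k) x\<bar> \<le> A (k + Suc a)" for k using Suc.prems(1)[of "Suc k"] by simp
  qed (rule Suc.prems)
  have 2: "\<bar>leibniz n X (\<lambda>k. Y (Suc k)) x\<bar> \<le> 2 ^ n * (A (n + a) * A (n + Suc b))"
  proof (rule Suc.IH)
    show "\<bar>Y (Suc k) x\<bar> \<le> A (k + Suc b)" for k using Suc.prems(2)[of "Suc k"] by simp
  qed (rule Suc.prems)
  have "A (n + b) \<le> A (Suc n + b)" "A (n + a) \<le> A (Suc n + a)" using assms(1) by (auto intro: monoD)
  then have 3: "A (n + Suc a) * A (n + b) \<le> A (Suc n + a) * A (Suc n + b)"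
    "A (n + a) * A (n + Suc b) \<le> A (Suc n + a) * A (Suc n + b)"
    using assms(2) by (auto intro!: mult_mono)
  have "\<bar>leibniz (Suc n) X Y x\<bar> \<le> 2 ^ n * (A (n + Suc a) * A (n + b)) + 2 ^ n * (A (n + a) * A (n + Suc b))"
    using 1 2 by simp
  also have "\<dots> \<le> 2 ^ n * (A (Suc n + a) * A (Suc n + b)) + 2 ^ n * (A (Suc n + a) * A (Suc n + b))"
    by (intro add_mono mult_left_mono 3) auto
  also have "\<dots> = 2 ^ Suc n * (A (Suc n + a) * A (Suc n + b))" by simp
  finally show ?case .
qed

text \<open>The bound of Gevrey type. The shift \<open>n + 1\<close> keeps the base at least 1 and
  the exponent positive at n = 0, so that constants, products and index changes can be absorbed by
  enlarging \<open>C\<close> and \<open>s\<close>.\<close>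

definition tower :: "real \<Rightarrow> nat \<Rightarrow> nat \<Rightarrow> real" where
  "tower C s n = (C * real (n + 1)) ^ (s * (n + 1))"

lemma tower_mono:
  assumes "1 \<le> C" "C \<le> C'" "s \<le> s'" "n \<le> n'"
  shows "tower C s n \<le> tower C' s' n'"
proof -
  have "1 * 1 \<le> C' * real (n' + 1)" using assms by (intro mult_mono) auto
  moreover have "C * real (n + 1) \<le> C' * real (n' + 1)" using assms by (intro mult_mono) auto
  moreover have "0 \<le> C * real (n + 1)" using assms by simp
  moreover have "s * (n + 1) \<le> s' * (n' + 1)" using assms by (intro mult_le_mono) auto
  ultimately have "(C * real (n + 1)) ^ (s * (n + 1)) \<le> (C' * real (n' + 1)) ^ (s * (n + 1))"
    "(C' * real (n' + 1)) ^ (s * (n + 1)) \<le> (C' * real (n' + 1)) ^ (s' * (n' + 1))"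
    by (intro power_mono power_increasing; simp)+
  then show ?thesis by (simp add: tower_def)
qed

lemma one_le_tower: "1 \<le> C \<Longrightarrow> 1 \<le> tower C s n"
  using mult_mono[of 1 C 1 "real (n + 1)"] by (simp add: tower_def one_le_power)

lemma power_tower_le:
  assumes "1 \<le> C" "1 \<le> c"
  shows "c ^ (n + 1) * (tower C s n * tower C s' n) \<le> tower (c * C) (s + s' + 1) n"
proof -
  let ?x = "C * real (n + 1)" and ?y = "c * C * real (n + 1)"
  have x: "1 \<le> ?x" using mult_mono[of 1 C 1 "real (n + 1)"] assms by simp
  have xy: "?x \<le> ?y" using assms x mult_right_mono[of 1 c ?x] by (simp add: mult_ac)
  have "c * 1 \<le> c * ?x" using assms x by (intro mult_left_mono) auto
  then have cy: "c \<le> ?y" by (simp add: mult_ac)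
  have "c ^ (n + 1) * (?x ^ (s * (n + 1)) * ?x ^ (s' * (n + 1))) \<le> ?y ^ (n + 1) * (?y ^ (s * (n + 1)) * ?y ^ (s' * (n + 1)))"
    using assms x xy cy by (intro mult_mono power_mono) auto
  also have "\<dots> = ?y ^ ((s + s' + 1) * (n + 1))"
    by (simp only: power_add[symmetric]) (simp add: algebra_simps)
  finally show ?thesis unfolding tower_def .
qed

text \<open>A normalised primitive of the bump exp (-1/x) exp (-1/(1-x)) on the unit interval:
  constant on either side, with derivatives equal to those of the bump, one order lower, divided by
  the total mass.\<close>

lemma smooth_step:
  obtains S :: "nat \<Rightarrow> real \<Rightarrow> real" and C :: real and s :: nat
  where "\<And>n x. (S n has_real_derivative S (Suc n) x) (at x)"
    and "\<And>x. x \<le> 0 \<Longrightarrow> S 0 x = 0" and "\<And>x. x \<ge> 1 \<Longrightarrow> S 0 x = 1"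
    and "1 \<le> C" and "\<And>n x. \<bar>S n x\<bar> \<le> tower C s n"
proof -
  define X where "X k = flat k 0" for k
  define Y where "Y k x = (-1) ^ k * flat k 0 (1 - x)" for k x
  define b where "b n = leibniz n X Y" for n
  have X: "(X k has_real_derivative X (Suc k) x) (at x)" for k x
    unfolding X_def by (rule flat_has_derivative)
  have Y: "(Y k has_real_derivative Y (Suc k) x) (at x)" for k x
  proof -
    have "((\<lambda>x. flat k 0 (1 - x)) has_real_derivative flat (Suc k) 0 (1 - x) * (-1)) (at x)"
      by (rule DERIV_chain2[OF flat_has_derivative]) (auto intro!: derivative_eq_intros)
    from DERIV_cmult[OF this, of "(-1) ^ k"] show ?thesis
      by (simp add: Y_def[abs_def] del: flat.simps)
  qed
  have b: "(b n has_real_derivative b (Suc n) x) (at x)" for n x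
    unfolding b_def by (rule leibniz_has_derivative) (rule X Y)+
  have b0: "b 0 x = flat 0 0 x * flat 0 0 (1 - x)" for x
    by (simp add: b_def X_def Y_def)
  define A where "A k = (2 ^ k * fact (2 * k) :: real)" for k
  have "mono A" unfolding A_def mono_def by (auto intro!: mult_mono power_increasing fact_mono)
  moreover have "A k \<ge> 0" for k by (simp add: A_def)
  moreover have "\<bar>X k x\<bar> \<le> A (k + 0)" "\<bar>Y k x\<bar> \<le> A (k + 0)" for k x
    using abs_flat_le[of k 0] by (simp_all add: X_def Y_def A_def abs_mult power_abs)
  ultimately have b_le: "\<bar>b n x\<bar> \<le> 2 ^ n * (A n * A n)" for n x
    unfolding b_def using abs_leibniz_le[of A X x 0 Y 0 n] by simp
  \<comment> \<open>Any primitive of the continuous bump will do; its free constant is removed by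
    subtracting \<open>F 0\<close> in the definition of \<open>S\<close>.\<close>
  have "\<exists>F. \<forall>x::real. - \<infinity> < ereal x \<longrightarrow> ereal x < \<infinity> \<longrightarrow> (F has_vector_derivative b 0 x) (at x)"
    by (rule einterval_antiderivative) (auto intro: DERIV_isCont[OF b])
  then obtain F where F: "\<And>x. (F has_real_derivative b 0 x) (at x)"
    by (auto simp: has_real_derivative_iff_has_vector_derivative)
  have contF: "continuous_on T F" for T
    using F by (meson DERIV_isCont continuous_at_imp_continuous_on)
  have Fz: "(F has_real_derivative 0) (at x)" if "x < 0 \<or> 1 < x" for x
    using F[of x] that by (auto simp: b0)
  have low: "F x = F 0" if "x \<le> 0" for x
  proof (cases "x < 0")
    case True
    have "F 0 = F x"
      by (rule DERIV_isconst2[where a = x and b = 0]) (use True Fz contF in auto)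
    then show ?thesis by simp
  qed (use that in simp)
  have high: "F x = F 1" if "x \<ge> 1" for x
  proof (cases "x > 1")
    case True
    show ?thesis
      by (rule DERIV_isconst2[where a = 1 and b = x]) (use True Fz contF in auto)
  qed (use that in simp)
  have b_nonneg: "b 0 x \<ge> 0" for x by (simp add: b0)
  have monoF: "F x \<le> F y" if "x \<le> y" for x y
    by (rule DERIV_nonneg_imp_nondecreasing[OF that]) (use F b_nonneg in blast)
  have pos: "F 0 < F 1"
    by (rule DERIV_pos_imp_increasing_open) (use F contF in \<open>auto simp: b0 intro!: exI\<close>)
  define \<delta> where "\<delta> = F 1 - F 0"
  have \<delta>: "\<delta> > 0" using pos by (simp add: \<delta>_def)
  define S where "S n x = (case n of 0 \<Rightarrow> (F x - F 0) / \<delta> | Suc m \<Rightarrow> b m x / \<delta>)" for n x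
  \<comment> \<open>16 is 8 times 2: the 8 collects \<open>2 ^ m\<close> from the Leibniz bound and
    from each factor \<open>A m\<close>, and the 2 is the base constant in
    \<open>fact (2 * m) \<le> tower 2 2 m\<close>. The maximum with 1 keeps all constants at least
    1, as \<open>power_tower_le\<close> requires.\<close>
  define C where "C = 16 * max 1 (1 / \<delta>)"
  show ?thesis
  proof
    show "(S n has_real_derivative S (Suc n) x) (at x)" for n x
    proof (cases n)
      case 0
      have "((\<lambda>x. (F x - F 0) / \<delta>) has_real_derivative (b 0 x - 0) / \<delta>) (at x)"
        by (intro DERIV_cdivide DERIV_diff F DERIV_const)
      then show ?thesis by (simp add: 0 S_def[abs_def])
    next
      case (Suc m)
      have "((\<lambda>x. b m x / \<delta>) has_real_derivative b (Suc m) x / \<delta>) (at x)"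
        by (intro DERIV_cdivide b)
      then show ?thesis by (simp add: Suc S_def[abs_def])
    qed
    show "S 0 x = 0" if "x \<le> 0" for x using low[OF that] by (simp add: S_def)
    show "S 0 x = 1" if "x \<ge> 1" for x using high[OF that] \<delta> by (simp add: S_def \<delta>_def)
    show C: "1 \<le> C" by (simp add: C_def)
    show "\<bar>S n x\<bar> \<le> tower C 6 n" for n x
    proof (cases n)
      case 0
      have "F 0 \<le> F x" using low[of x] monoF[of 0 x] by (cases "x \<le> 0") auto
      moreover have "F x \<le> F 1" using high[of x] monoF[of x 1] by (cases "x \<ge> 1") auto
      ultimately have "\<bar>S n x\<bar> \<le> 1" using \<delta> by (simp add: 0 S_def \<delta>_def)
      then show ?thesis using one_le_tower[OF C, of 6 n] by linarith
    next
      case (Suc m)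
      have "fact (2 * m) \<le> (real (2 * m) ^ (2 * m))" using fact_le_power[of "2 * m"] by (simp only: of_nat_power)
      also have "\<dots> \<le> (2 * real (m + 1)) ^ (2 * m)" by (intro power_mono) auto
      also have "\<dots> \<le> (2 * real (m + 1)) ^ (2 * (m + 1))" by (intro power_increasing) auto
      also have "\<dots> = tower 2 2 m" by (simp add: tower_def)
      finally have fact: "fact (2 * m) \<le> tower 2 2 m" .
      have t: "tower 2 2 m \<ge> 1" by (rule one_le_tower) simp
      have "\<bar>S n x\<bar> = \<bar>b m x\<bar> * (1 / \<delta>)" using \<delta> by (simp add: Suc S_def)
      also have "\<dots> \<le> (2 ^ m * (A m * A m)) * max 1 (1 / \<delta>)"
        using \<delta> by (intro mult_mono b_le) (auto simp: A_def)
      also have "\<dots> = 8 ^ m * max 1 (1 / \<delta>) * (fact (2 * m) * fact (2 * m))"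
        by (simp add: A_def power_mult_distrib[symmetric])
      also have "\<dots> \<le> (8 * max 1 (1 / \<delta>)) ^ (m + 1) * (tower 2 2 m * tower 2 2 m)"
      proof (intro mult_mono fact)
        have "8 ^ m * max 1 (1 / \<delta>) \<le> 8 ^ (m + 1) * max 1 (1 / \<delta>) ^ (m + 1)"
          by (intro mult_mono power_increasing self_le_power) auto
        then show "8 ^ m * max 1 (1 / \<delta>) \<le> (8 * max 1 (1 / \<delta>)) ^ (m + 1)" by (simp only: power_mult_distrib)
      qed (use t in auto)
      also have "\<dots> \<le> tower ((8 * max 1 (1 / \<delta>)) * 2) (2 + 2 + 1) m"
        by (rule power_tower_le) (auto simp: max_def)
      also have "\<dots> \<le> tower C 6 n" by (rule tower_mono) (auto simp: C_def Suc max_def)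
      finally show ?thesis .
    qed
  qed
qed

section \<open>Cutoff functions of several variables\<close>

definition tame :: "(real^'n::finite \<Rightarrow> complex) \<Rightarrow> bool" where
  "tame g \<longleftrightarrow> smooth_fun g \<and> (\<exists>C\<ge>1. \<exists>s. \<forall>is x. norm (pd is g x) \<le> tower C s (length is))"

lemma tame_mult:
  assumes "tame f" "tame g"
  shows "tame (\<lambda>t. f t * g t)"
proof -
  from assms obtain C s C' s' where sm: "smooth_fun f" "smooth_fun g"
    and C: "1 \<le> C" "1 \<le> C'"
    and le: "\<And>is x. norm (pd is f x) \<le> tower C s (length is)" "\<And>is x. norm (pd is g x) \<le> tower C' s' (length is)"
    unfolding tame_def by blast
  let ?C = "max C C'"
  have "norm (pd is (\<lambda>t. f t * g t) x) \<le> tower (2 * ?C) (s + s' + 1) (length is)" for "is" x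
  proof -
    have "norm (pd is (\<lambda>t. f t * g t) x) \<le> 2 ^ length is * (tower ?C s (length is) * tower ?C s' (length is))"
    proof (rule norm_pd_mult_le[OF sm])
      fix a b :: "'a list" assume ab: "length a + length b = length is"
      have "norm (pd a f x) \<le> tower ?C s (length is)"
        by (rule order_trans[OF le(1) tower_mono]) (use C ab in auto)
      moreover have "norm (pd b g x) \<le> tower ?C s' (length is)"
        by (rule order_trans[OF le(2) tower_mono]) (use C ab in auto)
      ultimately show "norm (pd a f x) * norm (pd b g x) \<le> tower ?C s (length is) * tower ?C s' (length is)"
        by (intro mult_mono) (auto intro: order_trans[OF norm_ge_zero])
    qed
    also have "\<dots> \<le> 2 ^ (length is + 1) * (tower ?C s (length is) * tower ?C s' (length is))"
      using C by (intro mult_right_mono power_increasing mult_nonneg_nonneg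
          order_trans[OF zero_le_one one_le_tower]) auto
    also have "\<dots> \<le> tower (2 * ?C) (s + s' + 1) (length is)"
      by (rule power_tower_le) (use C in auto)
    finally show ?thesis .
  qed
  then show ?thesis
    unfolding tame_def using sm C
    by (intro conjI smooth_mult exI[of _ "2 * ?C"] exI[of _ "s + s' + 1"]) auto
qed

lemma tame_1: "tame (\<lambda>t. 1)"
proof -
  have "norm (pd is (\<lambda>t. 1) x) \<le> tower 1 1 (length is)" for "is" and x :: "real^'n"
  proof (cases "is" rule: rev_cases)
    case (snoc js i)
    have "partial_deriv i (\<lambda>t :: real^'n. 1) = (\<lambda>t. 0)" by (rule ext) (rule partial_deriv_const)
    then have "pd is (\<lambda>t. 1) x = 0" by (simp add: snoc pd_append pd_zero)
    then show ?thesis using one_le_tower[of 1 1 "length is"] by simp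
  qed (simp add: tower_def)
  then show ?thesis unfolding tame_def using smooth_const by (intro conjI exI[of _ 1]) auto
qed

lemma tame_prod: "finite I \<Longrightarrow> (\<And>i. i \<in> I \<Longrightarrow> tame (f i)) \<Longrightarrow> tame (\<lambda>t. \<Prod>i\<in>I. f i t)"
  by (induction I rule: finite_induct) (auto simp: tame_1 tame_mult)

text \<open>The family \<open>g k n\<close> is closed under partial derivatives: direction i
  multiplies k by c and advances n, any other direction sets k to 0. Smoothness and the bound on all
  mixed derivatives follow from this single rule.\<close>

lemma tame_coordinate:
  fixes S :: "nat \<Rightarrow> real \<Rightarrow> real"
  assumes S: "\<And>n x. (S n has_real_derivative S (Suc n) x) (at x)"
    and C: "1 \<le> C" and le: "\<And>n x. \<bar>S n x\<bar> \<le> tower C s n"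
  shows "tame (\<lambda>x :: real^'n::finite. complex_of_real (S 0 (b + c * x $ i)))"
proof -
  define g where "g k n = (\<lambda>x :: real^'n. complex_of_real (k * S n (b + c * x $ i)))" for k n
  have deriv: "(g k n has_derivative (\<lambda>h. complex_of_real (h $ i * (k * (c * S (Suc n) (b + c * x $ i)))))) (at x)" for k n x
  proof -
    have "((\<lambda>y. k * S n (b + c * y)) has_real_derivative k * (S (Suc n) (b + c * x $ i) * c)) (at (x $ i))"
      by (intro DERIV_cmult DERIV_chain2[OF S]) (auto intro!: derivative_eq_intros)
    then have "((\<lambda>y. k * S n (b + c * y)) has_derivative (*) (k * (S (Suc n) (b + c * x $ i) * c))) (at (x $ i))"
      by (rule has_field_derivative_imp_has_derivative)
    from has_derivative_of_real[OF has_derivative_compose[OF bounded_linear_imp_has_derivative[OF bounded_linear_vec_nth] this]]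
    show ?thesis by (simp add: g_def mult_ac)
  qed
  have pd1: "partial_deriv j (g k n) = g (if j = i then k * c else 0) (Suc n)" for j k n
    using partial_deriv_eq[OF deriv] by (auto simp: fun_eq_iff g_def axis_def)
  have smooth: "smooth_fun (g k n)" for k n
  proof (rule smooth_fun_coinduct[where P = "\<lambda>f. \<exists>k n. f = g k n"])
    show "f differentiable at x" if "\<exists>k n. f = g k n" for f x
      using that deriv by (auto simp: differentiable_def)
    show "\<exists>k n. partial_deriv j f = g k n" if "\<exists>k n. f = g k n" for f j
      using that pd1 by blast
  qed blast
  have "\<exists>k. \<bar>k\<bar> \<le> max 1 \<bar>c\<bar> ^ length is \<and> pd is (g 1 0) = g k (length is)" for "is"
  proof (induction "is")
    case Nil
    show ?case by (rule exI[of _ 1]) simp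
  next
    case (Cons j "is")
    then obtain k where k: "\<bar>k\<bar> \<le> max 1 \<bar>c\<bar> ^ length is" "pd is (g 1 0) = g k (length is)" by blast
    have "\<bar>k\<bar> * \<bar>c\<bar> \<le> max 1 \<bar>c\<bar> ^ length is * max 1 \<bar>c\<bar>" using k(1) by (intro mult_mono) auto
    then show ?case
      using k(2) by (intro exI[of _ "if j = i then k * c else 0"]) (auto simp: pd1 abs_mult mult_ac)
  qed
  then have "norm (pd is (g 1 0) x) \<le> tower (max 1 \<bar>c\<bar> * C) (s + 0 + 1) (length is)" for "is" x
  proof -
    obtain k where k: "\<bar>k\<bar> \<le> max 1 \<bar>c\<bar> ^ length is" "pd is (g 1 0) = g k (length is)"
      using \<open>\<And>is. \<exists>k. \<bar>k\<bar> \<le> max 1 \<bar>c\<bar> ^ length is \<and> pd is (g 1 0) = g k (length is)\<close> by blast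
    have "norm (pd is (g 1 0) x) = \<bar>k\<bar> * \<bar>S (length is) (b + c * x $ i)\<bar>"
      by (subst k(2)) (simp add: g_def norm_mult)
    also have "\<dots> \<le> max 1 \<bar>c\<bar> ^ (length is + 1) * (tower C s (length is) * tower C 0 (length is))"
    proof (intro mult_mono)
      show "\<bar>k\<bar> \<le> max 1 \<bar>c\<bar> ^ (length is + 1)"
        by (rule order_trans[OF k(1)]) (intro power_increasing, auto)
      show "\<bar>S (length is) (b + c * x $ i)\<bar> \<le> tower C s (length is) * tower C 0 (length is)"
        using le by (simp add: tower_def)
    qed auto
    also have "\<dots> \<le> tower (max 1 \<bar>c\<bar> * C) (s + 0 + 1) (length is)"
      by (rule power_tower_le) (use C in auto)
    finally show ?thesis .
  qed
  moreover have "1 * 1 \<le> max 1 \<bar>c\<bar> * C" using C by (intro mult_mono) auto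
  ultimately have "tame (g 1 0)" unfolding tame_def using smooth by auto
  then show ?thesis by (simp add: g_def)
qed

lemma tame_cutoff:
  assumes "r > 0"
  obtains \<Phi> :: "real^'n::finite \<Rightarrow> complex"
  where "tame \<Phi>" "\<And>x. (\<And>i. \<bar>x $ i\<bar> \<le> r) \<Longrightarrow> \<Phi> x = 1" "\<And>x i. \<bar>x $ i\<bar> \<ge> 2 * r \<Longrightarrow> \<Phi> x = 0"
    "\<And>x. cnj (\<Phi> x) = \<Phi> x"
proof -
  obtain S :: "nat \<Rightarrow> real \<Rightarrow> real" and C s where S: "\<And>n x. (S n has_real_derivative S (Suc n) x) (at x)"
    and S01: "\<And>x. x \<le> 0 \<Longrightarrow> S 0 x = 0" "\<And>x. x \<ge> 1 \<Longrightarrow> S 0 x = 1"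
    and C: "1 \<le> C" "\<And>n x. \<bar>S n x\<bar> \<le> tower C s n"
    using smooth_step by metis
  \<comment> \<open>Both arguments 2 + x_i/r and 2 - x_i/r are at least 1 when |x_i| is at most r,
    and one of them is at most 0 when |x_i| is at least 2r.\<close>
  define \<Phi> where "\<Phi> x = (\<Prod>i\<in>UNIV. complex_of_real (S 0 (2 + (1 / r) * x $ i)) * complex_of_real (S 0 (2 + (- 1 / r) * x $ i)))"
    for x :: "real^'n"
  show ?thesis
  proof
    show "tame \<Phi>"
      unfolding \<Phi>_def by (intro tame_prod tame_mult tame_coordinate[OF S C]) simp
    show "\<Phi> x = 1" if "\<And>i. \<bar>x $ i\<bar> \<le> r" for x
    proof -
      have "S 0 (2 + (1 / r) * x $ i) = 1" "S 0 (2 + (- 1 / r) * x $ i) = 1" for i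
        using that[of i] assms by (auto intro!: S01 simp: field_simps abs_le_iff)
      then show ?thesis by (simp add: \<Phi>_def)
    qed
    show "\<Phi> x = 0" if "\<bar>x $ i\<bar> \<ge> 2 * r" for x i
    proof -
      have "S 0 (2 + (1 / r) * x $ i) = 0 \<or> S 0 (2 + (- 1 / r) * x $ i) = 0"
      proof (cases "x $ i \<ge> 0")
        case True
        then show ?thesis using that assms by (intro disjI2 S01) (simp add: field_simps)
      next
        case False
        then show ?thesis using that assms by (intro disjI1 S01) (simp add: field_simps)
      qed
      then show ?thesis unfolding \<Phi>_def by (subst prod_zero_iff) auto
    qed
    show "cnj (\<Phi> x) = \<Phi> x" for x by (simp add: \<Phi>_def cnj_prod)
  qed
qed

text \<open>Towers lie below \<open>growth \<tau> \<sigma> h\<close> for every h > 0, so one cutoff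
  of Gevrey type serves all \<tau> > 0 and \<sigma> > 1, in the Beurling and the Roumieu
  case.\<close>

lemma tame_imp_D_Beurling:
  assumes "tame g" "supp g \<subseteq> K" "\<tau> > 0" "\<sigma> > 1"
  shows "g \<in> D_Beurling \<tau> \<sigma> K"
  unfolding D_Beurling_def
proof (intro INT_I)
  fix h :: real assume "h \<in> {0<..}"
  then have h: "h > 0" by simp
  from assms(1) obtain C s where g: "smooth_fun g" and C: "C \<ge> 1"
    and le: "\<And>is x. norm (pd is g x) \<le> tower C s (length is)"
    unfolding tame_def by blast
  obtain A where A: "\<And>N. tower C s N \<le> A * growth \<tau> \<sigma> h N"
    using power_tower_le_growth[OF assms(3,4) h, of C s] C by (auto simp: tower_def)
  have "norm (multi_deriv \<alpha> g x) / (h powr (real (multi_abs \<alpha>) powr \<sigma>) * M_seq \<tau> \<sigma> (multi_abs \<alpha>)) \<le> A" for \<alpha> x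
    using order_trans[OF le A, of "expand_index \<alpha>" x] growth_pos[OF h, of \<tau> \<sigma> "multi_abs \<alpha>"]
    by (simp add: multi_deriv_eq_pd length_expand_index growth_def pos_divide_le_eq)
  then show "g \<in> D_h \<tau> \<sigma> h K"
    unfolding D_h_def using g assms(2) by (auto intro!: bdd_aboveI[of _ A])
qed

lemma D_Beurling_subset_Roumieu: "D_Beurling \<tau> \<sigma> K \<subseteq> D_Roumieu \<tau> \<sigma> K"
  unfolding D_Beurling_def D_Roumieu_def by (auto intro!: exI[of _ 1])

section \<open>Proof of the equivalence\<close>

lemma conic_nhd_norm_pos: "conic_nhd \<Gamma> \<xi>0 \<Longrightarrow> \<xi> \<in> \<Gamma> \<Longrightarrow> norm \<xi> > 0"
  unfolding conic_nhd_def by auto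

text \<open>The smaller cone is generated by a ball of half the radius. By homogeneity the
  perturbation is scaled back to that ball, where it moves a point by at most the other
  half.\<close>

lemma conic_nhd_shrink:
  fixes \<xi>0 :: "real^'n::finite"
  assumes \<Gamma>: "conic_nhd \<Gamma> \<xi>0"
  obtains \<Gamma>' c where "conic_nhd \<Gamma>' \<xi>0" "0 < c" "c < 1"
    "\<And>\<xi> \<eta>. \<xi> \<in> \<Gamma>' \<Longrightarrow> norm (\<eta> - \<xi>) \<le> c * norm \<xi> \<Longrightarrow> \<eta> \<in> \<Gamma>"
proof -
  obtain e where e: "e > 0" "ball \<xi>0 e \<subseteq> \<Gamma>"
    using \<Gamma> by (auto simp: conic_nhd_def mem_interior)
  have cone: "s *\<^sub>R \<xi> \<in> \<Gamma>" if "\<xi> \<in> \<Gamma>" "s > 0" for s \<xi>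
    using \<Gamma> that by (auto simp: conic_nhd_def)
  have "0 \<notin> \<Gamma>" using \<Gamma> by (simp add: conic_nhd_def)
  then have "0 \<notin> ball \<xi>0 e" using e(2) by blast
  then have e\<xi>: "e \<le> norm \<xi>0" by simp
  define \<Gamma>' where "\<Gamma>' = {s *\<^sub>R \<zeta> | s \<zeta>. s > 0 \<and> \<zeta> \<in> ball \<xi>0 (e / 2)}"
  \<comment> \<open>Since 0 is not in \<Gamma>, the radius e is at most |\<xi>0|, which makes c < 1.
    Generators have norm at most 2|\<xi>0|, so a relative error c is an absolute error of at most
    e/2.\<close>
  define c where "c = e / (4 * norm \<xi>0)"
  have n0: "norm \<xi>0 > 0" using e(1) e\<xi> by linarith
  show ?thesis
  proof
    show "0 < c" "c < 1" using e(1) e\<xi> n0 by (auto simp: c_def)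
    have "0 \<notin> \<Gamma>'"
    proof
      assume "0 \<in> \<Gamma>'"
      then have "0 \<in> ball \<xi>0 (e / 2)" by (auto simp: \<Gamma>'_def)
      then show False using e\<xi> e(1) by simp
    qed
    moreover have "s *\<^sub>R \<xi> \<in> \<Gamma>'" if "\<xi> \<in> \<Gamma>'" "s > 0" for s \<xi>
    proof -
      from that(1) obtain t \<zeta> where t: "\<xi> = t *\<^sub>R \<zeta>" "t > 0" "\<zeta> \<in> ball \<xi>0 (e / 2)"
        unfolding \<Gamma>'_def by blast
      have "s *\<^sub>R \<xi> = (s * t) *\<^sub>R \<zeta>" "s * t > 0" using t that(2) by auto
      then show ?thesis using t(3) unfolding \<Gamma>'_def by blast
    qed
    moreover have "\<xi>0 \<in> interior \<Gamma>'"
    proof -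
      have "ball \<xi>0 (e / 2) \<subseteq> \<Gamma>'"
      proof
        fix \<zeta> assume "\<zeta> \<in> ball \<xi>0 (e / 2)"
        then show "\<zeta> \<in> \<Gamma>'" unfolding \<Gamma>'_def by (auto intro!: exI[of _ 1] exI[of _ \<zeta>])
      qed
      then show ?thesis using e(1) unfolding mem_interior by (intro exI[of _ "e / 2"]) auto
    qed
    ultimately show "conic_nhd \<Gamma>' \<xi>0" by (auto simp: conic_nhd_def)
    show "\<eta> \<in> \<Gamma>" if "\<xi> \<in> \<Gamma>'" "norm (\<eta> - \<xi>) \<le> c * norm \<xi>" for \<xi> \<eta>
    proof -
      from that(1) obtain s \<zeta> where s: "\<xi> = s *\<^sub>R \<zeta>" "s > 0" and \<zeta>: "dist \<xi>0 \<zeta> < e / 2"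
        unfolding \<Gamma>'_def by auto
      define \<omega> where "\<omega> = (1 / s) *\<^sub>R \<eta>"
      have \<eta>: "\<eta> = s *\<^sub>R \<omega>" using s(2) by (simp add: \<omega>_def)
      have "norm (s *\<^sub>R (\<omega> - \<zeta>)) \<le> c * norm (s *\<^sub>R \<zeta>)" using that(2) by (simp add: \<eta> s(1) scaleR_diff_right)
      then have "s * norm (\<omega> - \<zeta>) \<le> s * (c * norm \<zeta>)" using s(2) by (simp add: mult_ac)
      then have "norm (\<omega> - \<zeta>) \<le> c * norm \<zeta>" using s(2) by simp
      also have "norm \<zeta> \<le> norm \<xi>0 + norm (\<zeta> - \<xi>0)" by (rule norm_triangle_sub)
      also have "\<dots> \<le> 2 * norm \<xi>0" using \<zeta> e\<xi> e(1) by (simp add: dist_norm norm_minus_commute)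
      finally have "norm (\<omega> - \<zeta>) \<le> c * (2 * norm \<xi>0)" using \<open>0 < c\<close> by (simp add: mult_left_mono)
      also have "\<dots> = e / 2" using n0 by (simp add: c_def)
      finally have "dist \<xi>0 \<omega> < e"
        using \<zeta> dist_triangle[of \<xi>0 \<omega> \<zeta>] by (simp add: dist_norm norm_minus_commute)
      then have "\<omega> \<in> \<Gamma>" using e(2) by auto
      then show ?thesis unfolding \<eta> using cone s(2) by blast
    qed
  qed
qed

lemma compact_subset_cube:
  fixes K :: "(real^'n::finite) set"
  assumes "compact K"
  obtains r where "r > 0" "K \<subseteq> cube r"
proof -
  obtain r where r: "r > 0" "\<And>x. x \<in> K \<Longrightarrow> norm x \<le> r"
    using compact_imp_bounded[OF assms] by (auto simp: bounded_pos)
  have "x \<in> cube r" if "x \<in> K" for x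
    using component_le_norm_cart[of x] r(2)[OF that] by (auto simp: mem_cube intro: order_trans)
  then show ?thesis using that r(1) by blast
qed

text \<open>The order of quantifiers is the point. Cone, radius and \<open>H\<close> are chosen
  before h, A and B, and \<open>A'\<close> is common to all \<psi> of the given size, which makes it
  uniform over translated windows. One parameter h serves for \<phi> u and for \<psi>, so that both
  the Roumieu and the Beurling case can be derived; \<open>H h = exp 1 * h\<close> for
  \<open>h \<le> 1\<close> is there for the latter.\<close>

lemma microlocal_estimate:
  fixes u :: "(real^'n::finite \<Rightarrow> complex) \<Rightarrow> complex"
  assumes u: "distribution u" and \<tau>: "\<tau> > 0" and \<sigma>: "\<sigma> > 1" and \<Gamma>: "conic_nhd \<Gamma> \<xi>0"
    and \<phi>: "smooth_fun \<phi>" "supp \<phi> \<subseteq> K" "compact K" and one: "\<forall>\<^sub>F x in nhds x0. \<phi> x = 1"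
  obtains \<Gamma>' \<rho> H where "conic_nhd \<Gamma>' \<xi>0" "\<rho> > 0" "\<And>h. h > 0 \<Longrightarrow> H h > (0::real)"
    "\<And>h. 0 < h \<Longrightarrow> h \<le> 1 \<Longrightarrow> H h = exp 1 * h"
    "\<And>h A B. h > 0 \<Longrightarrow> A > 0 \<Longrightarrow> B > 0 \<Longrightarrow>
      (\<And>N \<xi>. \<xi> \<in> \<Gamma> \<Longrightarrow> norm (fourier (mult_dist \<phi> u) \<xi>) \<le> A * (growth \<tau> \<sigma> h N / norm \<xi> ^ N)) \<Longrightarrow>
      \<exists>A'>0. \<forall>\<psi>. smooth_fun \<psi> \<longrightarrow> supp \<psi> \<subseteq> cball x0 \<rho> \<longrightarrow>
        (\<forall>N i t. norm (pd (replicate N i) \<psi> t) \<le> B * growth \<tau> \<sigma> h N) \<longrightarrow>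
        (\<forall>N. \<forall>\<xi>\<in>\<Gamma>'. norm (fourier (mult_dist \<psi> u) \<xi>) \<le> A' * (growth \<tau> \<sigma> (H h) N / norm \<xi> ^ N))"
proof -
  obtain \<Gamma>' c where \<Gamma>': "conic_nhd \<Gamma>' \<xi>0" and c: "0 < c" "c < 1"
    and cone: "\<And>\<xi> \<eta>. \<xi> \<in> \<Gamma>' \<Longrightarrow> norm (\<eta> - \<xi>) \<le> c * norm \<xi> \<Longrightarrow> \<eta> \<in> \<Gamma>"
    using conic_nhd_shrink[OF \<Gamma>] by metis
  obtain e where e: "e > 0" "\<And>x. dist x x0 < e \<Longrightarrow> \<phi> x = 1"
    using one unfolding eventually_nhds_metric by blast
  obtain r where r: "r > 0" "K \<subseteq> cube r" using compact_subset_cube[OF \<phi>(3)] by blast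
  obtain C m where C: "C \<ge> 0" and Cm: "\<And>\<eta>. norm (u (\<lambda>t. \<phi> t * wave \<eta> t)) \<le> C * (1 + norm \<eta>) ^ m"
    using fourier_localised_growth[OF u \<phi>] by blast
  define d where "d = CARD('n)"
  \<comment> \<open>m powers pay for the growth of the transform of \<phi> u, and 2d powers for the
    summability over the lattice.\<close>
  define q where "q = m + 2 * d"
  define a where "a = r + 1"
  define b where "b = max (2 * a) (1 + 1 / c)"
  define H where "H h = exp 1 * max h (h powr (real (q + 1) powr \<sigma>))" for h :: real
  have b: "b \<ge> 0" using r(1) by (simp add: b_def a_def le_max_iff_disj)
  have hH: "exp 1 * max h (h powr (real (0 + 1) powr \<sigma>)) \<le> H h" if "h > 0" for h
    using that by (simp add: H_def)
  show ?thesis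
  proof
    show "conic_nhd \<Gamma>' \<xi>0" by fact
    \<comment> \<open>Half the radius on which \<phi> = 1: a closed ball of this size stays inside
      the open ball.\<close>
    show "e / 2 > 0" using e(1) by simp
    show H0: "H h > 0" if "h > 0" for h using that by (simp add: H_def less_max_iff_disj)
    \<comment> \<open>For \<open>h \<le> 1\<close> raising h to an exponent of at least 1 does not
      increase it, so the maximum in \<open>H\<close> is h.\<close>
    show "H h = exp 1 * h" if "0 < h" "h \<le> 1" for h
    proof -
      have "1 \<le> real (q + 1) powr \<sigma>" using \<sigma> by (intro ge_one_powr_ge_zero) auto
      then have "h powr (real (q + 1) powr \<sigma>) \<le> h powr 1" using that by (intro powr_mono') auto
      then show ?thesis using that by (simp add: H_def)
    qed
    fix h A B :: real
    assume h: "h > 0" and A: "A > 0" and B: "B > 0"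
      and dec: "\<And>N \<xi>. \<xi> \<in> \<Gamma> \<Longrightarrow> norm (fourier (mult_dist \<phi> u) \<xi>) \<le> A * (growth \<tau> \<sigma> h N / norm \<xi> ^ N)"
    let ?g = "growth \<tau> \<sigma> h" and ?G = "growth \<tau> \<sigma> (H h)"
    \<comment> \<open>These terms have no index shift; shift 0 absorbs the N-th powers of the
      constants, at a parameter not exceeding \<open>H h\<close>.\<close>
    obtain A1 A2 where A12: "A1 > 0" "A2 > 0"
      and "\<And>N. (1 / (1 - c)) ^ N * ?g (N + 0) \<le> A1 * growth \<tau> \<sigma> (exp 1 * max h (h powr (real (0 + 1) powr \<sigma>))) N"
      and "\<And>N. (real d / c) ^ N * ?g (N + 0) \<le> A2 * growth \<tau> \<sigma> (exp 1 * max h (h powr (real (0 + 1) powr \<sigma>))) N"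
      using growth_shift[OF \<tau> \<sigma> h] by metis
    then have g1: "(1 / (1 - c)) ^ N * ?g N \<le> A1 * ?G N" and g2: "(real d / c) ^ N * ?g N \<le> A2 * ?G N" for N
      using h A12 by (auto intro: order_trans[OF _ mult_left_mono[OF growth_mono[OF _ hH[OF h]]]])
    obtain A3 where A3: "A3 > 0" and g3: "\<And>N. (real d / c) ^ N * ?g (N + q) \<le> A3 * ?G N"
      using growth_shift[OF \<tau> \<sigma> h, of "real d / c" q] unfolding H_def by metis
    let ?W = "2 ^ (2 * d) * real d ^ (2 * d) * (B + (2 * a) ^ (2 * d) * (B * ?g (2 * d)))"
    let ?A' = "5 ^ d * (?W * A * A1 + C * 2 ^ q * real d ^ q * B * (A2 + b ^ q * A3))"
    have W: "?W > 0"
      using r(1) B growth_pos[OF h, of \<tau> \<sigma> "2 * d"]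
      by (intro mult_pos_pos add_pos_nonneg mult_nonneg_nonneg) (auto simp: a_def d_def)
    have p1: "0 \<le> ?W * A"
      by (rule mult_nonneg_nonneg[OF less_imp_le[OF W] less_imp_le[OF A]])
    have p2: "0 \<le> C * 2 ^ q * real d ^ q * B"
      using C B by (intro mult_nonneg_nonneg) auto
    have p3: "0 < ?W * A * A1" by (rule mult_pos_pos[OF mult_pos_pos[OF W A] A12(1)])
    have p4: "0 \<le> A2 + b ^ q * A3" using A12 A3 b by (intro add_nonneg_nonneg mult_nonneg_nonneg) auto
    have A': "?A' > 0"
      by (rule mult_pos_pos[OF _ add_pos_nonneg[OF p3 mult_nonneg_nonneg[OF p2 p4]]]) simp
    have main: "norm (fourier (mult_dist \<psi> u) \<xi>) \<le> ?A' * (?G N / norm \<xi> ^ N)"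
      if \<psi>: "smooth_fun \<psi>" "supp \<psi> \<subseteq> cball x0 (e / 2)"
        and D: "\<And>N i t. norm (pd (replicate N i) \<psi> t) \<le> B * ?g N" and \<xi>: "\<xi> \<in> \<Gamma>'" for \<psi> N \<xi>
    proof -
      have \<phi>1: "\<phi> t = 1" if "\<psi> t \<noteq> 0" for t
      proof -
        have "t \<in> cball x0 (e / 2)" using that not_in_supp \<psi>(2) by blast
        then show ?thesis using e by (intro e(2)) (simp add: dist_commute)
      qed
      have \<phi>\<psi>: "\<phi> t * \<psi> t = \<psi> t" for t using \<phi>1[of t] by auto
      have ra: "r < a" by (simp add: a_def)
      have s\<phi>: "supp \<phi> \<subseteq> cube r" using \<phi>(2) r(2) by blast
      \<comment> \<open>\<phi> is 1, hence nonzero, wherever \<psi> is nonzero. The cube chosen for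
        \<phi> therefore contains the support of every admissible \<psi>.\<close>
      have "supp \<psi> \<subseteq> supp \<phi>" unfolding supp_def using \<phi>1 by (intro closure_mono) auto
      then have s\<psi>: "supp \<psi> \<subseteq> cube r" using s\<phi> by blast
      \<comment> \<open>For N = 0 the list of derivatives is empty, so the coordinate may be
        arbitrary.\<close>
      have D0: "norm (\<psi> t) \<le> B" for t using D[of 0 undefined t] growth_0[OF h] by simp
      have pos: "norm \<xi> ^ N > 0" by (rule zero_less_power[OF conic_nhd_norm_pos[OF \<Gamma>' \<xi>]])
      have E: "norm (u (\<lambda>t. \<phi> t * wave \<eta> t)) * norm \<eta> ^ N \<le> A * ?g N" if "\<eta> \<in> \<Gamma>" for \<eta>
      proof -
        have "norm \<eta> ^ N > 0" by (rule zero_less_power[OF conic_nhd_norm_pos[OF \<Gamma> that]])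
        then show ?thesis
          using dec[OF that, of N] by (simp add: fourier_mult_dist pos_le_divide_eq)
      qed
      have "norm (u (\<lambda>t. \<psi> t * wave \<xi> t)) * norm \<xi> ^ N \<le> 5 ^ d * (?W * ((A * ?g N) * (1 / (1 - c)) ^ N)
          + C * (1 / c) ^ N * (2 ^ q * real d ^ (N + q) * (B * ?g N + b ^ q * (B * ?g (N + q)))))"
        unfolding q_def b_def d_def
        by (rule fourier_localised_cone_estimate[where \<Gamma> = \<Gamma>, OF u \<phi>(1) s\<phi> \<psi>(1) s\<psi> r(1) ra \<phi>\<psi> C Cm c
              cone[OF \<xi>] E D0 D D D])
      also have "\<dots> = 5 ^ d * (?W * A * ((1 / (1 - c)) ^ N * ?g N) +
          C * 2 ^ q * real d ^ q * B * ((real d / c) ^ N * ?g N + b ^ q * ((real d / c) ^ N * ?g (N + q))))"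
        by (simp add: power_add power_divide algebra_simps)
      also have "\<dots> \<le> 5 ^ d * (?W * A * (A1 * ?G N) +
          C * 2 ^ q * real d ^ q * B * (A2 * ?G N + b ^ q * (A3 * ?G N)))"
        using b by (intro mult_left_mono add_mono g1 g2 g3 p1 p2) auto
      also have "\<dots> = ?A' * ?G N" by (simp add: algebra_simps)
      finally show ?thesis
        using pos by (simp add: fourier_mult_dist pos_le_divide_eq)
    qed
    show "\<exists>A'>0. \<forall>\<psi>. smooth_fun \<psi> \<longrightarrow> supp \<psi> \<subseteq> cball x0 (e / 2) \<longrightarrow>
        (\<forall>N i t. norm (pd (replicate N i) \<psi> t) \<le> B * ?g N) \<longrightarrow>
        (\<forall>N. \<forall>\<xi>\<in>\<Gamma>'. norm (fourier (mult_dist \<psi> u) \<xi>) \<le> A' * (?G N / norm \<xi> ^ N))"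
      by (rule exI[of _ ?A']) (use A' main in blast)
  qed
qed

section \<open>Derivative bounds for members of the classes\<close>

lemma D_h_bound:
  assumes "\<phi> \<in> D_h \<tau> \<sigma> h K" "h > 0"
  obtains B where "B > 0" "\<And>N i t. norm (pd (replicate N i) \<phi> t) \<le> B * growth \<tau> \<sigma> h N"
proof -
  obtain M where M: "\<And>\<alpha> x. x \<in> K \<Longrightarrow> norm (multi_deriv \<alpha> \<phi> x) /
      (h powr (real (multi_abs \<alpha>) powr \<sigma>) * M_seq \<tau> \<sigma> (multi_abs \<alpha>)) \<le> M"
    using assms(1) unfolding D_h_def bdd_above_def by blast
  \<comment> \<open>The norm of \<open>D_h\<close> sees only points of K; elsewhere the derivatives
    vanish. The maximum with 1 makes the constant positive.\<close>
  have "norm (pd (replicate N i) \<phi> t) \<le> max 1 M * growth \<tau> \<sigma> h N" for N i t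
  proof (cases "t \<in> K")
    case True
    obtain \<alpha> where \<alpha>: "multi_abs \<alpha> = N" "pd (replicate N i) \<phi> = multi_deriv \<alpha> \<phi>"
      using pd_replicate_eq_multi_deriv[of N i] by metis
    have "norm (multi_deriv \<alpha> \<phi> t) / growth \<tau> \<sigma> h N \<le> M"
      using M[OF True, of \<alpha>] \<alpha>(1) by (simp add: growth_def)
    then have "norm (multi_deriv \<alpha> \<phi> t) / growth \<tau> \<sigma> h N \<le> max 1 M" by simp
    then show ?thesis
      using growth_pos[OF assms(2), of \<tau> \<sigma> N] by (simp add: \<alpha>(2) pos_divide_le_eq)
  next
    case False
    then have "t \<notin> supp \<phi>" using assms(1) by (auto simp: D_h_def)
    then have "pd (replicate N i) \<phi> t = 0" by (rule pd_outside_supp)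
    moreover have "0 \<le> max 1 M * growth \<tau> \<sigma> h N"
      using growth_pos[OF assms(2), of \<tau> \<sigma> N] by (intro mult_nonneg_nonneg) auto
    ultimately show ?thesis by simp
  qed
  then show ?thesis using that[of "max 1 M"] by auto
qed

lemma D_Roumieu_smooth: "\<phi> \<in> D_Roumieu \<tau> \<sigma> K \<Longrightarrow> smooth_fun \<phi> \<and> supp \<phi> \<subseteq> K"
  by (auto simp: D_Roumieu_def D_h_def)

lemma D_Beurling_smooth: "\<phi> \<in> D_Beurling \<tau> \<sigma> K \<Longrightarrow> smooth_fun \<phi> \<and> supp \<phi> \<subseteq> K"
  using D_Beurling_subset_Roumieu D_Roumieu_smooth by blast

lemma D_Roumieu_bound:
  assumes "\<phi> \<in> D_Roumieu \<tau> \<sigma> K"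
  obtains h B where "h > 0" "B > 0" "\<And>N i t. norm (pd (replicate N i) \<phi> t) \<le> B * growth \<tau> \<sigma> h N"
proof -
  obtain h where "h > 0" "\<phi> \<in> D_h \<tau> \<sigma> h K" using assms by (auto simp: D_Roumieu_def)
  then show ?thesis using D_h_bound that by metis
qed

lemma D_Beurling_bound:
  assumes "\<phi> \<in> D_Beurling \<tau> \<sigma> K" "h > 0"
  obtains B where "B > 0" "\<And>N i t. norm (pd (replicate N i) \<phi> t) \<le> B * growth \<tau> \<sigma> h N"
proof -
  have "\<phi> \<in> D_h \<tau> \<sigma> h K" using assms by (auto simp: D_Beurling_def)
  then show ?thesis using D_h_bound that assms(2) by metis
qed

section \<open>Windows and cutoffs near \<open>x0\<close>\<close>

lemma compact_nhd_cball:
  fixes x0 :: "real^'n::finite"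
  shows "r > 0 \<Longrightarrow> compact_nhd (cball x0 r) x0"
  by (simp add: compact_nhd_def regular_compact_def)

lemma compact_nhd_compact: "compact_nhd K x0 \<Longrightarrow> compact K"
  by (simp add: compact_nhd_def regular_compact_def)

lemma stft_eq_fourier: "stft \<phi> u x \<xi> = fourier (mult_dist (\<lambda>t. cnj (\<phi> (t - x))) u) \<xi>"
  by (simp add: stft_def translate_def[abs_def])

text \<open>The radius is shared: half of it bounds the support of the window around 0, the other
  half the distance of x from x0. Hence the STFT condition is proved on
  \<open>cball x0 (\<rho> / 2)\<close>.\<close>

lemma supp_cnj_translate:
  assumes "supp \<phi> \<subseteq> {y. y + x0 \<in> cball x0 (\<rho> / 2)}" "x \<in> cball x0 (\<rho> / 2)"
  shows "supp (\<lambda>t. cnj (\<phi> (t - x))) \<subseteq> cball x0 \<rho>"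
proof (rule supp_subset)
  fix t assume t: "t \<notin> cball x0 \<rho>"
  have "t - x \<notin> supp \<phi>"
  proof
    assume "t - x \<in> supp \<phi>"
    then have "norm (t - x) \<le> \<rho> / 2" using assms(1) by (auto simp: dist_norm)
    then have "dist x0 t \<le> \<rho> / 2 + \<rho> / 2"
      using assms(2) dist_triangle[of x0 t x] by (simp add: dist_norm norm_minus_commute)
    then show False using t by simp
  qed
  then show "cnj (\<phi> (t - x)) = 0" by (simp add: not_in_supp)
qed simp

text \<open>Two forms of one function: \<open>f\<close>, centred at 0, is a window for the STFT, and
  its conjugate translate is the localising factor that \<open>stft\<close> produces at
  \<open>x = x0\<close>.\<close>

lemma cutoff_exists:
  fixes x0 :: "real^'n::finite"
  assumes "x0 \<in> interior K" "\<tau> > 0" "\<sigma> > 1"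
  obtains f where "f \<in> D_Beurling \<tau> \<sigma> {y. y + x0 \<in> K}"
    "(\<lambda>t. cnj (f (t - x0))) \<in> D_Beurling \<tau> \<sigma> K" "\<forall>\<^sub>F x in nhds x0. cnj (f (x - x0)) = 1"
proof -
  obtain e where e: "e > 0" "ball x0 e \<subseteq> K" using assms(1) by (auto simp: mem_interior)
  \<comment> \<open>The cutoff lives on the cube of half side 2r, whose points have l1 norm at most
    \<open>2 * r * CARD('n) = e / 2\<close>, below the radius e.\<close>
  define r where "r = e / (4 * real CARD('n))"
  have r: "r > 0" using e(1) by (simp add: r_def)
  obtain \<Phi> :: "real^'n \<Rightarrow> complex" where \<Phi>: "tame \<Phi>"
    "\<And>x. (\<And>i. \<bar>x $ i\<bar> \<le> r) \<Longrightarrow> \<Phi> x = 1" "\<And>x i. \<bar>x $ i\<bar> \<ge> 2 * r \<Longrightarrow> \<Phi> x = 0"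
    "\<And>x. cnj (\<Phi> x) = \<Phi> x"
    using tame_cutoff[OF r] by metis
  have K: "x + x0 \<in> K" if "x \<in> cube (2 * r)" for x
  proof -
    have "norm x \<le> (\<Sum>i\<in>UNIV. \<bar>x $ i\<bar>)" by (rule norm_le_l1_cart)
    also have "\<dots> \<le> (\<Sum>i\<in>(UNIV :: 'n set). 2 * r)" using that by (intro sum_mono) (simp add: mem_cube)
    also have "\<dots> < e" using e(1) by (simp add: r_def)
    finally show ?thesis using e(2) by (auto simp: dist_norm subset_iff)
  qed
  have out: "\<Phi> x = 0" if "x \<notin> cube (2 * r)" for x
  proof -
    obtain i where "2 * r < \<bar>x $ i\<bar>" using \<open>x \<notin> cube (2 * r)\<close> by (auto simp: mem_cube not_le)
    then show ?thesis by (intro \<Phi>(3)[of x i]) simp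
  qed
  have closed: "closed (cube (2 * r) :: (real^'n) set)" by (rule compact_imp_closed[OF compact_cube])
  show ?thesis
  proof
    have "supp \<Phi> \<subseteq> cube (2 * r)" by (rule supp_subset[OF closed out])
    then show "\<Phi> \<in> D_Beurling \<tau> \<sigma> {y. y + x0 \<in> K}"
      using K by (intro tame_imp_D_Beurling[OF \<Phi>(1) _ assms(2,3)]) auto
    have tame: "tame (\<lambda>t. cnj (\<Phi> (t - x0)))"
      using \<Phi>(1) unfolding tame_def by (auto simp: pd_cnj_translate)
    have "supp (\<lambda>t. cnj (\<Phi> (t - x0))) \<subseteq> (\<lambda>x. x0 + x) ` cube (2 * r)"
    proof (rule supp_subset)
      show "closed ((\<lambda>x. x0 + x) ` cube (2 * r))" by (rule closed_translation[OF closed])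
      fix t assume "t \<notin> (\<lambda>x. x0 + x) ` cube (2 * r)"
      moreover have "t = x0 + (t - x0)" by simp
      ultimately have "t - x0 \<notin> cube (2 * r)" by (metis imageI)
      then show "cnj (\<Phi> (t - x0)) = 0" by (simp add: out)
    qed
    also have "\<dots> \<subseteq> K" using K by (auto simp: add.commute)
    finally show "(\<lambda>t. cnj (\<Phi> (t - x0))) \<in> D_Beurling \<tau> \<sigma> K"
      by (rule tame_imp_D_Beurling[OF tame _ assms(2,3)])
    show "\<forall>\<^sub>F x in nhds x0. cnj (\<Phi> (x - x0)) = 1"
      unfolding eventually_nhds_metric
    proof (intro exI[of _ r] conjI r allI impI)
      fix x assume x: "dist x x0 < r"
      have "\<bar>(x - x0) $ i\<bar> \<le> r" for i
        using component_le_norm_cart[of "x - x0" i] x by (simp add: dist_norm)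
      then show "cnj (\<Phi> (x - x0)) = 1" by (simp add: \<Phi>(2,4))
    qed
  qed
qed

section \<open>Decay in powers and decay by the associated function\<close>

lemma exp_assoc_decay:
  assumes "\<tau> > 0" "\<sigma> > 1" "h > 0" "conic_nhd \<Gamma> \<xi>0" "\<xi> \<in> \<Gamma>" "A > 0"
    and "F \<le> A * exp (- assoc_fun \<tau> \<sigma> h (norm \<xi>))"
  shows "F \<le> A * (growth \<tau> \<sigma> (1 / h) N / norm \<xi> ^ N)"
proof -
  have "norm \<xi> > 0" by (rule conic_nhd_norm_pos[OF assms(4,5)])
  then have "exp (- assoc_fun \<tau> \<sigma> h (norm \<xi>)) \<le> growth \<tau> \<sigma> (1 / h) N / norm \<xi> ^ N"
    using assms by (intro exp_assoc_fun_le)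
  then have "A * exp (- assoc_fun \<tau> \<sigma> h (norm \<xi>)) \<le> A * (growth \<tau> \<sigma> (1 / h) N / norm \<xi> ^ N)"
    using assms(6) by (intro mult_left_mono) auto
  then show ?thesis using assms(7) by linarith
qed

lemma decay_exp_assoc:
  assumes "h > 0" "conic_nhd \<Gamma> \<xi>0" "\<xi> \<in> \<Gamma>" "A > 0"
    and "\<And>N. norm z \<le> A * (growth \<tau> \<sigma> h N / norm \<xi> ^ N)"
  shows "norm z \<le> A * exp (- assoc_fun \<tau> \<sigma> (1 / h) (norm \<xi>))"
proof (rule norm_le_exp_assoc_fun)
  show "norm \<xi> > 0" by (rule conic_nhd_norm_pos[OF assms(2,3)])
qed (use assms in auto)

lemma growth_bound_mono:
  assumes "0 < h" "h \<le> h'" "0 \<le> B" "x \<le> B * (growth \<tau> \<sigma> h N / y ^ N)" "0 \<le> y"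
  shows "x \<le> B * (growth \<tau> \<sigma> h' N / y ^ N)"
  using assms(4) mult_left_mono[OF divide_right_mono[OF growth_mono[OF assms(1,2)] zero_le_power[OF assms(5)]] assms(3)]
  by (rule order_trans)

text \<open>\<phi> u and \<psi> come with different parameters. Enlarging a parameter weakens either
  bound, so both are brought to the maximum of the two; the resulting \<open>h'\<close> depends on h
  but not on \<psi>.\<close>

lemma Roumieu_microlocal:
  fixes u :: "(real^'n::finite \<Rightarrow> complex) \<Rightarrow> complex"
  assumes u: "distribution u" and \<tau>: "\<tau> > 0" and \<sigma>: "\<sigma> > 1"
    and \<Gamma>: "conic_nhd \<Gamma> \<xi>0" and K: "compact_nhd K x0" and \<phi>: "\<phi> \<in> D_Roumieu \<tau> \<sigma> K"
    and one: "\<forall>\<^sub>F x in nhds x0. \<phi> x = 1" and dec: "decay_Roumieu \<tau> \<sigma> \<Gamma> (fourier (mult_dist \<phi> u))"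
  obtains \<Gamma>' \<rho> where "conic_nhd \<Gamma>' \<xi>0" "\<rho> > 0"
    "\<And>h B. h > 0 \<Longrightarrow> B > 0 \<Longrightarrow> \<exists>A>0. \<exists>h'>0. \<forall>\<psi>. smooth_fun \<psi> \<longrightarrow> supp \<psi> \<subseteq> cball x0 \<rho> \<longrightarrow>
        (\<forall>N i t. norm (pd (replicate N i) \<psi> t) \<le> B * growth \<tau> \<sigma> h N) \<longrightarrow>
        (\<forall>N. \<forall>\<xi>\<in>\<Gamma>'. norm (fourier (mult_dist \<psi> u) \<xi>) \<le> A * (growth \<tau> \<sigma> h' N / norm \<xi> ^ N))"
proof -
  from microlocal_estimate[OF u \<tau> \<sigma> \<Gamma> conjunct1[OF D_Roumieu_smooth[OF \<phi>]] conjunct2[OF D_Roumieu_smooth[OF \<phi>]]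
    compact_nhd_compact[OF K] one]
  obtain \<Gamma>' \<rho> H where m: "conic_nhd \<Gamma>' \<xi>0" "\<rho> > 0" "\<And>h. h > 0 \<Longrightarrow> H h > (0::real)"
    and est: "\<And>h A B. h > 0 \<Longrightarrow> A > 0 \<Longrightarrow> B > 0 \<Longrightarrow>
      (\<And>N \<xi>. \<xi> \<in> \<Gamma> \<Longrightarrow> norm (fourier (mult_dist \<phi> u) \<xi>) \<le> A * (growth \<tau> \<sigma> h N / norm \<xi> ^ N)) \<Longrightarrow>
      \<exists>A'>0. \<forall>\<psi>. smooth_fun \<psi> \<longrightarrow> supp \<psi> \<subseteq> cball x0 \<rho> \<longrightarrow>
        (\<forall>N i t. norm (pd (replicate N i) \<psi> t) \<le> B * growth \<tau> \<sigma> h N) \<longrightarrow>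
        (\<forall>N. \<forall>\<xi>\<in>\<Gamma>'. norm (fourier (mult_dist \<psi> u) \<xi>) \<le> A' * (growth \<tau> \<sigma> (H h) N / norm \<xi> ^ N))"
    by metis
  obtain A0 h0 where A0: "A0 > 0" "h0 > 0"
    "\<And>N \<xi>. \<xi> \<in> \<Gamma> \<Longrightarrow> norm (fourier (mult_dist \<phi> u) \<xi>) \<le> A0 * (growth \<tau> \<sigma> h0 N / norm \<xi> ^ N)"
    using dec unfolding decay_Roumieu_def growth_def[symmetric] by blast
  show ?thesis
  proof
    fix h B :: real assume h: "h > 0" and B: "B > 0"
    let ?h = "max h h0"
    have "norm (fourier (mult_dist \<phi> u) \<xi>) \<le> A0 * (growth \<tau> \<sigma> ?h N / norm \<xi> ^ N)" if "\<xi> \<in> \<Gamma>" for N \<xi>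
      by (rule growth_bound_mono[OF A0(2) _ _ A0(3)[OF that]]) (use A0 in auto)
    from est[OF _ A0(1) B this] h obtain A' where A': "A' > 0"
      "\<And>\<psi> N \<xi>. smooth_fun \<psi> \<Longrightarrow> supp \<psi> \<subseteq> cball x0 \<rho> \<Longrightarrow>
        (\<And>N i t. norm (pd (replicate N i) \<psi> t) \<le> B * growth \<tau> \<sigma> ?h N) \<Longrightarrow> \<xi> \<in> \<Gamma>' \<Longrightarrow>
        norm (fourier (mult_dist \<psi> u) \<xi>) \<le> A' * (growth \<tau> \<sigma> (H ?h) N / norm \<xi> ^ N)"
      by (auto simp: less_max_iff_disj)
    have "B * growth \<tau> \<sigma> h N \<le> B * growth \<tau> \<sigma> ?h N" for N
      using B h by (intro mult_left_mono growth_mono) auto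
    note le = this
    show "\<exists>A>0. \<exists>h'>0. \<forall>\<psi>. smooth_fun \<psi> \<longrightarrow> supp \<psi> \<subseteq> cball x0 \<rho> \<longrightarrow>
        (\<forall>N i t. norm (pd (replicate N i) \<psi> t) \<le> B * growth \<tau> \<sigma> h N) \<longrightarrow>
        (\<forall>N. \<forall>\<xi>\<in>\<Gamma>'. norm (fourier (mult_dist \<psi> u) \<xi>) \<le> A * (growth \<tau> \<sigma> h' N / norm \<xi> ^ N))"
    proof (rule exI[of _ A'], rule conjI[OF A'(1)], intro exI[of _ "H ?h"] conjI allI impI ballI)
      show "H ?h > 0" using h by (intro m(3)) (simp add: less_max_iff_disj)
    next
      fix \<psi> N \<xi> assume "smooth_fun \<psi>" "supp \<psi> \<subseteq> cball x0 \<rho>" "\<xi> \<in> \<Gamma>'"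
        and "\<forall>N i t. norm (pd (replicate N i) \<psi> t) \<le> B * growth \<tau> \<sigma> h N"
      moreover from this(4) have "norm (pd (replicate N i) \<psi> t) \<le> B * growth \<tau> \<sigma> ?h N" for N i t
        using le order_trans by blast
      ultimately show "norm (fourier (mult_dist \<psi> u) \<xi>) \<le> A' * (growth \<tau> \<sigma> (H ?h) N / norm \<xi> ^ N)"
        by (intro A'(2)) auto
    qed
  qed (use m in auto)
qed

text \<open>The target parameter comes first, then h, then B: a Beurling function has its own bound
  B for each h, so h has to be fixed without reference to B.\<close>

lemma Beurling_microlocal:
  fixes u :: "(real^'n::finite \<Rightarrow> complex) \<Rightarrow> complex"
  assumes u: "distribution u" and \<tau>: "\<tau> > 0" and \<sigma>: "\<sigma> > 1"
    and \<Gamma>: "conic_nhd \<Gamma> \<xi>0" and K: "compact_nhd K x0" and \<phi>: "\<phi> \<in> D_Beurling \<tau> \<sigma> K"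
    and one: "\<forall>\<^sub>F x in nhds x0. \<phi> x = 1" and dec: "decay_Beurling \<tau> \<sigma> \<Gamma> (fourier (mult_dist \<phi> u))"
  obtains \<Gamma>' \<rho> where "conic_nhd \<Gamma>' \<xi>0" "\<rho> > 0"
    "\<And>h'. h' > 0 \<Longrightarrow> \<exists>h>0. \<forall>B>0. \<exists>A>0. \<forall>\<psi>. smooth_fun \<psi> \<longrightarrow> supp \<psi> \<subseteq> cball x0 \<rho> \<longrightarrow>
        (\<forall>N i t. norm (pd (replicate N i) \<psi> t) \<le> B * growth \<tau> \<sigma> h N) \<longrightarrow>
        (\<forall>N. \<forall>\<xi>\<in>\<Gamma>'. norm (fourier (mult_dist \<psi> u) \<xi>) \<le> A * (growth \<tau> \<sigma> h' N / norm \<xi> ^ N))"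
proof -
  from microlocal_estimate[OF u \<tau> \<sigma> \<Gamma> conjunct1[OF D_Beurling_smooth[OF \<phi>]] conjunct2[OF D_Beurling_smooth[OF \<phi>]]
    compact_nhd_compact[OF K] one]
  obtain \<Gamma>' \<rho> H where m: "conic_nhd \<Gamma>' \<xi>0" "\<rho> > 0" and H: "\<And>h. 0 < h \<Longrightarrow> h \<le> 1 \<Longrightarrow> H h = exp 1 * h"
    and est: "\<And>h A B. h > 0 \<Longrightarrow> A > 0 \<Longrightarrow> B > 0 \<Longrightarrow>
      (\<And>N \<xi>. \<xi> \<in> \<Gamma> \<Longrightarrow> norm (fourier (mult_dist \<phi> u) \<xi>) \<le> A * (growth \<tau> \<sigma> h N / norm \<xi> ^ N)) \<Longrightarrow>
      \<exists>A'>0. \<forall>\<psi>. smooth_fun \<psi> \<longrightarrow> supp \<psi> \<subseteq> cball x0 \<rho> \<longrightarrow>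
        (\<forall>N i t. norm (pd (replicate N i) \<psi> t) \<le> B * growth \<tau> \<sigma> h N) \<longrightarrow>
        (\<forall>N. \<forall>\<xi>\<in>\<Gamma>'. norm (fourier (mult_dist \<psi> u) \<xi>) \<le> A' * (growth \<tau> \<sigma> (H h) N / norm \<xi> ^ N))"
    by metis
  show ?thesis
  proof
    fix h' :: real assume h': "h' > 0"
    \<comment> \<open>For \<open>h \<le> 1\<close> the estimate loses exactly the factor
      \<open>exp 1\<close>, so this h gives \<open>H h \<le> h'\<close>.\<close>
    define h where "h = min 1 (h' / exp 1)"
    have h: "h > 0" "h \<le> 1" using h' by (auto simp: h_def)
    have "exp 1 * h \<le> exp 1 * (h' / exp 1)" by (intro mult_left_mono) (auto simp: h_def)
    then have Hh: "0 < H h" "H h \<le> h'" using H[OF h] h(1) by auto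
    obtain A0 where A0: "A0 > 0"
      "\<And>N \<xi>. \<xi> \<in> \<Gamma> \<Longrightarrow> norm (fourier (mult_dist \<phi> u) \<xi>) \<le> A0 * (growth \<tau> \<sigma> h N / norm \<xi> ^ N)"
      using dec h(1) unfolding decay_Beurling_def growth_def[symmetric] by blast
    show "\<exists>h>0. \<forall>B>0. \<exists>A>0. \<forall>\<psi>. smooth_fun \<psi> \<longrightarrow> supp \<psi> \<subseteq> cball x0 \<rho> \<longrightarrow>
        (\<forall>N i t. norm (pd (replicate N i) \<psi> t) \<le> B * growth \<tau> \<sigma> h N) \<longrightarrow>
        (\<forall>N. \<forall>\<xi>\<in>\<Gamma>'. norm (fourier (mult_dist \<psi> u) \<xi>) \<le> A * (growth \<tau> \<sigma> h' N / norm \<xi> ^ N))"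
    proof (rule exI[of _ h], intro conjI h(1) allI impI)
      fix B :: real assume "B > 0"
      from est[OF h(1) A0(1) this A0(2)] obtain A' where A': "A' > 0"
        "\<And>\<psi> N \<xi>. smooth_fun \<psi> \<Longrightarrow> supp \<psi> \<subseteq> cball x0 \<rho> \<Longrightarrow>
          (\<And>N i t. norm (pd (replicate N i) \<psi> t) \<le> B * growth \<tau> \<sigma> h N) \<Longrightarrow> \<xi> \<in> \<Gamma>' \<Longrightarrow>
          norm (fourier (mult_dist \<psi> u) \<xi>) \<le> A' * (growth \<tau> \<sigma> (H h) N / norm \<xi> ^ N)"
        by auto
      show "\<exists>A>0. \<forall>\<psi>. smooth_fun \<psi> \<longrightarrow> supp \<psi> \<subseteq> cball x0 \<rho> \<longrightarrow>
          (\<forall>N i t. norm (pd (replicate N i) \<psi> t) \<le> B * growth \<tau> \<sigma> h N) \<longrightarrow>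
          (\<forall>N. \<forall>\<xi>\<in>\<Gamma>'. norm (fourier (mult_dist \<psi> u) \<xi>) \<le> A * (growth \<tau> \<sigma> h' N / norm \<xi> ^ N))"
        by (intro exI[of _ A'] conjI A'(1) allI impI ballI growth_bound_mono[OF Hh _ A'(2)]) (use A'(1) in auto)
    qed
  qed (use m in auto)
qed

theorem theorem4p1:
  fixes u :: "(real^'n::finite \<Rightarrow> complex) \<Rightarrow> complex"
    and \<tau> \<sigma> :: real and x0 \<xi>0 :: "real^'n"
  assumes "distribution u" and "\<tau> > 0" and "\<sigma> > 1" and "\<xi>0 \<noteq> 0"
  shows
    "(((x0, \<xi>0) \<notin> WF_Roumieu \<tau> \<sigma> u \<longleftrightarrow>
        (\<exists>\<Gamma> K. conic_nhd \<Gamma> \<xi>0 \<and> compact_nhd K x0 \<and>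
          (\<forall>\<phi>\<in>D_Roumieu \<tau> \<sigma> K. \<exists>A>0. \<exists>h>0. \<forall>N::nat. \<forall>\<xi>\<in>\<Gamma>.
             norm (fourier (mult_dist \<phi> u) \<xi>)
               \<le> A * (h powr (real N powr \<sigma>) * M_seq \<tau> \<sigma> N / norm \<xi> ^ N)))) \<and>
      ((x0, \<xi>0) \<notin> WF_Roumieu \<tau> \<sigma> u \<longleftrightarrow>
        (\<exists>\<Gamma> K. conic_nhd \<Gamma> \<xi>0 \<and> compact_nhd K x0 \<and>
          (\<forall>\<phi>\<in>D_Roumieu \<tau> \<sigma> {y. y + x0 \<in> K}. \<exists>A>0. \<exists>h>0. \<forall>x\<in>K. \<forall>\<xi>\<in>\<Gamma>.
             norm (stft \<phi> u x \<xi>) \<le> A * exp (- assoc_fun \<tau> \<sigma> h (norm \<xi>)))))) \<and>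
     (((x0, \<xi>0) \<notin> WF_Beurling \<tau> \<sigma> u \<longleftrightarrow>
        (\<exists>\<Gamma> K. conic_nhd \<Gamma> \<xi>0 \<and> compact_nhd K x0 \<and>
          (\<forall>\<phi>\<in>D_Beurling \<tau> \<sigma> K. \<forall>h>0. \<exists>A>0. \<forall>N::nat. \<forall>\<xi>\<in>\<Gamma>.
             norm (fourier (mult_dist \<phi> u) \<xi>)
               \<le> A * (h powr (real N powr \<sigma>) * M_seq \<tau> \<sigma> N / norm \<xi> ^ N)))) \<and>
      ((x0, \<xi>0) \<notin> WF_Beurling \<tau> \<sigma> u \<longleftrightarrow>
        (\<exists>\<Gamma> K. conic_nhd \<Gamma> \<xi>0 \<and> compact_nhd K x0 \<and>
          (\<forall>\<phi>\<in>D_Beurling \<tau> \<sigma> {y. y + x0 \<in> K}. \<forall>h>0. \<exists>A>0. \<forall>x\<in>K. \<forall>\<xi>\<in>\<Gamma>.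
             norm (stft \<phi> u x \<xi>) \<le> A * exp (- assoc_fun \<tau> \<sigma> h (norm \<xi>))))))"
proof -
  note G = growth_def[symmetric]
  let ?Roumieu_cutoff = "\<exists>\<Gamma> K. conic_nhd \<Gamma> \<xi>0 \<and> compact_nhd K x0 \<and>
         (\<exists>\<phi>\<in>D_Roumieu \<tau> \<sigma> K. (\<forall>\<^sub>F x in nhds x0. \<phi> x = 1) \<and>
            decay_Roumieu \<tau> \<sigma> \<Gamma> (fourier (mult_dist \<phi> u)))"
  let ?Roumieu_fourier = "\<exists>\<Gamma> K. conic_nhd \<Gamma> \<xi>0 \<and> compact_nhd K x0 \<and>
          (\<forall>\<phi>\<in>D_Roumieu \<tau> \<sigma> K. \<exists>A>0. \<exists>h>0. \<forall>N::nat. \<forall>\<xi>\<in>\<Gamma>.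
             norm (fourier (mult_dist \<phi> u) \<xi>) \<le> A * (growth \<tau> \<sigma> h N / norm \<xi> ^ N))"
  let ?Roumieu_stft = "\<exists>\<Gamma> K. conic_nhd \<Gamma> \<xi>0 \<and> compact_nhd K x0 \<and>
          (\<forall>\<phi>\<in>D_Roumieu \<tau> \<sigma> {y. y + x0 \<in> K}. \<exists>A>0. \<exists>h>0. \<forall>x\<in>K. \<forall>\<xi>\<in>\<Gamma>.
             norm (stft \<phi> u x \<xi>) \<le> A * exp (- assoc_fun \<tau> \<sigma> h (norm \<xi>)))"
  let ?Beurling_cutoff = "\<exists>\<Gamma> K. conic_nhd \<Gamma> \<xi>0 \<and> compact_nhd K x0 \<and>
         (\<exists>\<phi>\<in>D_Beurling \<tau> \<sigma> K. (\<forall>\<^sub>F x in nhds x0. \<phi> x = 1) \<and>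
            decay_Beurling \<tau> \<sigma> \<Gamma> (fourier (mult_dist \<phi> u)))"
  let ?Beurling_fourier = "\<exists>\<Gamma> K. conic_nhd \<Gamma> \<xi>0 \<and> compact_nhd K x0 \<and>
          (\<forall>\<phi>\<in>D_Beurling \<tau> \<sigma> K. \<forall>h>0. \<exists>A>0. \<forall>N::nat. \<forall>\<xi>\<in>\<Gamma>.
             norm (fourier (mult_dist \<phi> u) \<xi>) \<le> A * (growth \<tau> \<sigma> h N / norm \<xi> ^ N))"
  let ?Beurling_stft = "\<exists>\<Gamma> K. conic_nhd \<Gamma> \<xi>0 \<and> compact_nhd K x0 \<and>
          (\<forall>\<phi>\<in>D_Beurling \<tau> \<sigma> {y. y + x0 \<in> K}. \<forall>h>0. \<exists>A>0. \<forall>x\<in>K. \<forall>\<xi>\<in>\<Gamma>.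
             norm (stft \<phi> u x \<xi>) \<le> A * exp (- assoc_fun \<tau> \<sigma> h (norm \<xi>)))"
  note u = assms(1) and \<tau> = assms(2) and \<sigma> = assms(3)
  have R1: "(x0, \<xi>0) \<notin> WF_Roumieu \<tau> \<sigma> u \<longleftrightarrow> ?Roumieu_cutoff"
    and B1: "(x0, \<xi>0) \<notin> WF_Beurling \<tau> \<sigma> u \<longleftrightarrow> ?Beurling_cutoff"
    using assms(4) by (simp_all add: WF_Roumieu_def WF_Beurling_def)
  have smooth_translate: "smooth_fun (\<lambda>t. cnj (\<phi> (t - x)))"
    "norm (pd is (\<lambda>t. cnj (\<phi> (t - x))) t) = norm (pd is \<phi> (t - x))" if "smooth_fun \<phi>" for \<phi> :: "real^'n \<Rightarrow> complex" and x t and "is"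
    using that by (simp_all add: pd_cnj_translate)
  \<comment> \<open>One cone and one radius serve both conclusions: the uniform estimate is applied
    to a single function of the class for the Fourier condition, and to all translates of the
    conjugate window for the STFT condition.\<close>
  have Rc: "?Roumieu_fourier \<and> ?Roumieu_stft" if ?Roumieu_cutoff
  proof -
    from that obtain \<Gamma> K \<phi> where "conic_nhd \<Gamma> \<xi>0" "compact_nhd K x0" "\<phi> \<in> D_Roumieu \<tau> \<sigma> K"
      "\<forall>\<^sub>F x in nhds x0. \<phi> x = 1" "decay_Roumieu \<tau> \<sigma> \<Gamma> (fourier (mult_dist \<phi> u))" by blast
    from Roumieu_microlocal[OF u \<tau> \<sigma> this] obtain \<Gamma>' \<rho> where \<Gamma>': "conic_nhd \<Gamma>' \<xi>0" and \<rho>: "\<rho> > 0"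
      and est: "\<And>h B. h > 0 \<Longrightarrow> B > 0 \<Longrightarrow> \<exists>A>0. \<exists>h'>0. \<forall>\<psi>. smooth_fun \<psi> \<longrightarrow> supp \<psi> \<subseteq> cball x0 \<rho> \<longrightarrow>
        (\<forall>N i t. norm (pd (replicate N i) \<psi> t) \<le> B * growth \<tau> \<sigma> h N) \<longrightarrow>
        (\<forall>N. \<forall>\<xi>\<in>\<Gamma>'. norm (fourier (mult_dist \<psi> u) \<xi>) \<le> A * (growth \<tau> \<sigma> h' N / norm \<xi> ^ N))"
      by metis
    have ?Roumieu_fourier
    proof (rule exI[of _ \<Gamma>'], rule exI[of _ "cball x0 \<rho>"], intro conjI ballI)
      fix \<psi> assume \<psi>: "\<psi> \<in> D_Roumieu \<tau> \<sigma> (cball x0 \<rho>)"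
      obtain h B where hB: "h > 0" "B > 0" "\<And>N i t. norm (pd (replicate N i) \<psi> t) \<le> B * growth \<tau> \<sigma> h N"
        using D_Roumieu_bound[OF \<psi>] by metis
      from est[OF hB(1,2)] show "\<exists>A>0. \<exists>h>0. \<forall>N::nat. \<forall>\<xi>\<in>\<Gamma>'.
             norm (fourier (mult_dist \<psi> u) \<xi>) \<le> A * (growth \<tau> \<sigma> h N / norm \<xi> ^ N)"
        using D_Roumieu_smooth[OF \<psi>] hB(3) by blast
    qed (use \<Gamma>' \<rho> in \<open>auto intro!: compact_nhd_cball\<close>)
    moreover have ?Roumieu_stft
    proof (rule exI[of _ \<Gamma>'], rule exI[of _ "cball x0 (\<rho> / 2)"], intro conjI ballI)
      fix \<psi> assume \<psi>: "\<psi> \<in> D_Roumieu \<tau> \<sigma> {y. y + x0 \<in> cball x0 (\<rho> / 2)}"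
      obtain h B where hB: "h > 0" "B > 0" "\<And>N i t. norm (pd (replicate N i) \<psi> t) \<le> B * growth \<tau> \<sigma> h N"
        using D_Roumieu_bound[OF \<psi>] by metis
      from est[OF hB(1,2)] obtain A h' where A: "A > 0" "h' > 0" and
        le: "\<And>f N \<xi>. smooth_fun f \<Longrightarrow> supp f \<subseteq> cball x0 \<rho> \<Longrightarrow>
          (\<And>N i t. norm (pd (replicate N i) f t) \<le> B * growth \<tau> \<sigma> h N) \<Longrightarrow> \<xi> \<in> \<Gamma>' \<Longrightarrow>
          norm (fourier (mult_dist f u) \<xi>) \<le> A * (growth \<tau> \<sigma> h' N / norm \<xi> ^ N)"
        by blast
      \<comment> \<open>\<open>A\<close> and \<open>h'\<close> were fixed before x, so the bound is
        uniform in x; infimum over N turns the parameter \<open>h'\<close> into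
        \<open>1 / h'\<close>.\<close>
      have "norm (stft \<psi> u x \<xi>) \<le> A * exp (- assoc_fun \<tau> \<sigma> (1 / h') (norm \<xi>))"
        if "x \<in> cball x0 (\<rho> / 2)" "\<xi> \<in> \<Gamma>'" for x \<xi>
        unfolding stft_eq_fourier using that(2) conjunct1[OF D_Roumieu_smooth[OF \<psi>]] hB(3)
        by (intro decay_exp_assoc[OF A(2) \<Gamma>' that(2) A(1)] le
            supp_cnj_translate[OF conjunct2[OF D_Roumieu_smooth[OF \<psi>]] that(1)])
          (simp_all add: smooth_translate)
      moreover have "1 / h' > 0" using A by simp
      ultimately show "\<exists>A>0. \<exists>h>0. \<forall>x\<in>cball x0 (\<rho> / 2). \<forall>\<xi>\<in>\<Gamma>'.
             norm (stft \<psi> u x \<xi>) \<le> A * exp (- assoc_fun \<tau> \<sigma> h (norm \<xi>))"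
        using A(1) by blast
    qed (use \<Gamma>' \<rho> in \<open>auto intro!: compact_nhd_cball\<close>)
    ultimately show ?thesis ..
  qed
  have Rf: ?Roumieu_cutoff if ?Roumieu_fourier
  proof -
    from that obtain \<Gamma> K where 1: "conic_nhd \<Gamma> \<xi>0" and K: "compact_nhd K x0"
      and dec: "\<And>\<phi>. \<phi> \<in> D_Roumieu \<tau> \<sigma> K \<Longrightarrow> decay_Roumieu \<tau> \<sigma> \<Gamma> (fourier (mult_dist \<phi> u))"
      unfolding decay_Roumieu_def G by blast
    obtain f where g: "(\<lambda>t. cnj (f (t - x0))) \<in> D_Beurling \<tau> \<sigma> K" "\<forall>\<^sub>F x in nhds x0. cnj (f (x - x0)) = 1"
      using cutoff_exists[OF _ \<tau> \<sigma>, of x0 K] K unfolding compact_nhd_def by metis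
    have g': "(\<lambda>t. cnj (f (t - x0))) \<in> D_Roumieu \<tau> \<sigma> K"
      by (rule subsetD[OF D_Beurling_subset_Roumieu g(1)])
    show ?thesis
      by (rule exI[of _ \<Gamma>], rule exI[of _ K], intro conjI 1 K bexI[of _ "\<lambda>t. cnj (f (t - x0))"] g(2) dec g')
  qed
  have Rs: ?Roumieu_cutoff if ?Roumieu_stft
  proof -
    from that obtain \<Gamma> K where 1: "conic_nhd \<Gamma> \<xi>0" and K: "compact_nhd K x0"
      and dec: "\<And>\<phi>. \<phi> \<in> D_Roumieu \<tau> \<sigma> {y. y + x0 \<in> K} \<Longrightarrow> \<exists>A>0. \<exists>h>0. \<forall>x\<in>K. \<forall>\<xi>\<in>\<Gamma>.
             norm (stft \<phi> u x \<xi>) \<le> A * exp (- assoc_fun \<tau> \<sigma> h (norm \<xi>))" by blast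
    obtain f where f: "f \<in> D_Beurling \<tau> \<sigma> {y. y + x0 \<in> K}" and
      g: "(\<lambda>t. cnj (f (t - x0))) \<in> D_Beurling \<tau> \<sigma> K" "\<forall>\<^sub>F x in nhds x0. cnj (f (x - x0)) = 1"
      using cutoff_exists[OF _ \<tau> \<sigma>, of x0 K] K unfolding compact_nhd_def by metis
    have x0: "x0 \<in> K" using K interior_subset by (auto simp: compact_nhd_def)
    obtain A h where A: "A > 0" "h > 0" "\<And>x \<xi>. x \<in> K \<Longrightarrow> \<xi> \<in> \<Gamma> \<Longrightarrow>
        norm (stft f u x \<xi>) \<le> A * exp (- assoc_fun \<tau> \<sigma> h (norm \<xi>))"
      using dec[OF subsetD[OF D_Beurling_subset_Roumieu f]] by blast
    \<comment> \<open>At the single point \<open>x = x0\<close> the STFT is the Fourier transform of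
      the cutoff \<open>\<lambda>t. cnj (f (t - x0))\<close> times u.\<close>
    have dec': "decay_Roumieu \<tau> \<sigma> \<Gamma> (fourier (mult_dist (\<lambda>t. cnj (f (t - x0))) u))"
      unfolding decay_Roumieu_def G
    proof (intro exI conjI allI ballI)
      show "norm (fourier (mult_dist (\<lambda>t. cnj (f (t - x0))) u) \<xi>) \<le> A * (growth \<tau> \<sigma> (1 / h) N / norm \<xi> ^ N)"
        if "\<xi> \<in> \<Gamma>" for N \<xi>
        using exp_assoc_decay[OF \<tau> \<sigma> A(2) 1 that A(1) A(3)[OF x0 that]] by (simp add: stft_eq_fourier)
    qed (use A in auto)
    show ?thesis
      by (rule exI[of _ \<Gamma>], rule exI[of _ K], intro conjI 1 K bexI[of _ "\<lambda>t. cnj (f (t - x0))"] g(2) dec'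
          subsetD[OF D_Beurling_subset_Roumieu g(1)])
  qed
  have Bc: "?Beurling_fourier \<and> ?Beurling_stft" if ?Beurling_cutoff
  proof -
    from that obtain \<Gamma> K \<phi> where "conic_nhd \<Gamma> \<xi>0" "compact_nhd K x0" "\<phi> \<in> D_Beurling \<tau> \<sigma> K"
      "\<forall>\<^sub>F x in nhds x0. \<phi> x = 1" "decay_Beurling \<tau> \<sigma> \<Gamma> (fourier (mult_dist \<phi> u))" by blast
    from Beurling_microlocal[OF u \<tau> \<sigma> this] obtain \<Gamma>' \<rho> where \<Gamma>': "conic_nhd \<Gamma>' \<xi>0" and \<rho>: "\<rho> > 0"
      and est: "\<And>h'. h' > 0 \<Longrightarrow> \<exists>h>0. \<forall>B>0. \<exists>A>0. \<forall>\<psi>. smooth_fun \<psi> \<longrightarrow> supp \<psi> \<subseteq> cball x0 \<rho> \<longrightarrow>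
        (\<forall>N i t. norm (pd (replicate N i) \<psi> t) \<le> B * growth \<tau> \<sigma> h N) \<longrightarrow>
        (\<forall>N. \<forall>\<xi>\<in>\<Gamma>'. norm (fourier (mult_dist \<psi> u) \<xi>) \<le> A * (growth \<tau> \<sigma> h' N / norm \<xi> ^ N))"
      by metis
    have ?Beurling_fourier
    proof (rule exI[of _ \<Gamma>'], rule exI[of _ "cball x0 \<rho>"], intro conjI ballI allI impI)
      fix \<psi> and h' :: real assume \<psi>: "\<psi> \<in> D_Beurling \<tau> \<sigma> (cball x0 \<rho>)" and "h' > 0"
      from est[OF this(2)] obtain h where h: "h > 0" and
        le: "\<And>B. B > 0 \<Longrightarrow> \<exists>A>0. \<forall>\<psi>. smooth_fun \<psi> \<longrightarrow> supp \<psi> \<subseteq> cball x0 \<rho> \<longrightarrow>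
        (\<forall>N i t. norm (pd (replicate N i) \<psi> t) \<le> B * growth \<tau> \<sigma> h N) \<longrightarrow>
        (\<forall>N. \<forall>\<xi>\<in>\<Gamma>'. norm (fourier (mult_dist \<psi> u) \<xi>) \<le> A * (growth \<tau> \<sigma> h' N / norm \<xi> ^ N))"
        by blast
      obtain B where B: "B > 0" "\<And>N i t. norm (pd (replicate N i) \<psi> t) \<le> B * growth \<tau> \<sigma> h N"
        using D_Beurling_bound[OF \<psi> h] by metis
      from le[OF B(1)] show "\<exists>A>0. \<forall>N::nat. \<forall>\<xi>\<in>\<Gamma>'.
             norm (fourier (mult_dist \<psi> u) \<xi>) \<le> A * (growth \<tau> \<sigma> h' N / norm \<xi> ^ N)"
        using D_Beurling_smooth[OF \<psi>] B(2) by blast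
    qed (use \<Gamma>' \<rho> in \<open>auto intro!: compact_nhd_cball\<close>)
    moreover have ?Beurling_stft
    proof (rule exI[of _ \<Gamma>'], rule exI[of _ "cball x0 (\<rho> / 2)"], intro conjI ballI allI impI)
      fix \<psi> and h' :: real assume \<psi>: "\<psi> \<in> D_Beurling \<tau> \<sigma> {y. y + x0 \<in> cball x0 (\<rho> / 2)}" and h': "h' > 0"
      \<comment> \<open>The target is \<open>1 / h'\<close>, so that the passage to the associated
        function, which inverts the parameter, ends at \<open>h'\<close>.\<close>
      from est[of "1 / h'"] h' obtain h where h: "h > 0" and
        le: "\<And>B. B > 0 \<Longrightarrow> \<exists>A>0. \<forall>\<psi>. smooth_fun \<psi> \<longrightarrow> supp \<psi> \<subseteq> cball x0 \<rho> \<longrightarrow>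
        (\<forall>N i t. norm (pd (replicate N i) \<psi> t) \<le> B * growth \<tau> \<sigma> h N) \<longrightarrow>
        (\<forall>N. \<forall>\<xi>\<in>\<Gamma>'. norm (fourier (mult_dist \<psi> u) \<xi>) \<le> A * (growth \<tau> \<sigma> (1 / h') N / norm \<xi> ^ N))"
        by auto
      obtain B where B: "B > 0" "\<And>N i t. norm (pd (replicate N i) \<psi> t) \<le> B * growth \<tau> \<sigma> h N"
        using D_Beurling_bound[OF \<psi> h] by metis
      from le[OF B(1)] obtain A where A: "A > 0" and
        le: "\<And>f N \<xi>. smooth_fun f \<Longrightarrow> supp f \<subseteq> cball x0 \<rho> \<Longrightarrow>
          (\<And>N i t. norm (pd (replicate N i) f t) \<le> B * growth \<tau> \<sigma> h N) \<Longrightarrow> \<xi> \<in> \<Gamma>' \<Longrightarrow>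
          norm (fourier (mult_dist f u) \<xi>) \<le> A * (growth \<tau> \<sigma> (1 / h') N / norm \<xi> ^ N)"
        by blast
      have "norm (stft \<psi> u x \<xi>) \<le> A * exp (- assoc_fun \<tau> \<sigma> (1 / (1 / h')) (norm \<xi>))"
        if "x \<in> cball x0 (\<rho> / 2)" "\<xi> \<in> \<Gamma>'" for x \<xi>
        unfolding stft_eq_fourier using that(2) conjunct1[OF D_Beurling_smooth[OF \<psi>]] B(2) h'
        by (intro decay_exp_assoc[OF _ \<Gamma>' that(2) A] le
            supp_cnj_translate[OF conjunct2[OF D_Beurling_smooth[OF \<psi>]] that(1)])
          (simp_all add: smooth_translate)
      then show "\<exists>A>0. \<forall>x\<in>cball x0 (\<rho> / 2). \<forall>\<xi>\<in>\<Gamma>'.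
             norm (stft \<psi> u x \<xi>) \<le> A * exp (- assoc_fun \<tau> \<sigma> h' (norm \<xi>))"
        using A by (intro exI[of _ A]) auto
    qed (use \<Gamma>' \<rho> in \<open>auto intro!: compact_nhd_cball\<close>)
    ultimately show ?thesis ..
  qed
  have Bf: ?Beurling_cutoff if ?Beurling_fourier
  proof -
    from that obtain \<Gamma> K where 1: "conic_nhd \<Gamma> \<xi>0" and K: "compact_nhd K x0"
      and dec: "\<And>\<phi>. \<phi> \<in> D_Beurling \<tau> \<sigma> K \<Longrightarrow> decay_Beurling \<tau> \<sigma> \<Gamma> (fourier (mult_dist \<phi> u))"
      unfolding decay_Beurling_def G by blast
    obtain f where g: "(\<lambda>t. cnj (f (t - x0))) \<in> D_Beurling \<tau> \<sigma> K" "\<forall>\<^sub>F x in nhds x0. cnj (f (x - x0)) = 1"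
      using cutoff_exists[OF _ \<tau> \<sigma>, of x0 K] K unfolding compact_nhd_def by metis
    show ?thesis
      by (rule exI[of _ \<Gamma>], rule exI[of _ K], intro conjI 1 K bexI[of _ "\<lambda>t. cnj (f (t - x0))"] g dec)
  qed
  have Bs: ?Beurling_cutoff if ?Beurling_stft
  proof -
    from that obtain \<Gamma> K where 1: "conic_nhd \<Gamma> \<xi>0" and K: "compact_nhd K x0"
      and dec: "\<And>\<phi> h. \<phi> \<in> D_Beurling \<tau> \<sigma> {y. y + x0 \<in> K} \<Longrightarrow> h > 0 \<Longrightarrow> \<exists>A>0. \<forall>x\<in>K. \<forall>\<xi>\<in>\<Gamma>.
             norm (stft \<phi> u x \<xi>) \<le> A * exp (- assoc_fun \<tau> \<sigma> h (norm \<xi>))" by blast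
    obtain f where f: "f \<in> D_Beurling \<tau> \<sigma> {y. y + x0 \<in> K}" and
      g: "(\<lambda>t. cnj (f (t - x0))) \<in> D_Beurling \<tau> \<sigma> K" "\<forall>\<^sub>F x in nhds x0. cnj (f (x - x0)) = 1"
      using cutoff_exists[OF _ \<tau> \<sigma>, of x0 K] K unfolding compact_nhd_def by metis
    have x0: "x0 \<in> K" using K interior_subset by (auto simp: compact_nhd_def)
    have dec': "decay_Beurling \<tau> \<sigma> \<Gamma> (fourier (mult_dist (\<lambda>t. cnj (f (t - x0))) u))"
      unfolding decay_Beurling_def G
    proof (intro allI impI)
      \<comment> \<open>In the other direction the parameter is inverted too, so the STFT bound is
        taken at \<open>1 / h\<close>.\<close>
      fix h :: real assume "h > 0"
      then have h: "1 / h > 0" by simp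
      obtain A where A: "A > 0" "\<And>x \<xi>. x \<in> K \<Longrightarrow> \<xi> \<in> \<Gamma> \<Longrightarrow>
          norm (stft f u x \<xi>) \<le> A * exp (- assoc_fun \<tau> \<sigma> (1 / h) (norm \<xi>))"
        using dec[OF f h] by blast
      show "\<exists>A>0. \<forall>N. \<forall>\<xi>\<in>\<Gamma>. norm (fourier (mult_dist (\<lambda>t. cnj (f (t - x0))) u) \<xi>)
          \<le> A * (growth \<tau> \<sigma> h N / norm \<xi> ^ N)"
      proof (intro exI conjI allI ballI)
        show "norm (fourier (mult_dist (\<lambda>t. cnj (f (t - x0))) u) \<xi>) \<le> A * (growth \<tau> \<sigma> h N / norm \<xi> ^ N)"
          if "\<xi> \<in> \<Gamma>" for N \<xi>
          using exp_assoc_decay[OF \<tau> \<sigma> h 1 that A(1) A(2)[OF x0 that]] by (simp add: stft_eq_fourier)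
      qed (use A in auto)
    qed
    show ?thesis
      by (rule exI[of _ \<Gamma>], rule exI[of _ K], intro conjI 1 K bexI[of _ "\<lambda>t. cnj (f (t - x0))"] g dec')
  qed
  show ?thesis
    unfolding R1 B1 G
    by (intro conjI iffI)
      (erule Rc[THEN conjunct1] Rc[THEN conjunct2] Rf Rs Bc[THEN conjunct1] Bc[THEN conjunct2] Bf Bs)+
qed

end
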